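(* Assume that the sequence of random variables $(g_n)_{n=1}^\infty$ satisfies, for some $c>0$, $$\limsup_{n\to\infty}\mathbb P(\{\omega\in\Omega:|g_n(\omega)|\le c\})<1.$$ Moreover, assume that $(h_k)_{k\in\mathbb Z^d}$ is i.i.d. with the Rademacher distribution. Let $1\le\beta\le\alpha<\infty$ and $\sigma\in\mathbb R$. Then $\langle\nabla\rangle^\sigma\gamma_0\langle\nabla\rangle^\sigma\in\mathfrak S^\alpha\setminus\mathfrak S^\beta$ implies $\langle\nabla\rangle^\sigma\gamma_0^{\omega,\widetilde\omega;\sigma}\langle\nabla\rangle^\sigma\in\mathfrak S^\alpha\setminus\mathfrak S^\beta$ for almost all $(\omega,\widetilde\omega)\in\Omega\times\widetilde\Omega$.
   Context: $\langle\nabla\rangle=(1-\Delta)^{1/2}$ on $\mathbb R^d$; $\mathcal F$ is the Fourier transform; $\mathfrak S^\alpha$ is the Schatten class on $L^2_x=L^2(\mathbb R^d;\mathbb C)$, $\|A\|_{\mathfrak S^\alpha}=(\mathrm{Tr}|A|^\alpha)^{1/\alpha}$. $(g_n)_{n\ge1}$ are independent mean-zero real-valued random variables on a probability space $(\Omega,\mathcal A,\mathbb P)$ with distributions $\mu_n$, such that for some $C_0>0$, $\int_{\mathbb R}e^{\zeta x}d\mu_n(x)\le e^{C_0\zeta^2}$ for all $\zeta\in\mathbb R$ and all $n$. The $h_k$ are random variables on another probability space $(\widetilde\Omega,\widetilde{\mathcal A},\widetilde{\mathbb P})$ (Rademacher: values $\pm1$ with probability $\frac12$ each). Wiener randomization: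 $\chi_k(\xi)=\mathbf 1_{[0,1]^d}(\xi-k)$, $\Pi_k=\mathcal F^{-1}\chi_k\mathcal F$, $\mathcal R^{\widetilde\omega}u=\sum_{k\in\mathbb Z^d}h_k(\widetilde\omega)\Pi_ku$. For compact $\gamma$ with (fixed) singular value decomposition $\gamma=\sum_na_n|u_n\rangle\langle v_n|$ ($a_n\ge0$, $(u_n),(v_n)$ orthonormal systems in $L^2_x$, $|f\rangle\langle g|(\phi)=\langle g|\phi\rangle f$), $\gamma^\omega=\sum_na_ng_n(\omega)|u_n\rangle\langle v_n|$ and $\gamma^{\omega,\widetilde\omega}=\mathcal R^{\widetilde\omega}\gamma^\omega\mathcal R^{\widetilde\omega}$. If $\langle\nabla\rangle^\sigma\gamma_0\langle\nabla\rangle^\sigma$ is compact, $\gamma_0^{\omega,\widetilde\omega;\sigma}=\langle\nabla\rangle^{-\sigma}(\langle\nabla\rangle^\sigma\gamma_0\langle\nabla\rangle^\sigma)^{\omega,\widetilde\omega}\langle\nabla\rangle^{-\sigma}$. *)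

theory Defs
  imports "HOL-Probability.Probability"
begin

section \<open>The complex Hilbert space of square-integrable functions\<close>

definition square_integrable :: "(real^'d \<Rightarrow> complex) \<Rightarrow> bool" where
  "square_integrable f \<longleftrightarrow>
     f \<in> borel_measurable lborel \<and> integrable lborel (\<lambda>x. (cmod (f x))\<^sup>2)"

lemma square_integrable_0: "square_integrable (\<lambda>x. 0)"
  by (simp add: square_integrable_def)

lemma square_integrable_scale:
  assumes "square_integrable f"
  shows "square_integrable (\<lambda>x. c * f x)"
  using assms by (auto simp: square_integrable_def norm_mult power_mult_distrib)

lemma square_integrable_add:
  assumes "square_integrable f" "square_integrable g"
  shows "square_integrable (\<lambda>x. f x + g x)"
proof -
  have [measurable]: "f \<in> borel_measurable lborel" "g \<in> borel_measurable lborel"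
    using assms by (auto simp: square_integrable_def)
  have "integrable lborel (\<lambda>x. 2 * (cmod (f x))\<^sup>2 + 2 * (cmod (g x))\<^sup>2)"
    using assms by (auto simp: square_integrable_def)
  then have "integrable lborel (\<lambda>x. (cmod (f x + g x))\<^sup>2)"
  proof (rule Bochner_Integration.integrable_bound)
    show "AE x in lborel. norm ((cmod (f x + g x))\<^sup>2)
        \<le> norm (2 * (cmod (f x))\<^sup>2 + 2 * (cmod (g x))\<^sup>2)"
    proof (intro AE_I2)
      fix x
      have "(cmod (f x + g x))\<^sup>2 \<le> (cmod (f x) + cmod (g x))\<^sup>2"
        by (intro power_mono norm_triangle_ineq) auto
      also have "\<dots> \<le> 2 * (cmod (f x))\<^sup>2 + 2 * (cmod (g x))\<^sup>2"
        using zero_le_power2[of "cmod (f x) - cmod (g x)"]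
        by (simp add: power2_eq_square algebra_simps)
      finally show "norm ((cmod (f x + g x))\<^sup>2)
          \<le> norm (2 * (cmod (f x))\<^sup>2 + 2 * (cmod (g x))\<^sup>2)"
        by simp
    qed
  qed measurable
  then show ?thesis by (auto simp: square_integrable_def)
qed

lemma square_integrable_mult:
  assumes "square_integrable f" "square_integrable g"
  shows "integrable lborel (\<lambda>x. cnj (f x) * g x)"
proof -
  have [measurable]: "f \<in> borel_measurable lborel" "g \<in> borel_measurable lborel"
    using assms by (auto simp: square_integrable_def)
  have m: "(\<lambda>x. cnj (f x) * g x) \<in> borel_measurable lborel"
    by (intro borel_measurable_times borel_measurable_continuous_on[of cnj]
        continuous_intros) measurable
  have "integrable lborel (\<lambda>x. (cmod (f x))\<^sup>2 + (cmod (g x))\<^sup>2)"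
    using assms by (auto simp: square_integrable_def)
  then show ?thesis
  proof (rule Bochner_Integration.integrable_bound[OF _ m])
    show "AE x in lborel. norm (cnj (f x) * g x) \<le> norm ((cmod (f x))\<^sup>2 + (cmod (g x))\<^sup>2)"
    proof (intro AE_I2)
      fix x
      have "2 * (cmod (f x) * cmod (g x)) \<le> (cmod (f x))\<^sup>2 + (cmod (g x))\<^sup>2"
        using zero_le_power2[of "cmod (f x) - cmod (g x)"]
        by (simp add: power2_eq_square algebra_simps)
      moreover have "0 \<le> cmod (f x) * cmod (g x)" by simp
      ultimately have "cmod (f x) * cmod (g x) \<le> (cmod (f x))\<^sup>2 + (cmod (g x))\<^sup>2"
        by linarith
      then show "norm (cnj (f x) * g x) \<le> norm ((cmod (f x))\<^sup>2 + (cmod (g x))\<^sup>2)"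
        by (simp add: norm_mult)
    qed
  qed
qed

quotient_type 'd L2 = "real^'d::finite \<Rightarrow> complex" /
  partial: "\<lambda>f g. square_integrable f \<and> square_integrable g \<and> (AE x in lborel. f x = g x)"
proof (rule part_equivpI)
  show "\<exists>f::real^'d \<Rightarrow> complex. square_integrable f \<and> square_integrable f \<and> (AE x in lborel. f x = f x)"
    using square_integrable_0 by auto
  show "symp (\<lambda>f g::real^'d \<Rightarrow> complex.
      square_integrable f \<and> square_integrable g \<and> (AE x in lborel. f x = g x))"
    by (auto intro!: sympI elim: AE_mp)
  show "transp (\<lambda>f g::real^'d \<Rightarrow> complex.
      square_integrable f \<and> square_integrable g \<and> (AE x in lborel. f x = g x))"
    by (auto intro!: transpI elim: AE_mp)
qed

lift_definition scaleC :: "complex \<Rightarrow> 'd::finite L2 \<Rightarrow> 'd L2" (infixr "*\<^sub>C" 75)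
  is "\<lambda>c f x. c * f x"
  by (auto intro: square_integrable_scale)

text \<open>Antilinear in the first argument, as in the bracket notation.\<close>

lift_definition cinner :: "'d::finite L2 \<Rightarrow> 'd L2 \<Rightarrow> complex"
  is "\<lambda>f g. \<integral>x. cnj (f x) * g x \<partial>lborel"
proof (elim conjE)
  fix f1 f2 g1 g2 :: "real^'d \<Rightarrow> complex"
  assume s: "square_integrable f1" "square_integrable f2"
      "square_integrable g1" "square_integrable g2"
    and ae: "AE x in lborel. f1 x = f2 x" "AE x in lborel. g1 x = g2 x"
  show "(\<integral>x. cnj (f1 x) * g1 x \<partial>lborel) = (\<integral>x. cnj (f2 x) * g2 x \<partial>lborel)"
  proof (rule integral_cong_AE)
    show "(\<lambda>x. cnj (f1 x) * g1 x) \<in> borel_measurable lborel"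
      using square_integrable_mult[OF s(1,3)] by auto
    show "(\<lambda>x. cnj (f2 x) * g2 x) \<in> borel_measurable lborel"
      using square_integrable_mult[OF s(2,4)] by auto
    show "AE x in lborel. cnj (f1 x) * g1 x = cnj (f2 x) * g2 x"
      using ae by eventually_elim simp
  qed
qed

instantiation L2 :: (finite) real_inner
begin

lift_definition zero_L2 :: "'a L2" is "\<lambda>x. 0"
  by (auto simp: square_integrable_0)

lift_definition plus_L2 :: "'a L2 \<Rightarrow> 'a L2 \<Rightarrow> 'a L2" is "\<lambda>f g x. f x + g x"
  by (auto intro: square_integrable_add)

definition scaleR_L2 :: "real \<Rightarrow> 'a L2 \<Rightarrow> 'a L2" where
  "scaleR_L2 r u = complex_of_real r *\<^sub>C u"

definition uminus_L2 :: "'a L2 \<Rightarrow> 'a L2" where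
  "uminus_L2 u = (- 1) *\<^sub>C u"

definition minus_L2 :: "'a L2 \<Rightarrow> 'a L2 \<Rightarrow> 'a L2" where
  "minus_L2 u v = u + - (v :: 'a L2)"

definition inner_L2 :: "'a L2 \<Rightarrow> 'a L2 \<Rightarrow> real" where
  "inner_L2 u v = Re (cinner u v)"

definition norm_L2 :: "'a L2 \<Rightarrow> real" where
  "norm_L2 u = sqrt (u \<bullet> u)"

definition dist_L2 :: "'a L2 \<Rightarrow> 'a L2 \<Rightarrow> real" where
  "dist_L2 u v = norm (u - v)"

definition sgn_L2 :: "'a L2 \<Rightarrow> 'a L2" where
  "sgn_L2 u = inverse (norm u) *\<^sub>R u"

definition uniformity_L2 :: "('a L2 \<times> 'a L2) filter" where
  "uniformity_L2 = (INF e\<in>{0 <..}. principal {(u, v :: 'a L2). dist u v < e})"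

definition open_L2 :: "'a L2 set \<Rightarrow> bool" where
  "open_L2 U = (\<forall>u\<in>U. eventually (\<lambda>(u', v). u' = u \<longrightarrow> v \<in> U) uniformity)"

instance
proof
  fix u v w :: "'a L2" and r s :: real
  show "u + v + w = u + (v + w)"
    by transfer (auto intro!: square_integrable_add simp: add.assoc)
  show "u + v = v + u"
    by transfer (auto intro!: square_integrable_add simp: add.commute)
  show "0 + u = u" by transfer auto
  show "- u + u = 0" unfolding uminus_L2_def
    by transfer (auto intro!: square_integrable_add square_integrable_0
        dest: square_integrable_scale[where c = "-1"])
  show "u - v = u + - v" by (simp add: minus_L2_def)
  show "r *\<^sub>R (u + v) = r *\<^sub>R u + r *\<^sub>R v" unfolding scaleR_L2_def
    by transfer (auto intro!: square_integrable_add square_integrable_scale simp: distrib_left distrib_right)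
  show "(r + s) *\<^sub>R u = r *\<^sub>R u + s *\<^sub>R u" unfolding scaleR_L2_def
    by transfer (auto intro!: square_integrable_add square_integrable_scale simp: distrib_left distrib_right)
  show "r *\<^sub>R s *\<^sub>R u = (r * s) *\<^sub>R u" unfolding scaleR_L2_def
    by transfer (auto intro!: square_integrable_scale simp: mult.assoc)
  show "1 *\<^sub>R u = u" unfolding scaleR_L2_def by transfer auto
  show "dist u v = norm (u - v)" by (simp add: dist_L2_def)
  show "sgn u = inverse (norm u) *\<^sub>R u" by (simp add: sgn_L2_def)
  show "uniformity = (INF e\<in>{0 <..}. principal {(u, v :: 'a L2). dist u v < e})"
    by (simp add: uniformity_L2_def)
  show "open U = (\<forall>u\<in>U. eventually (\<lambda>(u', v). u' = u \<longrightarrow> v \<in> U) uniformity)"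
    for U :: "'a L2 set"
    by (simp add: open_L2_def)
  have cnj: "cinner v u = cnj (cinner u v)"
  proof (transfer, elim conjE)
    fix f g :: "real^'a \<Rightarrow> complex"
    show "(\<integral>x. cnj (g x) * f x \<partial>lborel) = cnj (\<integral>x. cnj (f x) * g x \<partial>lborel)"
      by (subst Bochner_Integration.integral_cnj[symmetric]) (simp add: mult.commute)
  qed
  show "u \<bullet> v = v \<bullet> u" by (simp add: inner_L2_def cnj)
  have "cinner (u + v) w = cinner u w + cinner v w"
  proof (transfer, elim conjE)
    fix f g h :: "real^'a \<Rightarrow> complex"
    assume "square_integrable f" "square_integrable g" "square_integrable h"
    then show "(\<integral>x. cnj (f x + g x) * h x \<partial>lborel)
        = (\<integral>x. cnj (f x) * h x \<partial>lborel) + (\<integral>x. cnj (g x) * h x \<partial>lborel)"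
      by (simp add: distrib_right square_integrable_mult)
  qed
  then show "(u + v) \<bullet> w = u \<bullet> w + v \<bullet> w" by (simp add: inner_L2_def)
  have "cinner (r *\<^sub>R u) v = complex_of_real r * cinner u v"
    unfolding scaleR_L2_def by transfer (simp add: mult.assoc)
  then show "(r *\<^sub>R u) \<bullet> v = r * (u \<bullet> v)" by (simp add: inner_L2_def)
  have sq: "cnj z * z = complex_of_real ((cmod z)\<^sup>2)" for z
    by (metis complex_norm_square mult.commute of_real_power)
  have *: "0 \<le> Re (cinner u u) \<and> (Re (cinner u u) = 0 \<longleftrightarrow> u = 0)"
  proof (transfer, elim conjE)
    fix f :: "real^'a \<Rightarrow> complex"
    assume s: "square_integrable f"
    then have i: "integrable lborel (\<lambda>x. (cmod (f x))\<^sup>2)"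
      by (simp add: square_integrable_def)
    have "Re (\<integral>x. cnj (f x) * f x \<partial>lborel) = (\<integral>x. (cmod (f x))\<^sup>2 \<partial>lborel)"
      unfolding sq by (subst integral_complex_of_real) simp
    then show "0 \<le> Re (\<integral>x. cnj (f x) * f x \<partial>lborel) \<and>
        (Re (\<integral>x. cnj (f x) * f x \<partial>lborel) = 0 \<longleftrightarrow>
          square_integrable f \<and> square_integrable (\<lambda>x::real^'a. 0) \<and> (AE x in lborel. f x = 0))"
      using integral_nonneg_eq_0_iff_AE[OF i] s square_integrable_0 by auto
  qed
  show "0 \<le> u \<bullet> u" "(u \<bullet> u = 0) = (u = 0)" using * by (auto simp: inner_L2_def)
  show "norm u = sqrt (u \<bullet> u)" by (simp add: norm_L2_def)
qed

end


section \<open>Operators and Schatten classes\<close>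

definition L2_operator :: "('d::finite L2 \<Rightarrow> 'd L2) \<Rightarrow> bool" where
  "L2_operator A \<longleftrightarrow> bounded_linear A \<and> (\<forall>c u. A (c *\<^sub>C u) = c *\<^sub>C A u)"

definition compact_operator :: "('d::finite L2 \<Rightarrow> 'd L2) \<Rightarrow> bool" where
  "compact_operator A \<longleftrightarrow> L2_operator A \<and> compact (closure (A ` cball 0 1))"

definition adjoint_L2 :: "('d::finite L2 \<Rightarrow> 'd L2) \<Rightarrow> 'd L2 \<Rightarrow> 'd L2" where
  "adjoint_L2 A = (THE B. L2_operator B \<and> (\<forall>u v. cinner (B u) v = cinner u (A v)))"

text \<open>The operator \<open>|f\<rangle>\<langle>g|\<close>.\<close>

definition rank_one :: "'d::finite L2 \<Rightarrow> 'd L2 \<Rightarrow> 'd L2 \<Rightarrow> 'd L2" where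
  "rank_one f g = (\<lambda>\<phi>. cinner g \<phi> *\<^sub>C f)"

definition orthonormal_seq :: "(nat \<Rightarrow> 'd::finite L2) \<Rightarrow> bool" where
  "orthonormal_seq e \<longleftrightarrow> (\<forall>m n. cinner (e m) (e n) = (if m = n then 1 else 0))"

text \<open>Finite-rank operators are included by allowing \<open>a n = 0\<close>, every finite orthonormal
  system in the infinite-dimensional space \<^typ>\<open>'d::finite L2\<close> being extendable to a sequence.\<close>

definition svd :: "('d::finite L2 \<Rightarrow> 'd L2) \<Rightarrow> (nat \<Rightarrow> real) \<Rightarrow> (nat \<Rightarrow> 'd L2) \<Rightarrow> (nat \<Rightarrow> 'd L2) \<Rightarrow> bool"
  where
  "svd A a u v \<longleftrightarrow> (\<forall>n. 0 \<le> a n) \<and> orthonormal_seq u \<and> orthonormal_seq v \<and>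
     (\<forall>\<phi>. ((\<lambda>n. a n *\<^sub>R rank_one (u n) (v n) \<phi>) has_sum A \<phi>) UNIV)"

text \<open>Functional calculus for a compact positive operator: if \<open>P = \<Sum>\<^sub>n l\<^sub>n |e\<^sub>n\<rangle>\<langle>e\<^sub>n|\<close> is a
  spectral decomposition, then \<open>P\<^sup>s = \<Sum>\<^sub>n l\<^sub>n\<^sup>s |e\<^sub>n\<rangle>\<langle>e\<^sub>n|\<close>. Only used for \<open>s > 0\<close>.\<close>

definition op_powr :: "('d::finite L2 \<Rightarrow> 'd L2) \<Rightarrow> real \<Rightarrow> 'd L2 \<Rightarrow> 'd L2" where
  "op_powr P s = (THE Q. \<exists>l e. svd P l e e \<and> svd Q (\<lambda>n. l n powr s) e e)"

definition op_abs :: "('d::finite L2 \<Rightarrow> 'd L2) \<Rightarrow> 'd L2 \<Rightarrow> 'd L2" where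
  "op_abs A = op_powr (adjoint_L2 A \<circ> A) (1 / 2)"

definition orthonormal_basis :: "'d::finite L2 set \<Rightarrow> bool" where
  "orthonormal_basis B \<longleftrightarrow>
     (\<forall>b\<in>B. \<forall>c\<in>B. cinner b c = (if b = c then 1 else 0)) \<and>
     (\<forall>u. (\<forall>b\<in>B. cinner b u = 0) \<longrightarrow> u = 0)"

text \<open>The trace of a positive operator, with values in \<open>[0, \<infinity>]\<close>; it does not depend on the basis.\<close>

definition trace_pos :: "('d::finite L2 \<Rightarrow> 'd L2) \<Rightarrow> ennreal" where
  "trace_pos Q = (\<Sum>\<^sub>\<infinity>b\<in>(SOME B. orthonormal_basis B). ennreal (Re (cinner b (Q b))))"

definition schatten :: "real \<Rightarrow> ('d::finite L2 \<Rightarrow> 'd L2) set" where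
  "schatten \<alpha> = {A. compact_operator A \<and> trace_pos (op_powr (op_abs A) \<alpha>) < \<infinity>}"


section \<open>Fourier multipliers\<close>

definition fourier :: "(real^'d \<Rightarrow> complex) \<Rightarrow> real^'d::finite \<Rightarrow> complex" where
  "fourier f \<xi> = complex_of_real ((2 * pi) powr (- real CARD('d) / 2)) *
     (\<integral>x. cis (- (x \<bullet> \<xi>)) * f x \<partial>lborel)"

definition fourier_L2 :: "'d::finite L2 \<Rightarrow> 'd L2" where
  "fourier_L2 = (THE T. bounded_linear T \<and>
     (\<forall>f. integrable lborel f \<and> square_integrable f \<longrightarrow>
        square_integrable (fourier f) \<and> T (abs_L2 f) = abs_L2 (fourier f)))"

text \<open>The operator \<open>\<F>\<^sup>-\<^sup>1 m \<F>\<close>, meaningful on its domain only.\<close>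

definition multiplier_dom :: "(real^'d \<Rightarrow> complex) \<Rightarrow> 'd::finite L2 set" where
  "multiplier_dom m = {u. square_integrable (\<lambda>\<xi>. m \<xi> * rep_L2 (fourier_L2 u) \<xi>)}"

definition multiplier :: "(real^'d \<Rightarrow> complex) \<Rightarrow> 'd::finite L2 \<Rightarrow> 'd L2" where
  "multiplier m u = inv fourier_L2 (abs_L2 (\<lambda>\<xi>. m \<xi> * rep_L2 (fourier_L2 u) \<xi>))"

definition jb_symbol :: "real \<Rightarrow> real^'d::finite \<Rightarrow> complex" where
  "jb_symbol s \<xi> = complex_of_real ((1 + (norm \<xi>)\<^sup>2) powr (s / 2))"

definition jb :: "real \<Rightarrow> 'd::finite L2 \<Rightarrow> 'd L2" where
  "jb s = multiplier (jb_symbol s)"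

text \<open>\<open>H\<^sup>\<infinity> = \<Inter>\<^sub>s H\<^sup>s\<close>, which every power \<open>\<langle>\<nabla>\<rangle>\<^sup>s\<close> maps onto itself.\<close>

definition H_infty :: "'d::finite L2 set" where
  "H_infty = (\<Inter>s. multiplier_dom (jb_symbol s))"


section \<open>Operators between Sobolev spaces\<close>

text \<open>
  If \<open>\<langle>\<nabla>\<rangle>\<^sup>\<sigma> \<gamma> \<langle>\<nabla>\<rangle>\<^sup>\<sigma>\<close> is bounded on \<open>L\<^sup>2\<close>, then \<open>\<gamma>\<close> maps \<open>H\<^sup>-\<^sup>\<sigma>\<close> to \<open>H\<^sup>\<sigma>\<close>; unless
  \<open>\<sigma> = 0\<close>, one of these spaces is not contained in \<open>L\<^sup>2\<close>. So that all real \<open>\<sigma>\<close> can be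
  treated alike, \<open>\<gamma>\<close> is taken to be an operator from \<open>H\<^sup>\<infinity>\<close> to its antidual
  \<open>H\<^sup>-\<^sup>\<infinity> = \<Union>\<^sub>s H\<^sup>s\<close>: \<open>\<gamma> \<psi>\<close> is the antilinear functional \<open>\<phi> \<mapsto> \<langle>\<phi>|\<gamma> \<psi>\<rangle>\<close>, an element \<open>f\<close> of \<open>L\<^sup>2\<close>
  being identified with \<open>\<phi> \<mapsto> \<langle>\<phi>|f\<rangle>\<close>. Only the values at \<open>\<psi>, \<phi> \<in> H\<^sup>\<infinity>\<close> matter. Linearity and
  continuity are not built into the type; they hold automatically as soon as
  \<open>\<langle>\<nabla>\<rangle>\<^sup>\<sigma> \<gamma> \<langle>\<nabla>\<rangle>\<^sup>\<sigma>\<close> is given by an operator on \<open>L\<^sup>2\<close>.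
\<close>

type_synonym 'd sobolev_operator = "'d L2 \<Rightarrow> 'd L2 \<Rightarrow> complex"

text \<open>\<open>\<langle>\<nabla>\<rangle>\<^sup>s\<close> acts on \<open>H\<^sup>-\<^sup>\<infinity>\<close> by duality, \<open>\<langle>\<phi>|\<langle>\<nabla>\<rangle>\<^sup>s F\<rangle> = \<langle>\<langle>\<nabla>\<rangle>\<^sup>s \<phi>|F\<rangle>\<close>, its symbol being real.\<close>

definition jb_dual :: "real \<Rightarrow> ('d::finite L2 \<Rightarrow> complex) \<Rightarrow> 'd L2 \<Rightarrow> complex" where
  "jb_dual s F = (\<lambda>\<phi>. F (jb s \<phi>))"

definition jb_conj :: "real \<Rightarrow> 'd::finite sobolev_operator \<Rightarrow> 'd sobolev_operator" where
  "jb_conj s \<gamma> = (\<lambda>\<psi>. jb_dual s (\<gamma> (jb s \<psi>)))"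

definition of_L2_operator :: "('d::finite L2 \<Rightarrow> 'd L2) \<Rightarrow> 'd sobolev_operator" where
  "of_L2_operator A = (\<lambda>\<psi> \<phi>. cinner \<phi> (A \<psi>))"

definition extends_to :: "'d::finite sobolev_operator \<Rightarrow> ('d L2 \<Rightarrow> 'd L2) \<Rightarrow> bool" where
  "extends_to \<gamma> A \<longleftrightarrow> L2_operator A \<and>
     (\<forall>\<psi>\<in>H_infty. \<forall>\<phi>\<in>H_infty. \<gamma> \<psi> \<phi> = of_L2_operator A \<psi> \<phi>)"

definition L2_extension :: "'d::finite sobolev_operator \<Rightarrow> 'd L2 \<Rightarrow> 'd L2" where
  "L2_extension \<gamma> = (THE A. extends_to \<gamma> A)"

definition schatten_sobolev :: "real \<Rightarrow> 'd::finite sobolev_operator set" where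
  "schatten_sobolev \<alpha> = {\<gamma>. \<exists>A\<in>schatten \<alpha>. extends_to \<gamma> A}"


section \<open>Randomization\<close>

definition cube_cutoff :: "int^'d \<Rightarrow> real^'d::finite \<Rightarrow> complex" where
  "cube_cutoff k \<xi> = indicator (cbox 0 1) (\<xi> - (\<chi> i. real_of_int (k $ i)))"

definition wiener :: "(int^'d \<Rightarrow> real) \<Rightarrow> 'd::finite L2 \<Rightarrow> 'd L2" where
  "wiener h u = (\<Sum>\<^sub>\<infinity>k. h k *\<^sub>R multiplier (cube_cutoff k) u)"

definition randomize_sv ::
  "(nat \<Rightarrow> real) \<Rightarrow> (nat \<Rightarrow> 'd L2) \<Rightarrow> (nat \<Rightarrow> 'd L2) \<Rightarrow> (nat \<Rightarrow> real) \<Rightarrow> 'd::finite L2 \<Rightarrow> 'd L2" where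
  "randomize_sv a u v g \<phi> = (\<Sum>\<^sub>\<infinity>n. (a n * g n) *\<^sub>R rank_one (u n) (v n) \<phi>)"

definition randomize ::
  "(nat \<Rightarrow> real) \<Rightarrow> (nat \<Rightarrow> 'd L2) \<Rightarrow> (nat \<Rightarrow> 'd L2) \<Rightarrow> (nat \<Rightarrow> real) \<Rightarrow> (int^'d \<Rightarrow> real) \<Rightarrow>
    'd::finite L2 \<Rightarrow> 'd L2" where
  "randomize a u v g h = wiener h \<circ> randomize_sv a u v g \<circ> wiener h"

text \<open>\<open>\<gamma>\<^sub>0\<^sup>\<omega>\<^sup>,\<^sup>\<omega>\<^sup>'\<^sup>;\<^sup>\<sigma>\<close>, where \<open>a, u, v\<close> is the chosen singular value decomposition of
  \<open>\<langle>\<nabla>\<rangle>\<^sup>\<sigma> \<gamma>\<^sub>0 \<langle>\<nabla>\<rangle>\<^sup>\<sigma>\<close>, and \<open>g, h\<close> are the values of the random variables at \<open>\<omega>, \<omega>'\<close>.\<close>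

definition randomize_sobolev ::
  "real \<Rightarrow> (nat \<Rightarrow> real) \<Rightarrow> (nat \<Rightarrow> 'd L2) \<Rightarrow> (nat \<Rightarrow> 'd L2) \<Rightarrow> (nat \<Rightarrow> real) \<Rightarrow> (int^'d \<Rightarrow> real) \<Rightarrow>
    'd::finite sobolev_operator" where
  "randomize_sobolev \<sigma> a u v g h = jb_conj (- \<sigma>) (of_L2_operator (randomize a u v g h))"

definition rademacher :: "'b measure \<Rightarrow> ('b \<Rightarrow> real) \<Rightarrow> bool" where
  "rademacher N X \<longleftrightarrow> X \<in> borel_measurable N \<and>
     measure N {\<omega> \<in> space N. X \<omega> = 1} = 1 / 2 \<and> measure N {\<omega> \<in> space N. X \<omega> = - 1} = 1 / 2"

end

(*
  By Plancherel's theorem each cube projection is an orthogonal projection, so for signs h the Wiener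
  randomization W is a unitary self-adjoint involution. Hence the randomized operator is
  \<Sum>n. a n * g n * |W (u n)><W (v n)|, with singular values a n * \<bar>g n\<bar>, whatever the signs are, and
  the claim reduces to weighted series: subgaussian moments give \<Sum>n. (a n * \<bar>g n\<bar>) powr \<alpha> < \<infinity>
  almost surely, while independence and the lower bound on the probability of c < \<bar>g n\<bar> force
  \<Sum>n. (a n * \<bar>g n\<bar>) powr \<beta> = \<infinity> almost surely.
*)

theory Submission
  imports Defs
begin

section \<open>The complex Hilbert space structure\<close>

text \<open>Several notions are definite descriptions (\<open>fourier_L2\<close>,
  \<open>adjoint_L2\<close>, \<open>op_powr\<close>, \<open>L2_extension\<close>) or rest on a
  chosen basis (\<open>trace_pos\<close>). Each must be shown to exist and not to depend on choices
  before it can be computed; this is where completeness, Plancherel's theorem and the uniqueness of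
  operator powers enter. Afterwards every operator in sight is a series \<open>sv_op\<close>, and
  Schatten membership is summability of powers of its weights (\<open>schatten_svd_iff\<close>). The
  exponent \<sigma> disappears because conjugation by \<open>jb\<close> with opposite exponents
  cancels on the dense space \<open>H_infty\<close>. The values of \<open>g n\<close> along one path
  may be unbounded, so that the randomized series defines a bounded operator is not clear
  beforehand; boundedness and compactness are read off, path by path, from the summability of the
  \<alpha>-th powers. Divergence for \<beta> cannot be deduced from an infinite expectation. The
  Laplace transform of the partial sums is used instead: independence factors it, and it tends to
  0.\<close>

lemma square_integrable_rep [simp]: "square_integrable (rep_L2 u)"
  using Quotient_rep_reflp[OF Quotient_L2, of u] by simp

lemma abs_rep_L2 [simp]: "abs_L2 (rep_L2 u) = u"
  by (rule Quotient_abs_rep[OF Quotient_L2])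

lemma abs_L2_eq_iff:
  assumes "square_integrable f" "square_integrable g"
  shows "abs_L2 f = abs_L2 g \<longleftrightarrow> (AE x in lborel. f x = g x)"
  using Quotient_rel[OF Quotient_L2, of f g] assms by auto

lemma rep_abs_L2:
  assumes "square_integrable f"
  shows "AE x in lborel. rep_L2 (abs_L2 f) x = f x"
  using abs_L2_eq_iff[of "rep_L2 (abs_L2 f)" f] assms by simp

lemma L2_eqI:
  assumes "AE x in lborel. rep_L2 u x = rep_L2 v x"
  shows "u = v"
  using abs_L2_eq_iff[of "rep_L2 u" "rep_L2 v"] assms by simp

lemma borel_measurable_square_integrable:
  "square_integrable f \<Longrightarrow> f \<in> borel_measurable borel"
  by (simp add: square_integrable_def)

lemma borel_measurable_rep_L2 [measurable]: "rep_L2 u \<in> borel_measurable borel"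
  by (simp add: borel_measurable_square_integrable)

lemma abs_L2_add:
  "square_integrable f \<Longrightarrow> square_integrable g \<Longrightarrow>
    abs_L2 f + abs_L2 g = abs_L2 (\<lambda>x. f x + g x)"
  by (rule plus_L2.abs_eq) auto

lemma abs_L2_scaleC: "square_integrable f \<Longrightarrow> c *\<^sub>C abs_L2 f = abs_L2 (\<lambda>x. c * f x)"
  by (rule scaleC.abs_eq) auto

lemma cinner_abs_L2:
  "square_integrable f \<Longrightarrow> square_integrable g \<Longrightarrow>
    cinner (abs_L2 f) (abs_L2 g) = (\<integral>x. cnj (f x) * g x \<partial>lborel)"
  by (rule cinner.abs_eq) auto

lemma cinner_rep: "cinner u v = (\<integral>x. cnj (rep_L2 u x) * rep_L2 v x \<partial>lborel)"
  using cinner_abs_L2[of "rep_L2 u" "rep_L2 v"] by simp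

lemma cinner_commute: "cinner v u = cnj (cinner u v)"
  unfolding cinner_rep
  by (subst Bochner_Integration.integral_cnj[symmetric]) (simp add: mult.commute)

lemma cinner_add_left: "cinner (u + v) w = cinner u w + cinner v w"
proof (transfer, elim conjE)
  fix f g h :: "real^'a \<Rightarrow> complex"
  assume "square_integrable f" "square_integrable g" "square_integrable h"
  then show "(\<integral>x. cnj (f x + g x) * h x \<partial>lborel)
      = (\<integral>x. cnj (f x) * h x \<partial>lborel) + (\<integral>x. cnj (g x) * h x \<partial>lborel)"
    by (simp add: distrib_right square_integrable_mult)
qed

lemma cinner_add_right: "cinner w (u + v) = cinner w u + cinner w v"
  by (metis cinner_add_left cinner_commute complex_cnj_add)

lemma cinner_scaleC_left: "cinner (c *\<^sub>C u) v = cnj c * cinner u v"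
  by transfer (simp add: mult.assoc)

lemma cinner_scaleC_right: "cinner u (c *\<^sub>C v) = c * cinner u v"
  by (metis cinner_commute cinner_scaleC_left complex_cnj_cnj complex_cnj_mult)

lemma scaleC_add_right: "c *\<^sub>C (u + v) = c *\<^sub>C u + c *\<^sub>C v"
  by transfer (auto intro!: square_integrable_add square_integrable_scale simp: distrib_left)

lemma scaleC_add_left: "(c + d) *\<^sub>C u = c *\<^sub>C u + d *\<^sub>C u"
  by transfer (auto intro!: square_integrable_add square_integrable_scale simp: distrib_right)

lemma scaleC_scaleC [simp]: "c *\<^sub>C d *\<^sub>C u = (c * d) *\<^sub>C u"
  by transfer (auto intro!: square_integrable_scale simp: mult.assoc)

lemma scaleC_one [simp]: "1 *\<^sub>C u = u"
  by transfer auto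

lemma scaleC_of_real: "complex_of_real r *\<^sub>C u = r *\<^sub>R u"
  by (simp add: scaleR_L2_def)

lemma scaleC_zero_left [simp]: "0 *\<^sub>C u = 0"
  using scaleC_of_real[of 0 u] by simp

lemma scaleC_zero_right [simp]: "c *\<^sub>C 0 = 0"
  using scaleC_add_right[of c 0 0] by simp

lemma scaleC_scaleR: "c *\<^sub>C (r *\<^sub>R u) = r *\<^sub>R (c *\<^sub>C u)"
  unfolding scaleC_of_real[symmetric] by (simp add: mult.commute)

lemma cinner_scaleR_left: "cinner (r *\<^sub>R u) v = complex_of_real r * cinner u v"
  by (simp add: scaleC_of_real[symmetric] cinner_scaleC_left)

lemma cinner_scaleR_right: "cinner u (r *\<^sub>R v) = complex_of_real r * cinner u v"
  by (simp add: scaleC_of_real[symmetric] cinner_scaleC_right)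

lemma cinner_zero_left [simp]: "cinner 0 u = 0"
  using cinner_scaleC_left[of 0 0 u] by simp

lemma cinner_zero_right [simp]: "cinner u 0 = 0"
  using cinner_scaleC_right[of u 0 0] by simp

lemma cinner_diff_right: "cinner w (u - v) = cinner w u - cinner w v"
  by (metis add_diff_cancel diff_add_cancel cinner_add_right)

lemma cinner_self: "cinner u u = complex_of_real ((norm u)\<^sup>2)"
proof -
  have "Im (cinner u u) = 0"
    using cinner_commute[of u u] by (metis complex_cnj_cancel_iff Reals_cnj_iff complex_is_Real_iff)
  moreover have "Re (cinner u u) = (norm u)\<^sup>2"
    by (simp add: power2_norm_eq_inner inner_L2_def)
  ultimately show ?thesis by (simp add: complex_eq_iff)
qed

lemma norm_scaleC [simp]: "norm (c *\<^sub>C u) = cmod c * norm (u :: 'd::finite L2)"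
proof -
  have "complex_of_real ((norm (c *\<^sub>C u))\<^sup>2) = complex_of_real ((cmod c * norm u)\<^sup>2)"
    unfolding cinner_self[symmetric] cinner_scaleC_left cinner_scaleC_right power_mult_distrib
      of_real_mult complex_norm_square by (simp add: cinner_self)
  then have "(norm (c *\<^sub>C u))\<^sup>2 = (cmod c * norm u)\<^sup>2"
    by (simp only: of_real_eq_iff)
  then show ?thesis by (simp add: power2_eq_iff_nonneg)
qed

text \<open>Multiplying \<open>v\<close> by a phase of modulus one makes \<open>cinner u v\<close>
  real and nonnegative, which reduces the claim to the Cauchy-Schwarz inequality of the real inner
  product.\<close>

lemma cmod_cinner_le: "cmod (cinner u v) \<le> norm u * norm (v :: 'd::finite L2)"
proof (cases "cinner u v = 0")
  case False
  define s where "s = cnj (cinner u v) / complex_of_real (cmod (cinner u v))"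
  have s: "cmod s = 1" using False by (simp add: s_def norm_divide)
  have "cinner u (s *\<^sub>C v) = complex_of_real (cmod (cinner u v))"
    using False complex_norm_square[of "cinner u v"]
    by (simp add: s_def cinner_scaleC_right divide_simps power2_eq_square mult.commute)
  then have "cmod (cinner u v) = u \<bullet> (s *\<^sub>C v)" by (simp add: inner_L2_def)
  also have "\<dots> \<le> norm u * norm (s *\<^sub>C v)" by (rule norm_cauchy_schwarz)
  finally show ?thesis by (simp add: s)
qed simp

text \<open>Supplies continuity in each argument, used below to pull inner products through limits
  and \<open>has_sum\<close> series.\<close>

interpretation cinner: bounded_bilinear "cinner :: 'd::finite L2 \<Rightarrow> _"
proof
  show "\<exists>K. \<forall>a b :: 'd L2. cmod (cinner a b) \<le> norm a * norm b * K"
    by (intro exI[of _ 1] allI) (simp add: cmod_cinner_le)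
qed (simp_all add: cinner_add_left cinner_add_right cinner_scaleR_left cinner_scaleR_right
      scaleR_conv_of_real)

interpretation scaleC: bounded_bilinear "scaleC :: complex \<Rightarrow> 'd::finite L2 \<Rightarrow> _"
proof
  show "\<exists>K. \<forall>a. \<forall>b :: 'd L2. norm (a *\<^sub>C b) \<le> norm a * norm b * K"
    by (intro exI[of _ 1]) simp
qed (simp_all add: scaleC_add_left scaleC_add_right scaleC_scaleR scaleC_of_real[symmetric]
      scaleR_conv_of_real mult.commute)

lemma cinner_ext:
  assumes "\<And>w. cinner w u = cinner w v"
  shows "u = v"
  using assms[of "u - v"] cinner_self[of "u - v"] by (simp add: cinner_diff_right)

section \<open>Norms computed from representatives, and completeness\<close>

lemma norm_L2_rep_square: "(norm u)\<^sup>2 = (\<integral>x. (cmod (rep_L2 u x))\<^sup>2 \<partial>lborel)"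
proof -
  have "cnj z * z = complex_of_real ((cmod z)\<^sup>2)" for z
    by (metis complex_norm_square mult.commute of_real_power)
  then have "cinner u u = complex_of_real (\<integral>x. (cmod (rep_L2 u x))\<^sup>2 \<partial>lborel)"
    unfolding cinner_rep by (subst integral_complex_of_real[symmetric]) simp
  then show ?thesis by (simp only: cinner_self of_real_eq_iff)
qed

lemma nn_integral_rep_L2:
  "(\<integral>\<^sup>+x. ennreal ((cmod (rep_L2 u x))\<^sup>2) \<partial>lborel) = ennreal ((norm u)\<^sup>2)"
  using square_integrable_rep[of u] unfolding square_integrable_def norm_L2_rep_square
  by (intro nn_integral_eq_integral) auto

lemma nn_integral_abs_L2:
  assumes "square_integrable f"
  shows "(\<integral>\<^sup>+x. ennreal ((cmod (f x))\<^sup>2) \<partial>lborel) = ennreal ((norm (abs_L2 f))\<^sup>2)"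
  unfolding nn_integral_rep_L2[symmetric]
  by (intro nn_integral_cong_AE) (use rep_abs_L2[OF assms] in eventually_elim, simp)

lemma norm_abs_L2_square:
  assumes "square_integrable f"
  shows "(norm (abs_L2 f))\<^sup>2 = (\<integral>x. (cmod (f x))\<^sup>2 \<partial>lborel)"
proof -
  have [measurable]: "f \<in> borel_measurable borel"
    using assms by (rule borel_measurable_square_integrable)
  show ?thesis unfolding norm_L2_rep_square
    by (intro integral_cong_AE) (measurable, use rep_abs_L2[OF assms] in eventually_elim, simp)
qed

lemma square_integrable_nn_integral:
  assumes "f \<in> borel_measurable borel" "(\<integral>\<^sup>+x. ennreal ((cmod (f x))\<^sup>2) \<partial>lborel) < \<infinity>"
  shows "square_integrable f"
  using assms unfolding square_integrable_def by (auto intro!: integrableI_bounded)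

lemma rep_L2_diff: "AE x in lborel. rep_L2 (u - v) x = rep_L2 u x - rep_L2 v x"
proof -
  have s: "square_integrable (\<lambda>x. rep_L2 u x + (-1) * rep_L2 v x)"
    by (intro square_integrable_add square_integrable_scale) auto
  have "u - v = abs_L2 (\<lambda>x. rep_L2 u x + (-1) * rep_L2 v x)"
    using abs_L2_add[of "rep_L2 u" "\<lambda>x. (-1) * rep_L2 v x"] abs_L2_scaleC[of "rep_L2 v" "-1"]
      square_integrable_scale[of "rep_L2 v" "-1"] scaleC_of_real[of "-1" v]
    by simp
  then show ?thesis using rep_abs_L2[OF s] by simp
qed

lemma rep_L2_add: "AE x in lborel. rep_L2 (u + v) x = rep_L2 u x + rep_L2 v x"
proof -
  have s: "square_integrable (\<lambda>x. rep_L2 u x + rep_L2 v x)"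
    by (intro square_integrable_add) auto
  have "u + v = abs_L2 (\<lambda>x. rep_L2 u x + rep_L2 v x)"
    using abs_L2_add[of "rep_L2 u" "rep_L2 v"] by simp
  then show ?thesis using rep_abs_L2[OF s] by simp
qed

lemma rep_L2_scaleC: "AE x in lborel. rep_L2 (c *\<^sub>C u) x = c * rep_L2 u x"
  using rep_abs_L2[OF square_integrable_scale[of "rep_L2 u" c]] abs_L2_scaleC[of "rep_L2 u" c]
  by simp

text \<open>Riesz--Fischer: along a rapidly Cauchy subsequence the differences \<open>d n\<close> satisfy
  \<open>\<Sum>n. 4 ^ n * \<bar>d n\<bar>\<^sup>2 < \<infinity>\<close> almost everywhere, so the representatives converge pointwise, and Fatou's
  lemma turns this into convergence in norm.\<close>

lemma L2_Cauchy_convergent: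
  fixes X :: "nat \<Rightarrow> 'd::finite L2"
  assumes "Cauchy X"
  shows "convergent X"
proof -
  have "\<exists>N. \<forall>m\<ge>N. \<forall>m'\<ge>N. norm (X m - X m') < (1/4) ^ n" for n
    using assms unfolding Cauchy_def dist_norm by (auto dest!: spec[of _ "(1/4) ^ n"])
  then obtain N where N: "\<And>n m m'. m \<ge> N n \<Longrightarrow> m' \<ge> N n \<Longrightarrow> norm (X m - X m') < (1/4) ^ n"
    by metis
  \<comment> \<open>Summing the thresholds makes \<open>r n\<close> at least as large as each of
    \<open>N 0\<close>, ..., \<open>N n\<close>.\<close>
  define r where "r n = (\<Sum>i\<le>n. N i)" for n
  have rN: "N m \<le> r n" if "m \<le> n" for m n
    unfolding r_def using that by (intro member_le_sum) auto
  define f where "f n = rep_L2 (X (r n))" for n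
  define d where "d n x = f (Suc n) x - f n x" for n x
  have [measurable]: "f n \<in> borel_measurable borel" for n by (simp add: f_def)
  have [measurable]: "d n \<in> borel_measurable borel" for n unfolding d_def by measurable
  have nn_diff: "(\<integral>\<^sup>+x. ennreal ((cmod (rep_L2 u x - rep_L2 v x))\<^sup>2) \<partial>lborel) = ennreal ((norm (u - v))\<^sup>2)"
    for u v :: "'d L2"
    unfolding nn_integral_rep_L2[symmetric]
    by (intro nn_integral_cong_AE) (use rep_L2_diff[of u v] in eventually_elim, simp)
  have dn: "(\<integral>\<^sup>+x. ennreal ((cmod (d n x))\<^sup>2) \<partial>lborel) \<le> ennreal ((1/16) ^ n)" for n
  proof -
    have "(norm (X (r (Suc n)) - X (r n)))\<^sup>2 \<le> ((1/4) ^ n)\<^sup>2"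
      using N[of n "r (Suc n)" "r n"] rN[of n n] rN[of n "Suc n"] by (intro power_mono) auto
    then show ?thesis unfolding d_def f_def nn_diff
      by (intro ennreal_leI) (simp add: power2_eq_square power_mult_distrib[symmetric])
  qed
  have "(\<integral>\<^sup>+x. (\<Sum>n. ennreal (4 ^ n) * ennreal ((cmod (d n x))\<^sup>2)) \<partial>lborel)
      = (\<Sum>n. ennreal (4 ^ n) * (\<integral>\<^sup>+x. ennreal ((cmod (d n x))\<^sup>2) \<partial>lborel))"
    by (subst nn_integral_suminf) (auto simp: nn_integral_cmult)
  also have "\<dots> \<le> (\<Sum>n. ennreal ((1/4) ^ n))"
  proof (intro suminf_le summableI)
    show "ennreal (4 ^ n) * (\<integral>\<^sup>+x. ennreal ((cmod (d n x))\<^sup>2) \<partial>lborel) \<le> ennreal ((1/4) ^ n)" for n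
      using mult_left_mono[OF dn, of "ennreal (4 ^ n)" n]
      by (simp add: ennreal_mult'[symmetric] power_mult_distrib[symmetric] del: ennreal_power)
  qed
  also have "\<dots> < \<infinity>"
    by (subst suminf_ennreal2) (auto simp: summable_geometric)
  finally have "AE x in lborel. (\<Sum>n. ennreal (4 ^ n) * ennreal ((cmod (d n x))\<^sup>2)) \<noteq> \<infinity>"
    by (intro nn_integral_noteq_infinite) auto
  then have conv: "AE x in lborel. convergent (\<lambda>n. f n x)"
  proof eventually_elim
    fix x assume fin: "(\<Sum>n. ennreal (4 ^ n) * ennreal ((cmod (d n x))\<^sup>2)) \<noteq> \<infinity>"
    define C where "C = enn2real (\<Sum>n. ennreal (4 ^ n) * ennreal ((cmod (d n x))\<^sup>2))"
    have C: "(\<Sum>n. ennreal (4 ^ n) * ennreal ((cmod (d n x))\<^sup>2)) = ennreal C" "C \<ge> 0"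
      using fin by (auto simp: C_def top.not_eq_extremum)
    \<comment> \<open>Each single term is at most the finite weighted sum \<open>C\<close>; the
      weight \<open>4 ^ n\<close> turns this into a geometric bound, so the telescoping series
      converges absolutely.\<close>
    have b: "cmod (d n x) \<le> sqrt C * (1/2) ^ n" for n
    proof -
      have "ennreal (4 ^ n) * ennreal ((cmod (d n x))\<^sup>2) \<le> ennreal C"
        unfolding C(1)[symmetric]
        using sum_le_suminf[of "\<lambda>n. ennreal (4 ^ n) * ennreal ((cmod (d n x))\<^sup>2)" "{n}"] by simp
      then have "4 ^ n * (cmod (d n x))\<^sup>2 \<le> C"
        by (simp add: ennreal_mult'[symmetric] C(2) del: ennreal_power)
      then have "(2 ^ n * cmod (d n x))\<^sup>2 \<le> C"
        by (simp add: power2_eq_square power_mult_distrib[symmetric] algebra_simps)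
      then have "2 ^ n * cmod (d n x) \<le> sqrt C" by (rule real_le_rsqrt)
      then show ?thesis by (simp add: field_simps power_divide)
    qed
    have "summable (\<lambda>n. d n x)"
      by (rule summable_comparison_test'[of "\<lambda>n. sqrt C * (1/2) ^ n" 0])
        (auto intro!: summable_mult summable_geometric b)
    then have "convergent (\<lambda>n. \<Sum>i<n. d i x)" by (simp add: summable_iff_convergent)
    then have "convergent (\<lambda>n. f 0 x + (\<Sum>i<n. d i x))"
      by (intro convergent_add convergent_const)
    moreover have "f 0 x + (\<Sum>i<n. d i x) = f n x" for n
      unfolding d_def by (subst sum_lessThan_telescope) simp
    ultimately show "convergent (\<lambda>n. f n x)" by simp
  qed
  define F where "F x = lim (\<lambda>n. f n x)" for x
  have [measurable]: "F \<in> borel_measurable borel"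
    unfolding F_def by measurable
  have lim: "AE x in lborel. (\<lambda>n. f n x) \<longlonglongrightarrow> F x"
    using conv by eventually_elim (simp add: F_def convergent_LIMSEQ_iff)
  \<comment> \<open>The Cauchy estimate with its second index sent to infinity.\<close>
  have Fatou: "(\<integral>\<^sup>+x. ennreal ((cmod (rep_L2 (X m) x - F x))\<^sup>2) \<partial>lborel) \<le> ennreal (((1/4) ^ k)\<^sup>2)"
    if "m \<ge> N k" for m k
  proof -
    have "(\<integral>\<^sup>+x. ennreal ((cmod (rep_L2 (X m) x - F x))\<^sup>2) \<partial>lborel)
        = (\<integral>\<^sup>+x. liminf (\<lambda>n. ennreal ((cmod (rep_L2 (X m) x - f n x))\<^sup>2)) \<partial>lborel)"
    proof (intro nn_integral_cong_AE)
      show "AE x in lborel. ennreal ((cmod (rep_L2 (X m) x - F x))\<^sup>2) =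
          liminf (\<lambda>n. ennreal ((cmod (rep_L2 (X m) x - f n x))\<^sup>2))"
        using lim
      proof eventually_elim
        fix x assume "(\<lambda>n. f n x) \<longlonglongrightarrow> F x"
        then have "(\<lambda>n. ennreal ((cmod (rep_L2 (X m) x - f n x))\<^sup>2))
            \<longlonglongrightarrow> ennreal ((cmod (rep_L2 (X m) x - F x))\<^sup>2)"
          by (intro tendsto_intros)
        then show "ennreal ((cmod (rep_L2 (X m) x - F x))\<^sup>2) =
            liminf (\<lambda>n. ennreal ((cmod (rep_L2 (X m) x - f n x))\<^sup>2))"
          using lim_imp_Liminf[OF sequentially_bot] by metis
      qed
    qed
    also have "\<dots> \<le> liminf (\<lambda>n. \<integral>\<^sup>+x. ennreal ((cmod (rep_L2 (X m) x - f n x))\<^sup>2) \<partial>lborel)"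
      by (intro nn_integral_liminf) measurable
    also have "\<dots> \<le> limsup (\<lambda>n. \<integral>\<^sup>+x. ennreal ((cmod (rep_L2 (X m) x - f n x))\<^sup>2) \<partial>lborel)"
      by (rule Liminf_le_Limsup) simp
    also have "\<dots> \<le> ennreal (((1/4) ^ k)\<^sup>2)"
    proof (rule Limsup_bounded)
      show "\<forall>\<^sub>F n in sequentially. (\<integral>\<^sup>+x. ennreal ((cmod (rep_L2 (X m) x - f n x))\<^sup>2) \<partial>lborel)
          \<le> ennreal (((1/4) ^ k)\<^sup>2)"
        using eventually_ge_at_top[of k]
      proof eventually_elim
        case (elim n)
        then show ?case unfolding f_def nn_diff using N[OF that, of "r n"] rN[of k n]
          by (intro ennreal_leI power_mono) auto
      qed
    qed
    finally show ?thesis .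
  qed
  \<comment> \<open>Square integrability of \<open>F\<close> is recovered from that of its
    difference to one member of the sequence.\<close>
  have "square_integrable (\<lambda>x. rep_L2 (X (N 0)) x - F x)"
    by (rule square_integrable_nn_integral)
      (auto intro!: le_less_trans[OF Fatou[of 0 "N 0"]])
  then have "square_integrable (\<lambda>x. rep_L2 (X (N 0)) x + (-1) * (rep_L2 (X (N 0)) x - F x))"
    by (intro square_integrable_add square_integrable_scale square_integrable_rep)
  then have F: "square_integrable F" by (simp add: fun_eq_iff)
  have "norm (X m - abs_L2 F) \<le> (1/4) ^ k" if "m \<ge> N k" for m k
  proof -
    have "ennreal ((norm (X m - abs_L2 F))\<^sup>2) \<le> ennreal (((1/4) ^ k)\<^sup>2)"
      using Fatou[OF that] unfolding nn_diff[symmetric]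
      by (subst nn_integral_cong_AE[where v = "\<lambda>x. ennreal ((cmod (rep_L2 (X m) x - F x))\<^sup>2)"])
        (use rep_abs_L2[OF F] in \<open>eventually_elim, simp\<close>)
    then have "(norm (X m - abs_L2 F))\<^sup>2 \<le> ((1/4) ^ k)\<^sup>2"
      by (subst (asm) ennreal_le_iff) auto
    then show ?thesis by (rule power2_le_imp_le) simp
  qed
  note near = this
  have "X \<longlonglongrightarrow> abs_L2 F"
  proof (rule LIMSEQ_I)
    fix e :: real assume "e > 0"
    then obtain k where "(1/4) ^ k < e" using real_arch_pow_inv[of e "1/4"] by auto
    then show "\<exists>no. \<forall>n\<ge>no. norm (X n - abs_L2 F) < e"
      using near[of k] by (intro exI[of _ "N k"]) (meson le_less_trans)
  qed
  then show ?thesis by (rule convergentI)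
qed

text \<open>Completeness turns Cauchy nets of finite partial sums into convergent series and totally
  bounded closed sets into compact ones.\<close>

instance L2 :: (finite) banach
  by standard (rule L2_Cauchy_convergent)

section \<open>Gaussian regularisation of the Fourier transform\<close>

text \<open>\<open>lborel\<close> is the image of the product measure under the coordinate map, so
  Fubini's theorem applies factor by factor; Gaussian integrals in several variables reduce to the
  line.\<close>

lemma integral_lborel_prod:
  fixes f :: "'a::euclidean_space \<Rightarrow> real \<Rightarrow> 'b::{real_normed_field,banach,second_countable_topology}"
  assumes "\<And>b. b \<in> Basis \<Longrightarrow> integrable lborel (f b)"
  shows "(\<integral>x. (\<Prod>b\<in>Basis. f b (x \<bullet> b)) \<partial>lborel) = (\<Prod>b\<in>Basis. \<integral>x. f b x \<partial>lborel)"
proof -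
  interpret product_sigma_finite "\<lambda>_::'a. lborel :: real measure" ..
  have [measurable]: "f b \<in> borel_measurable borel" if "b \<in> Basis" for b
    using assms[OF that] by simp
  have "(\<integral>x. (\<Prod>b\<in>Basis. f b (x \<bullet> b)) \<partial>lborel)
      = (\<integral>y. (\<Prod>b\<in>Basis. f b ((\<Sum>c\<in>Basis. y c *\<^sub>R c) \<bullet> b)) \<partial>(\<Pi>\<^sub>M b\<in>Basis. lborel))"
    by (subst lborel_eq, subst integral_distr) measurable
  also have "\<dots> = (\<integral>y. (\<Prod>b\<in>Basis. f b (y b)) \<partial>(\<Pi>\<^sub>M b\<in>(Basis::'a set). lborel))"
    by (intro Bochner_Integration.integral_cong refl prod.cong) simp
  also have "\<dots> = (\<Prod>b\<in>Basis. \<integral>x. f b x \<partial>lborel)"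
    using assms by (intro product_integral_prod) auto
  finally show ?thesis .
qed

lemma borel_measurable_cis [measurable]: "cis \<in> borel_measurable borel"
  by (intro borel_measurable_continuous_onI continuous_intros)

lemma borel_measurable_cnj [measurable]: "cnj \<in> borel_measurable borel"
  by (intro borel_measurable_continuous_onI continuous_intros)

text \<open>The substitution \<eta> = t * \<xi> leads to the characteristic function of the standard
  normal distribution at \<open>x / t\<close>. The factor \<open>2 * pi\<close> appears because
  \<open>sqrt (2 * pi) / t\<close> is \<open>2 * pi\<close> times the normalising constant of the
  density.\<close>

lemma integral_cis_gaussian_real:
  assumes "t > 0"
  shows "(\<integral>\<xi>. cis (x * \<xi>) * complex_of_real (exp (- (t\<^sup>2 * \<xi>\<^sup>2 / 2))) \<partial>lborel)
    = complex_of_real (2 * pi * normal_density 0 t x)"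
proof -
  have "(\<integral>\<eta>. std_normal_density \<eta> *\<^sub>R iexp ((x / t) * \<eta>) \<partial>lborel)
      = char std_normal_distribution (x / t)"
    unfolding char_def by (subst integral_density) (auto simp: mult.commute)
  also have "\<dots> = complex_of_real (exp (- ((x / t)\<^sup>2) / 2))"
    by (simp add: char_std_normal_distribution)
  also have "(\<integral>\<eta>. std_normal_density \<eta> *\<^sub>R iexp ((x / t) * \<eta>) \<partial>lborel)
      = \<bar>t\<bar> *\<^sub>R (\<integral>\<xi>. std_normal_density (0 + t * \<xi>) *\<^sub>R iexp ((x / t) * (0 + t * \<xi>)) \<partial>lborel)"
    using assms by (intro lborel_integral_real_affine) simp
  also have "(\<lambda>\<xi>. std_normal_density (0 + t * \<xi>) *\<^sub>R iexp ((x / t) * (0 + t * \<xi>)))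
      = (\<lambda>\<xi>. complex_of_real (1 / sqrt (2 * pi)) * (cis (x * \<xi>) * complex_of_real (exp (- (t\<^sup>2 * \<xi>\<^sup>2 / 2)))))"
    using assms by (auto simp: std_normal_density_def scaleR_conv_of_real cis_conv_exp power_mult_distrib)
  finally have "complex_of_real (t / sqrt (2 * pi)) *
      (\<integral>\<xi>. cis (x * \<xi>) * complex_of_real (exp (- (t\<^sup>2 * \<xi>\<^sup>2 / 2))) \<partial>lborel)
      = complex_of_real (exp (- ((x / t)\<^sup>2) / 2))"
    using assms by (simp add: scaleR_conv_of_real mult.assoc)
  then have "(\<integral>\<xi>. cis (x * \<xi>) * complex_of_real (exp (- (t\<^sup>2 * \<xi>\<^sup>2 / 2))) \<partial>lborel)
      = complex_of_real (exp (- ((x / t)\<^sup>2) / 2) * (sqrt (2 * pi) / t))"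
    using assms by (simp add: field_simps)
  also have "exp (- ((x / t)\<^sup>2) / 2) * (sqrt (2 * pi) / t) = 2 * pi * normal_density 0 t x"
    using assms real_sqrt_mult_self[of "2 * pi"]
    by (simp add: normal_density_def real_sqrt_mult power_divide field_simps)
  finally show ?thesis .
qed

text \<open>The density of a normal vector with independent centred coordinates of standard
  deviation \<open>t\<close>. Up to the factor \<open>(2 * pi) ^ DIM('a)\<close> it is the Fourier
  integral of \<open>gauss_weight t\<close>; as \<open>t\<close> tends to 0 it acts as an
  approximate identity.\<close>

definition gauss_kernel :: "real \<Rightarrow> 'a::euclidean_space \<Rightarrow> real" where
  "gauss_kernel t z = (\<Prod>b\<in>Basis. normal_density 0 t (z \<bullet> b))"

definition gauss_weight :: "real \<Rightarrow> 'a::euclidean_space \<Rightarrow> real" where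
  "gauss_weight t \<xi> = exp (- (t\<^sup>2 * (norm \<xi>)\<^sup>2 / 2))"

lemma borel_measurable_gauss_kernel [measurable]: "gauss_kernel t \<in> borel_measurable borel"
  unfolding gauss_kernel_def by measurable

lemma borel_measurable_gauss_weight [measurable]: "gauss_weight t \<in> borel_measurable borel"
  unfolding gauss_weight_def by measurable

lemma gauss_kernel_nonneg [simp]: "0 \<le> gauss_kernel t z"
  by (simp add: gauss_kernel_def prod_nonneg)

lemma gauss_weight_bounds [simp]: "0 \<le> gauss_weight t \<xi>" "gauss_weight t \<xi> \<le> 1"
  by (auto simp: gauss_weight_def)

lemma nn_integral_gauss_kernel:
  assumes "t > 0"
  shows "(\<integral>\<^sup>+z. ennreal (gauss_kernel t (z::'a::euclidean_space)) \<partial>lborel) = 1"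
proof -
  have "(\<integral>\<^sup>+z. ennreal (gauss_kernel t (z::'a)) \<partial>lborel)
      = (\<integral>\<^sup>+z. (\<Prod>b\<in>Basis. ennreal (normal_density 0 t ((z::'a) \<bullet> b))) \<partial>lborel)"
    by (simp add: gauss_kernel_def prod_ennreal)
  also have "\<dots> = (\<Prod>b\<in>(Basis::'a set). \<integral>\<^sup>+z. ennreal (normal_density 0 t z) \<partial>lborel)"
    by (subst nn_integral_lborel_prod) auto
  also have "\<dots> = 1"
    using assms by (simp add: nn_integral_eq_integral)
  finally show ?thesis .
qed

lemma gauss_weight_prod: "gauss_weight t \<xi> = (\<Prod>b\<in>Basis. exp (- (t\<^sup>2 * (\<xi> \<bullet> b)\<^sup>2 / 2)))"
  unfolding gauss_weight_def power2_norm_eq_inner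
  by (subst euclidean_inner)
    (simp add: exp_sum[symmetric] sum_negf sum_divide_distrib sum_distrib_left power2_eq_square)

lemma integrable_gaussian_real:
  assumes "t > 0"
  shows "integrable lborel (\<lambda>\<xi>::real. exp (- (t\<^sup>2 * \<xi>\<^sup>2 / 2)))"
proof -
  have "integrable lborel (\<lambda>\<xi>. sqrt (2 * pi) * std_normal_density (0 + t * \<xi>))"
    using assms by (intro integrable_mult_right lborel_integrable_real_affine) auto
  then show ?thesis
    by (simp add: std_normal_density_def power_mult_distrib)
qed

lemma integrable_gauss_weight:
  assumes "t > 0"
  shows "integrable lborel (gauss_weight t :: 'a::euclidean_space \<Rightarrow> real)"
proof (rule integrableI_nonneg)
  have "(\<integral>\<^sup>+z. ennreal (gauss_weight t (z::'a)) \<partial>lborel)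
      = (\<integral>\<^sup>+z. (\<Prod>b\<in>Basis. ennreal (exp (- (t\<^sup>2 * ((z::'a) \<bullet> b)\<^sup>2 / 2)))) \<partial>lborel)"
    by (simp add: gauss_weight_prod prod_ennreal)
  also have "\<dots> = (\<Prod>b\<in>(Basis::'a set). \<integral>\<^sup>+z. ennreal (exp (- (t\<^sup>2 * z\<^sup>2 / 2))) \<partial>lborel)"
    by (subst nn_integral_lborel_prod) auto
  also have "\<dots> < \<infinity>"
    using integrable_gaussian_real[OF assms] by (simp add: nn_integral_eq_integral ennreal_power)
  finally show "(\<integral>\<^sup>+z. ennreal (gauss_weight t (z::'a)) \<partial>lborel) < \<infinity>" .
qed auto

lemma integral_cis_gauss_weight:
  fixes z :: "'a::euclidean_space"
  assumes "t > 0"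
  shows "(\<integral>\<xi>. cis (z \<bullet> \<xi>) * complex_of_real (gauss_weight t \<xi>) \<partial>lborel)
    = complex_of_real ((2 * pi) ^ DIM('a) * gauss_kernel t z)"
proof -
  have "cis (z \<bullet> \<xi>) = (\<Prod>b\<in>Basis. cis ((z \<bullet> b) * (\<xi> \<bullet> b)))" for \<xi>
    by (subst euclidean_inner) (simp add: cis_conv_exp exp_sum[symmetric] sum_distrib_left)
  then have "(\<integral>\<xi>. cis (z \<bullet> \<xi>) * complex_of_real (gauss_weight t \<xi>) \<partial>lborel)
      = (\<integral>\<xi>. (\<Prod>b\<in>Basis. cis ((z \<bullet> b) * (\<xi> \<bullet> b)) *
          complex_of_real (exp (- (t\<^sup>2 * (\<xi> \<bullet> b)\<^sup>2 / 2)))) \<partial>lborel)"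
    by (simp add: gauss_weight_prod prod.distrib)
  also have "\<dots> = (\<Prod>b\<in>Basis. \<integral>\<xi>. cis ((z \<bullet> b) * \<xi>) *
      complex_of_real (exp (- (t\<^sup>2 * \<xi>\<^sup>2 / 2))) \<partial>lborel)"
  proof (rule integral_lborel_prod)
    fix b :: 'a
    have "integrable lborel (\<lambda>\<xi>. complex_of_real (exp (- (t\<^sup>2 * \<xi>\<^sup>2 / 2))))"
      using integrable_gaussian_real[OF assms] by (simp add: integrable_of_real)
    then show "integrable lborel (\<lambda>\<xi>. cis ((z \<bullet> b) * \<xi>) * complex_of_real (exp (- (t\<^sup>2 * \<xi>\<^sup>2 / 2))))"
      by (rule Bochner_Integration.integrable_bound) (auto simp: norm_mult)
  qed
  also have "\<dots> = complex_of_real ((2 * pi) ^ DIM('a) * gauss_kernel t z)"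
    unfolding integral_cis_gaussian_real[OF assms]
    by (simp add: gauss_kernel_def prod.distrib of_real_prod)
  finally show ?thesis .
qed

section \<open>Translation and scaling of the Gaussian kernel\<close>

lemma nn_integral_lborel_translate:
  fixes c :: "'a::euclidean_space"
  assumes [measurable]: "f \<in> borel_measurable borel"
  shows "(\<integral>\<^sup>+x. f (c + x) \<partial>lborel) = (\<integral>\<^sup>+x. f x \<partial>lborel)"
  by (subst (2) lborel_distr_plus[of c, symmetric]) (simp add: nn_integral_distr)

lemma gauss_kernel_minus [simp]: "gauss_kernel t (- z) = gauss_kernel t z"
  by (simp add: gauss_kernel_def normal_density_def)

lemma nn_integral_gauss_kernel_diff:
  assumes "t > 0"
  shows "(\<integral>\<^sup>+y. ennreal (gauss_kernel t (y - x)) \<partial>lborel) = 1"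
    and "(\<integral>\<^sup>+y. ennreal (gauss_kernel t (x - y)) \<partial>lborel) = 1"
proof -
  show 1: "(\<integral>\<^sup>+y. ennreal (gauss_kernel t (y - x)) \<partial>lborel) = 1"
    using nn_integral_lborel_translate[of "\<lambda>y. ennreal (gauss_kernel t y)" "- x"]
      nn_integral_gauss_kernel[OF assms] by simp
  have "gauss_kernel t (x - y) = gauss_kernel t (y - x)" for y
    using gauss_kernel_minus[of t "x - y"] by simp
  then show "(\<integral>\<^sup>+y. ennreal (gauss_kernel t (x - y)) \<partial>lborel) = 1" by (simp add: 1)
qed

lemma gauss_kernel_scale:
  fixes z :: "'a::euclidean_space"
  assumes "t > 0"
  shows "gauss_kernel t (t *\<^sub>R z) * t ^ DIM('a) = gauss_kernel 1 z"
proof -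
  have "normal_density 0 t (t * x) * t = normal_density 0 1 x" for x
    using assms by (simp add: normal_density_def real_sqrt_mult power_mult_distrib)
  then show ?thesis unfolding gauss_kernel_def prod_constant[symmetric]
    by (simp add: prod.distrib[symmetric] del: prod_constant)
qed

text \<open>Substituting \<open>y = x + t *\<^sub>R z\<close> moves \<open>t\<close> from the kernel
  into the argument of \<open>f\<close>, so that the limit at 0 can be taken against one fixed
  integrable density.\<close>

lemma integral_gauss_kernel_rescale:
  fixes f :: "'a::euclidean_space \<Rightarrow> complex"
  assumes "t > 0" and [measurable]: "f \<in> borel_measurable borel"
  shows "(\<integral>y. f y * complex_of_real (gauss_kernel t (y - x)) \<partial>lborel)
    = (\<integral>z. f (x + t *\<^sub>R z) * complex_of_real (gauss_kernel 1 z) \<partial>lborel)"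
proof -
  have "(\<integral>y. f y * complex_of_real (gauss_kernel t (y - x)) \<partial>lborel)
      = (\<integral>z. \<bar>t\<bar> ^ DIM('a) *\<^sub>R (f (x + t *\<^sub>R z) * complex_of_real (gauss_kernel t (t *\<^sub>R z))) \<partial>lborel)"
    using assms(1)
    by (subst lborel_affine[of t x]) (auto simp: integral_density integral_distr)
  also have "\<dots> = (\<integral>z. f (x + t *\<^sub>R z) * complex_of_real (gauss_kernel 1 z) \<partial>lborel)"
    using assms(1)
    by (simp add: gauss_kernel_scale[symmetric] scaleR_conv_of_real mult_ac)
  finally show ?thesis .
qed

lemma borel_measurable_fst_snd [measurable]:
  "(fst :: 'a::topological_space \<times> 'b::topological_space \<Rightarrow> 'a) \<in> borel_measurable borel"
  "(snd :: 'a \<times> 'b \<Rightarrow> 'b) \<in> borel_measurable borel"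
  by (intro borel_measurable_continuous_onI continuous_intros)+

lemma integrable_lborel_times:
  fixes f :: "'a::euclidean_space \<Rightarrow> complex" and g :: "'b::euclidean_space \<Rightarrow> complex"
  assumes f: "integrable lborel f" and g: "integrable lborel g"
  shows "integrable lborel (\<lambda>p. f (fst p) * g (snd p))"
    and "(\<integral>p. f (fst p) * g (snd p) \<partial>lborel) = (\<integral>x. f x \<partial>lborel) * (\<integral>y. g y \<partial>lborel)"
proof -
  have [measurable]: "f \<in> borel_measurable borel" "g \<in> borel_measurable borel"
    using f g by auto
  have 1: "integrable (lborel \<Otimes>\<^sub>M lborel) (\<lambda>p. f (fst p) * g (snd p))"
  proof (rule lborel_pair.Fubini_integrable)
    show "(\<lambda>p. f (fst p) * g (snd p)) \<in> borel_measurable (lborel \<Otimes>\<^sub>M lborel)" by measurable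
    show "integrable lborel (\<lambda>x. \<integral>y. cmod (f (fst (x, y)) * g (snd (x, y))) \<partial>lborel)"
      using f by (simp add: norm_mult integrable_mult_left)
    show "AE x in lborel. integrable lborel (\<lambda>y. f (fst (x, y)) * g (snd (x, y)))"
      using g by (simp add: integrable_mult_right)
  qed
  then show "integrable lborel (\<lambda>p. f (fst p) * g (snd p))" by (simp add: lborel_prod)
  show "(\<integral>p. f (fst p) * g (snd p) \<partial>lborel) = (\<integral>x. f x \<partial>lborel) * (\<integral>y. g y \<partial>lborel)"
    unfolding lborel_prod[symmetric] lborel_pair.integral_fst'[OF 1, symmetric]
    using f g by simp
qed

lemma borel_measurable_fourier [measurable]:
  assumes [measurable]: "f \<in> borel_measurable borel"
  shows "fourier f \<in> borel_measurable borel"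
  unfolding fourier_def by measurable

lemma cmod_fourier_le:
  fixes f :: "real^'d::finite \<Rightarrow> complex"
  assumes "integrable lborel f"
  shows "cmod (fourier f \<xi>) \<le> (2 * pi) powr (- real CARD('d) / 2) * (\<integral>x. cmod (f x) \<partial>lborel)"
proof -
  have "cmod (\<integral>x. cis (- (x \<bullet> \<xi>)) * f x \<partial>lborel) \<le> (\<integral>x. cmod (cis (- (x \<bullet> \<xi>)) * f x) \<partial>lborel)"
    by (rule integral_norm_bound)
  then show ?thesis unfolding fourier_def norm_mult by (simp add: mult_left_mono norm_mult)
qed

lemma cnj_fourier:
  fixes f :: "real^'d::finite \<Rightarrow> complex"
  shows "cnj (fourier f \<xi>) = complex_of_real ((2 * pi) powr (- real CARD('d) / 2)) *
    (\<integral>x. cis (x \<bullet> \<xi>) * cnj (f x) \<partial>lborel)"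
  unfolding fourier_def complex_cnj_mult complex_cnj_complex_of_real
  by (subst Bochner_Integration.integral_cnj[symmetric]) (simp add: cis_cnj)

text \<open>The Gaussian weight makes the integral over \<xi> and both space variables absolutely
  convergent, so Fubini's theorem may integrate \<xi> out first and leaves the kernel at
  \<open>snd p - fst p\<close>. This is Parseval's identity in regularised form; the regularisation
  is removed later.\<close>

lemma
  fixes f g :: "real^'d::finite \<Rightarrow> complex"
  assumes f: "integrable lborel f" and g: "integrable lborel g" and t: "t > 0"
  shows integrable_fourier_gauss_weight:
      "integrable lborel (\<lambda>p. f (fst p) * cnj (g (snd p)) * complex_of_real (gauss_kernel t (snd p - fst p)))"
    and fourier_gauss_weight:
      "(\<integral>\<xi>. fourier f \<xi> * cnj (fourier g \<xi>) * complex_of_real (gauss_weight t \<xi>) \<partial>lborel)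
        = (\<integral>p. f (fst p) * cnj (g (snd p)) * complex_of_real (gauss_kernel t (snd p - fst p)) \<partial>lborel)"
proof -
  let ?C = "complex_of_real ((2 * pi) ^ CARD('d))"
  define F where "F p = f (fst p) * cnj (g (snd p))" for p :: "(real^'d) \<times> (real^'d)"
  have g': "integrable lborel (\<lambda>x. cnj (g x))" using g by simp
  have F: "integrable lborel F" unfolding F_def by (rule integrable_lborel_times[OF f g'])
  have [measurable]: "f \<in> borel_measurable borel" "g \<in> borel_measurable borel" "F \<in> borel_measurable borel"
    using f g F by auto
  have FG: "fourier f \<xi> * cnj (fourier g \<xi>) = inverse ?C * (\<integral>p. cis ((snd p - fst p) \<bullet> \<xi>) * F p \<partial>lborel)" for \<xi>
  proof -
    have i1: "integrable lborel (\<lambda>x. cis (- (x \<bullet> \<xi>)) * f x)"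
      using f by (rule Bochner_Integration.integrable_bound) (auto simp: norm_mult)
    have i2: "integrable lborel (\<lambda>x. cis (x \<bullet> \<xi>) * cnj (g x))"
      using g' by (rule Bochner_Integration.integrable_bound) (auto simp: norm_mult)
    \<comment> \<open>The two normalising constants of the transforms combine to the inverse of the
      factor that the Gaussian integral produces.\<close>
    have c: "complex_of_real ((2 * pi) powr (- real CARD('d) / 2)) *
        complex_of_real ((2 * pi) powr (- real CARD('d) / 2)) = inverse ?C"
      unfolding of_real_mult[symmetric] powr_add[symmetric] of_real_inverse[symmetric]
      by (simp add: powr_minus powr_realpow del: of_real_inverse)
    have "fourier f \<xi> * cnj (fourier g \<xi>) = inverse ?C *
        ((\<integral>x. cis (- (x \<bullet> \<xi>)) * f x \<partial>lborel) * (\<integral>y. cis (y \<bullet> \<xi>) * cnj (g y) \<partial>lborel))"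
      unfolding cnj_fourier unfolding fourier_def c[symmetric] by (simp only: mult_ac)
    also have "\<dots> = inverse ?C * (\<integral>p. (cis (- (fst p \<bullet> \<xi>)) * f (fst p)) *
        (cis (snd p \<bullet> \<xi>) * cnj (g (snd p))) \<partial>lborel)"
      by (subst integrable_lborel_times(2)[OF i1 i2]) simp
    also have "(\<lambda>p. (cis (- (fst p \<bullet> \<xi>)) * f (fst p)) * (cis (snd p \<bullet> \<xi>) * cnj (g (snd p))))
        = (\<lambda>p. cis ((snd p - fst p) \<bullet> \<xi>) * F p)"
      unfolding F_def by (rule ext) (simp add: inner_diff_left cis_mult)
    finally show ?thesis .
  qed
  define G where "G \<xi> p = cis ((snd p - fst p) \<bullet> \<xi>) * F p * complex_of_real (gauss_weight t \<xi>)"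
    for \<xi> :: "real^'d" and p
  have wF: "integrable lborel (\<lambda>q. complex_of_real (gauss_weight t (fst q :: real^'d)) * F (snd q))"
    by (rule integrable_lborel_times(1))
      (use F integrable_gauss_weight[OF t] in \<open>auto intro: integrable_of_real\<close>)
  have G: "integrable (lborel \<Otimes>\<^sub>M lborel) (case_prod G)"
    unfolding lborel_prod
    by (rule Bochner_Integration.integrable_bound[OF wF])
      (auto simp: G_def norm_mult case_prod_unfold)
  have inner: "(\<integral>\<xi>. G \<xi> p \<partial>lborel) = ?C * (F p * complex_of_real (gauss_kernel t (snd p - fst p)))" for p
  proof -
    have "(\<integral>\<xi>. G \<xi> p \<partial>lborel) = F p *
        (\<integral>\<xi>. cis ((snd p - fst p) \<bullet> \<xi>) * complex_of_real (gauss_weight t \<xi>) \<partial>lborel)"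
      unfolding G_def by (subst integral_mult_right_zero[symmetric]) (simp add: mult_ac)
    then show ?thesis unfolding integral_cis_gauss_weight[OF t] by simp
  qed
  \<comment> \<open>Fubini's theorem also yields integrability of the inner \<xi>-integral as a
    function of \<open>p\<close>, which is the first claim up to a constant.\<close>
  have iK: "integrable lborel (\<lambda>p. inverse ?C * (?C * (F p * complex_of_real (gauss_kernel t (snd p - fst p)))))"
    using lborel_pair.integrable_snd[OF G] unfolding inner by (rule integrable_mult_right)
  have cancel: "inverse ?C * (?C * z) = z" for z
    by (subst mult.assoc[symmetric]) (subst left_inverse, simp_all)
  show "integrable lborel (\<lambda>p. f (fst p) * cnj (g (snd p)) * complex_of_real (gauss_kernel t (snd p - fst p)))"
    using iK unfolding cancel F_def .
  have "(\<integral>\<xi>. fourier f \<xi> * cnj (fourier g \<xi>) * complex_of_real (gauss_weight t \<xi>) \<partial>lborel)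
      = inverse ?C * (\<integral>\<xi>. (\<integral>p. G \<xi> p \<partial>lborel) \<partial>lborel)"
    by (simp only: FG G_def integral_mult_left_zero mult.assoc[of "inverse ?C"] integral_mult_right_zero)
  also have "\<dots> = inverse ?C * (\<integral>p. (\<integral>\<xi>. G \<xi> p \<partial>lborel) \<partial>lborel)"
    by (subst lborel_pair.Fubini_integral[OF G]) simp
  also have "\<dots> = (\<integral>p. F p * complex_of_real (gauss_kernel t (snd p - fst p)) \<partial>lborel)"
    unfolding inner integral_mult_right_zero cancel ..
  finally show "(\<integral>\<xi>. fourier f \<xi> * cnj (fourier g \<xi>) * complex_of_real (gauss_weight t \<xi>) \<partial>lborel)
        = (\<integral>p. f (fst p) * cnj (g (snd p)) * complex_of_real (gauss_kernel t (snd p - fst p)) \<partial>lborel)"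
    unfolding F_def .
qed

section \<open>Plancherel's theorem\<close>

lemma tendsto_gauss_weight: "(\<lambda>n. gauss_weight (1 / Suc n) \<xi>) \<longlonglongrightarrow> 1"
proof -
  have "(\<lambda>n. exp (- ((1 / real (Suc n))\<^sup>2 * (norm \<xi>)\<^sup>2 / 2))) \<longlonglongrightarrow> exp (- (0\<^sup>2 * (norm \<xi>)\<^sup>2 / 2))"
    by (intro tendsto_intros LIMSEQ_Suc[OF lim_1_over_n]) simp
  then show ?thesis by (simp add: gauss_weight_def)
qed

text \<open>The Gaussian kernel is a probability density and
  \<open>2 * \<bar>f x\<bar> * \<bar>f y\<bar> \<le> \<bar>f x\<bar>\<^sup>2 + \<bar>f y\<bar>\<^sup>2\<close>.\<close>

lemma fourier_gauss_weight_le: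
  fixes f :: "real^'d::finite \<Rightarrow> complex"
  assumes f: "integrable lborel f" and t: "t > 0"
  shows "(\<integral>\<^sup>+\<xi>. ennreal ((cmod (fourier f \<xi>))\<^sup>2 * gauss_weight t \<xi>) \<partial>lborel)
    \<le> (\<integral>\<^sup>+x. ennreal ((cmod (f x))\<^sup>2) \<partial>lborel)"
proof -
  let ?I = "\<integral>\<^sup>+x. ennreal ((cmod (f x))\<^sup>2) \<partial>lborel"
  let ?B = "(2 * pi) powr (- real CARD('d) / 2) * (\<integral>x. cmod (f x) \<partial>lborel)"
  let ?K = "\<lambda>p. gauss_kernel t (snd p - fst p :: real^'d)"
  have [measurable]: "f \<in> borel_measurable borel" using f by auto
  \<comment> \<open>The transform of an integrable function is bounded, so the weight provides the
    integrability.\<close>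
  have i: "integrable lborel (\<lambda>\<xi>. (cmod (fourier f \<xi>))\<^sup>2 * gauss_weight t \<xi>)"
  proof (rule Bochner_Integration.integrable_bound)
    show "integrable lborel (\<lambda>\<xi>::real^'d. ?B\<^sup>2 * gauss_weight t \<xi>)"
      by (intro integrable_mult_right integrable_gauss_weight t)
    show "AE \<xi> in lborel. norm ((cmod (fourier f \<xi>))\<^sup>2 * gauss_weight t \<xi>) \<le> norm (?B\<^sup>2 * gauss_weight t \<xi>)"
    proof (intro AE_I2)
      fix \<xi> :: "real^'d"
      have "(cmod (fourier f \<xi>))\<^sup>2 \<le> ?B\<^sup>2"
        using cmod_fourier_le[OF f] by (intro power_mono) auto
      then show "norm ((cmod (fourier f \<xi>))\<^sup>2 * gauss_weight t \<xi>) \<le> norm (?B\<^sup>2 * gauss_weight t \<xi>)"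
        by (simp add: abs_mult mult_right_mono)
    qed
  qed measurable
  have "complex_of_real (\<integral>\<xi>. (cmod (fourier f \<xi>))\<^sup>2 * gauss_weight t \<xi> \<partial>lborel)
      = (\<integral>\<xi>. fourier f \<xi> * cnj (fourier f \<xi>) * complex_of_real (gauss_weight t \<xi>) \<partial>lborel)"
    by (subst integral_complex_of_real[symmetric]) (simp only: of_real_mult complex_norm_square)
  also have "\<dots> = (\<integral>p. f (fst p) * cnj (f (snd p)) * complex_of_real (?K p) \<partial>lborel)"
    by (rule fourier_gauss_weight[OF f f t])
  finally have c: "complex_of_real (\<integral>\<xi>. (cmod (fourier f \<xi>))\<^sup>2 * gauss_weight t \<xi> \<partial>lborel)
      = (\<integral>p. f (fst p) * cnj (f (snd p)) * complex_of_real (?K p) \<partial>lborel)" .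
  have "\<bar>\<integral>\<xi>. (cmod (fourier f \<xi>))\<^sup>2 * gauss_weight t \<xi> \<partial>lborel\<bar>
      = cmod (\<integral>p. f (fst p) * cnj (f (snd p)) * complex_of_real (?K p) \<partial>lborel)"
    unfolding c[symmetric] norm_of_real ..
  then have "ennreal (\<integral>\<xi>. (cmod (fourier f \<xi>))\<^sup>2 * gauss_weight t \<xi> \<partial>lborel)
      = ennreal (cmod (\<integral>p. f (fst p) * cnj (f (snd p)) * complex_of_real (?K p) \<partial>lborel))"
    using Bochner_Integration.integral_nonneg[of lborel "\<lambda>\<xi>. (cmod (fourier f \<xi>))\<^sup>2 * gauss_weight t \<xi>"]
    by simp
  also have "\<dots> \<le> (\<integral>\<^sup>+p. ennreal (cmod (f (fst p) * cnj (f (snd p)) * complex_of_real (?K p))) \<partial>lborel)"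
    by (rule integral_norm_bound_ennreal) (rule integrable_fourier_gauss_weight[OF f f t])
  also have "\<dots> \<le> (\<integral>\<^sup>+p. (ennreal ((cmod (f (fst p)))\<^sup>2) * ennreal (?K p) + ennreal ((cmod (f (snd p)))\<^sup>2) * ennreal (?K p)) / 2 \<partial>lborel)"
  proof (intro nn_integral_mono)
    fix p
    have "2 * (cmod (f (fst p)) * cmod (f (snd p))) \<le> (cmod (f (fst p)))\<^sup>2 + (cmod (f (snd p)))\<^sup>2"
      using zero_le_power2[of "cmod (f (fst p)) - cmod (f (snd p))"]
      by (simp add: power2_eq_square algebra_simps)
    then have "(cmod (f (fst p)) * cmod (f (snd p))) * ?K p
        \<le> ((cmod (f (fst p)))\<^sup>2 + (cmod (f (snd p)))\<^sup>2) / 2 * ?K p"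
      by (intro mult_right_mono) auto
    then have "ennreal (cmod (f (fst p) * cnj (f (snd p)) * complex_of_real (?K p)))
        \<le> ennreal (((cmod (f (fst p)))\<^sup>2 * ?K p + (cmod (f (snd p)))\<^sup>2 * ?K p) / 2)"
      by (intro ennreal_leI) (simp add: norm_mult field_simps)
    then show "ennreal (cmod (f (fst p) * cnj (f (snd p)) * complex_of_real (?K p))) \<le>
      (ennreal ((cmod (f (fst p)))\<^sup>2) * ennreal (?K p) + ennreal ((cmod (f (snd p)))\<^sup>2) * ennreal (?K p)) / 2"
      by (simp add: ennreal_mult'[symmetric] ennreal_plus[symmetric] divide_ennreal[symmetric] del: ennreal_plus)
  qed
  also have "\<dots> = ((\<integral>\<^sup>+p. ennreal ((cmod (f (fst p)))\<^sup>2) * ennreal (?K p) \<partial>lborel) +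
      (\<integral>\<^sup>+p. ennreal ((cmod (f (snd p)))\<^sup>2) * ennreal (?K p) \<partial>lborel)) / 2"
    by (simp add: nn_integral_divide nn_integral_add)
  also have "(\<integral>\<^sup>+p. ennreal ((cmod (f (fst p)))\<^sup>2) * ennreal (?K p) \<partial>lborel) = ?I"
  proof -
    have "(\<integral>\<^sup>+p. ennreal ((cmod (f (fst p)))\<^sup>2) * ennreal (?K p) \<partial>lborel)
        = (\<integral>\<^sup>+x. (\<integral>\<^sup>+y. ennreal ((cmod (f x))\<^sup>2) * ennreal (gauss_kernel t (y - x)) \<partial>lborel) \<partial>lborel)"
      unfolding lborel_prod[symmetric] by (subst lborel.nn_integral_fst[symmetric]) auto
    then show ?thesis by (simp add: nn_integral_cmult nn_integral_gauss_kernel_diff[OF t])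
  qed
  also have "(\<integral>\<^sup>+p. ennreal ((cmod (f (snd p)))\<^sup>2) * ennreal (?K p) \<partial>lborel) = ?I"
  proof -
    have "(\<integral>\<^sup>+p. ennreal ((cmod (f (snd p)))\<^sup>2) * ennreal (?K p) \<partial>lborel)
        = (\<integral>\<^sup>+y. (\<integral>\<^sup>+x. ennreal ((cmod (f y))\<^sup>2) * ennreal (gauss_kernel t (y - x)) \<partial>lborel) \<partial>lborel)"
      unfolding lborel_prod[symmetric] by (subst lborel_pair.nn_integral_snd[symmetric]) auto
    then show ?thesis by (simp add: nn_integral_cmult nn_integral_gauss_kernel_diff[OF t])
  qed
  also have "(?I + ?I) / 2 = ?I"
    using mult_divide_eq_ennreal[of 2 ?I] by (simp add: mult_2_right)
  finally show ?thesis
    using i by (subst nn_integral_eq_integral) auto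
qed

text \<open>The weighted bound is uniform in the width, so Fatou's lemma removes the weight as
  \<open>1 / Suc n\<close> tends to 0.\<close>

lemma nn_integral_fourier_le:
  fixes f :: "real^'d::finite \<Rightarrow> complex"
  assumes f: "integrable lborel f"
  shows "(\<integral>\<^sup>+\<xi>. ennreal ((cmod (fourier f \<xi>))\<^sup>2) \<partial>lborel) \<le> (\<integral>\<^sup>+x. ennreal ((cmod (f x))\<^sup>2) \<partial>lborel)"
proof -
  have [measurable]: "f \<in> borel_measurable borel" using f by auto
  have "(\<integral>\<^sup>+\<xi>. ennreal ((cmod (fourier f \<xi>))\<^sup>2) \<partial>lborel)
      = (\<integral>\<^sup>+\<xi>. liminf (\<lambda>n. ennreal ((cmod (fourier f \<xi>))\<^sup>2 * gauss_weight (1 / Suc n) \<xi>)) \<partial>lborel)"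
  proof (intro nn_integral_cong)
    fix \<xi> :: "real^'d"
    have "(\<lambda>n. ennreal ((cmod (fourier f \<xi>))\<^sup>2 * gauss_weight (1 / Suc n) \<xi>)) \<longlonglongrightarrow> ennreal ((cmod (fourier f \<xi>))\<^sup>2 * 1)"
      by (intro tendsto_intros tendsto_gauss_weight)
    then show "ennreal ((cmod (fourier f \<xi>))\<^sup>2) =
        liminf (\<lambda>n. ennreal ((cmod (fourier f \<xi>))\<^sup>2 * gauss_weight (1 / Suc n) \<xi>))"
      using lim_imp_Liminf[OF sequentially_bot] by (metis mult.right_neutral)
  qed
  also have "\<dots> \<le> liminf (\<lambda>n. \<integral>\<^sup>+\<xi>. ennreal ((cmod (fourier f \<xi>))\<^sup>2 * gauss_weight (1 / Suc n) \<xi>) \<partial>lborel)"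
    by (intro nn_integral_liminf) measurable
  also have "\<dots> \<le> limsup (\<lambda>n. \<integral>\<^sup>+\<xi>. ennreal ((cmod (fourier f \<xi>))\<^sup>2 * gauss_weight (1 / Suc n) \<xi>) \<partial>lborel)"
    by (rule Liminf_le_Limsup) simp
  also have "\<dots> \<le> (\<integral>\<^sup>+x. ennreal ((cmod (f x))\<^sup>2) \<partial>lborel)"
    by (intro Limsup_bounded always_eventually allI fourier_gauss_weight_le f) simp
  finally show ?thesis .
qed

lemma
  fixes f :: "real^'d::finite \<Rightarrow> complex"
  assumes f: "integrable lborel f" "square_integrable f"
  shows square_integrable_fourier: "square_integrable (fourier f)"
    and norm_fourier_le: "norm (abs_L2 (fourier f)) \<le> norm (abs_L2 f)"
proof -
  have [measurable]: "f \<in> borel_measurable borel" using f by auto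
  note le = nn_integral_fourier_le[OF f(1), unfolded nn_integral_abs_L2[OF f(2)]]
  show s: "square_integrable (fourier f)"
    by (rule square_integrable_nn_integral) (auto intro: le_less_trans[OF le])
  show "norm (abs_L2 (fourier f)) \<le> norm (abs_L2 f)"
    using le unfolding nn_integral_abs_L2[OF s]
    by (simp add: ennreal_le_iff power_mono_iff)
qed

section \<open>Parseval's identity tested on indicators of boxes\<close>

lemma integrable_gauss_kernel_diff:
  assumes "t > 0"
  shows "integrable lborel (\<lambda>y. gauss_kernel t (y - x))"
    and "(\<integral>y. gauss_kernel t (y - x) \<partial>lborel) = 1"
proof -
  show i: "integrable lborel (\<lambda>y. gauss_kernel t (y - x))"
    using nn_integral_gauss_kernel_diff(1)[OF assms, of x] by (intro integrableI_nonneg) auto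
  have "ennreal (\<integral>y. gauss_kernel t (y - x) \<partial>lborel) = 1"
    using nn_integral_eq_integral[OF i] nn_integral_gauss_kernel_diff(1)[OF assms, of x] by simp
  then show "(\<integral>y. gauss_kernel t (y - x) \<partial>lborel) = 1" by simp
qed

lemma cnj_indicator [simp]: "cnj (indicator A x) = indicator A x"
  by (simp add: indicator_def)

lemma square_integrable_indicator_box:
  fixes a b :: "real^'d::finite"
  shows "integrable lborel (indicator (box a b) :: real^'d \<Rightarrow> complex)"
    and "square_integrable (indicator (box a b))"
proof -
  have i: "integrable lborel (indicat_real (box a b))"
    by (rule integrable_real_indicator) (simp, rule emeasure_bounded_finite[OF bounded_box])
  then show "integrable lborel (indicator (box a b) :: real^'d \<Rightarrow> complex)"
    using integrable_of_real[OF i, where 'a = complex] by (simp only: of_real_indicator)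
  have "(cmod (indicator (box a b) x))\<^sup>2 = indicat_real (box a b) x" for x :: "real^'d"
    by (simp add: indicator_def)
  then show "square_integrable (indicator (box a b) :: real^'d \<Rightarrow> complex)"
    using i by (simp add: square_integrable_def)
qed

text \<open>Off the frontier the indicator is continuous, and after rescaling dominated convergence
  applies with the fixed density \<open>gauss_kernel 1\<close>. The frontier is negligible because a
  box is convex.\<close>

lemma AE_tendsto_indicator_box:
  fixes a b :: "real^'d::finite"
  shows "AE x in lborel. (\<lambda>n. \<integral>y. indicator (box a b) y * complex_of_real (gauss_kernel (1 / Suc n) (y - x)) \<partial>lborel)
      \<longlonglongrightarrow> indicator (box a b) x"
proof -
  have "frontier (box a b) \<in> null_sets lborel"
    using negligible_convex_frontier[of "box a b"]
    by (auto simp: negligible_iff_null_sets null_sets_completion_iff)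
  then have "AE x in lborel. x \<notin> frontier (box a b)" by (rule AE_not_in)
  then show ?thesis
  proof eventually_elim
    fix x assume x: "x \<notin> frontier (box a b)"
    have K: "integrable lborel (gauss_kernel 1 :: real^'d \<Rightarrow> real)"
      and one: "(\<integral>z. gauss_kernel 1 (z :: real^'d) \<partial>lborel) = 1"
      using integrable_gauss_kernel_diff[of 1 "0 :: real^'d"] by auto
    have "(\<lambda>n. \<integral>z. indicator (box a b) (x + (1 / Suc n) *\<^sub>R z) * complex_of_real (gauss_kernel 1 z) \<partial>lborel)
        \<longlonglongrightarrow> (\<integral>z. indicator (box a b) x * complex_of_real (gauss_kernel 1 (z :: real^'d)) \<partial>lborel)"
    proof (rule integral_dominated_convergence[where w = "\<lambda>z::real^'d. gauss_kernel 1 z"])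
      show "AE z in lborel. (\<lambda>n. indicator (box a b) (x + (1 / Suc n) *\<^sub>R z) * complex_of_real (gauss_kernel 1 z))
          \<longlonglongrightarrow> indicator (box a b) x * complex_of_real (gauss_kernel 1 z)"
      proof (intro AE_I2 tendsto_mult tendsto_const)
        fix z
        have "(\<lambda>n. x + (1 / Suc n) *\<^sub>R z) \<longlonglongrightarrow> x + 0 *\<^sub>R z"
          by (intro tendsto_intros LIMSEQ_Suc[OF lim_1_over_n])
        moreover have "isCont (indicat_real (box a b)) x"
          using x by (simp add: isCont_indicator)
        ultimately have "(\<lambda>n. complex_of_real (indicat_real (box a b) (x + (1 / Suc n) *\<^sub>R z)))
            \<longlonglongrightarrow> complex_of_real (indicat_real (box a b) x)"
          by (intro tendsto_of_real) (rule isCont_tendsto_compose, simp_all)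
        then show "(\<lambda>n. indicator (box a b) (x + (1 / Suc n) *\<^sub>R z)) \<longlonglongrightarrow> (indicator (box a b) x :: complex)"
          by (simp only: of_real_indicator)
      qed
      show "AE z in lborel. cmod (indicator (box a b) (x + (1 / Suc n) *\<^sub>R z) * complex_of_real (gauss_kernel 1 z))
          \<le> gauss_kernel 1 z" for n
        by (auto simp: norm_mult indicator_def)
    qed (use K in auto)
    moreover have "(\<integral>z. indicator (box a b) x * complex_of_real (gauss_kernel 1 (z :: real^'d)) \<partial>lborel) = indicator (box a b) x"
      by (simp add: integral_complex_of_real one)
    ultimately show "(\<lambda>n. \<integral>y. indicator (box a b) y * complex_of_real (gauss_kernel (1 / Suc n) (y - x)) \<partial>lborel)
      \<longlonglongrightarrow> indicator (box a b) x"
      by (subst integral_gauss_kernel_rescale) auto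
  qed
qed

text \<open>For the indicator of a box the Gaussian averages converge almost everywhere and stay
  bounded by 1, so dominated convergence removes the regularisation on the space side. On the
  frequency side the product of the two transforms is itself an integrable bound, both being square
  integrable.\<close>

lemma fourier_inner_indicator_box:
  fixes f :: "real^'d::finite \<Rightarrow> complex"
  assumes f: "integrable lborel f" "square_integrable f"
  shows "(\<integral>\<xi>. cnj (fourier (indicator (box a b)) \<xi>) * fourier f \<xi> \<partial>lborel)
    = (\<integral>x. cnj (indicator (box a b) x) * f x \<partial>lborel)"
proof -
  let ?g = "indicator (box a b) :: real^'d \<Rightarrow> complex"
  note g = square_integrable_indicator_box[of a b]
  have [measurable]: "f \<in> borel_measurable borel" using f by auto
  have prod: "integrable lborel (\<lambda>\<xi>. cnj (fourier ?g \<xi>) * fourier f \<xi>)"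
    by (intro square_integrable_mult square_integrable_fourier f g)
  have L: "(\<lambda>n. \<integral>\<xi>. fourier f \<xi> * cnj (fourier ?g \<xi>) * complex_of_real (gauss_weight (1 / Suc n) \<xi>) \<partial>lborel)
      \<longlonglongrightarrow> (\<integral>\<xi>. cnj (fourier ?g \<xi>) * fourier f \<xi> \<partial>lborel)"
  proof (rule integral_dominated_convergence[where w = "\<lambda>\<xi>. cmod (cnj (fourier ?g \<xi>) * fourier f \<xi>)"])
    show "integrable lborel (\<lambda>\<xi>. cmod (cnj (fourier ?g \<xi>) * fourier f \<xi>))"
      using prod by (rule integrable_norm)
    show "AE \<xi> in lborel. (\<lambda>n. fourier f \<xi> * cnj (fourier ?g \<xi>) * complex_of_real (gauss_weight (1 / Suc n) \<xi>))
        \<longlonglongrightarrow> cnj (fourier ?g \<xi>) * fourier f \<xi>"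
    proof (intro AE_I2)
      fix \<xi>
      have "(\<lambda>n. fourier f \<xi> * cnj (fourier ?g \<xi>) * complex_of_real (gauss_weight (1 / Suc n) \<xi>))
        \<longlonglongrightarrow> fourier f \<xi> * cnj (fourier ?g \<xi>) * complex_of_real 1"
        by (intro tendsto_intros tendsto_gauss_weight)
      then show "(\<lambda>n. fourier f \<xi> * cnj (fourier ?g \<xi>) * complex_of_real (gauss_weight (1 / Suc n) \<xi>))
        \<longlonglongrightarrow> cnj (fourier ?g \<xi>) * fourier f \<xi>" by (simp add: mult.commute)
    qed
    show "AE \<xi> in lborel. cmod (fourier f \<xi> * cnj (fourier ?g \<xi>) * complex_of_real (gauss_weight (1 / Suc n) \<xi>))
        \<le> cmod (cnj (fourier ?g \<xi>) * fourier f \<xi>)" for n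
      by (intro AE_I2) (simp add: norm_mult mult.commute mult_left_le_one_le)
  qed measurable
  define k where "k n x = (\<integral>y. ?g y * complex_of_real (gauss_kernel (1 / Suc n) (y - x)) \<partial>lborel)" for n x
  have [measurable]: "k n \<in> borel_measurable borel" for n unfolding k_def by measurable
  have k: "cmod (k n x) \<le> 1" for n x
  proof -
    have t: "0 < 1 / real (Suc n)" by simp
    note K = integrable_gauss_kernel_diff[OF t, of x]
    have "integrable lborel (\<lambda>y. ?g y * complex_of_real (gauss_kernel (1 / Suc n) (y - x)))"
      by (rule Bochner_Integration.integrable_bound[OF K(1)]) (auto simp: norm_mult indicator_def)
    then have "cmod (k n x) \<le> (\<integral>y. gauss_kernel (1 / Suc n) (y - x) \<partial>lborel)"
      unfolding k_def using K
      by (intro Bochner_Integration.integral_norm_bound_integral) (auto simp: norm_mult indicator_def)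
    then show ?thesis unfolding K(2) .
  qed
  have eq: "(\<integral>p. f (fst p) * cnj (?g (snd p)) * complex_of_real (gauss_kernel (1 / Suc n) (snd p - fst p)) \<partial>lborel)
      = (\<integral>x. f x * k n x \<partial>lborel)" for n
    using integrable_fourier_gauss_weight[OF f(1) g(1), of "1 / Suc n"]
    unfolding lborel_prod[symmetric]
    by (subst lborel_pair.integral_fst'[symmetric]) (auto simp: k_def mult.assoc)
  have R: "(\<lambda>n. \<integral>x. f x * k n x \<partial>lborel) \<longlonglongrightarrow> (\<integral>x. cnj (?g x) * f x \<partial>lborel)"
  proof (rule integral_dominated_convergence[where w = "\<lambda>x. cmod (f x)"])
    show "integrable lborel (\<lambda>x. cmod (f x))" using f(1) by (rule integrable_norm)
    show "AE x in lborel. (\<lambda>n. f x * k n x) \<longlonglongrightarrow> cnj (?g x) * f x"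
      using AE_tendsto_indicator_box[of a b]
    proof eventually_elim
      case (elim x)
      then have "(\<lambda>n. f x * k n x) \<longlonglongrightarrow> f x * ?g x"
        unfolding k_def by (intro tendsto_intros)
      then show ?case by (simp add: mult.commute)
    qed
    show "AE x in lborel. cmod (f x * k n x) \<le> cmod (f x)" for n
      by (intro AE_I2) (simp add: norm_mult mult_left_le k)
  qed measurable
  have LR: "(\<lambda>n. \<integral>\<xi>. fourier f \<xi> * cnj (fourier ?g \<xi>) * complex_of_real (gauss_weight (1 / Suc n) \<xi>) \<partial>lborel)
      = (\<lambda>n. \<integral>x. f x * k n x \<partial>lborel)"
  proof (rule ext)
    fix n
    show "(\<integral>\<xi>. fourier f \<xi> * cnj (fourier ?g \<xi>) * complex_of_real (gauss_weight (1 / Suc n) \<xi>) \<partial>lborel)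
      = (\<integral>x. f x * k n x \<partial>lborel)"
      unfolding eq[symmetric] by (rule fourier_gauss_weight[OF f(1) g(1)]) simp
  qed
  show ?thesis
    by (rule LIMSEQ_unique[OF L[unfolded LR] R])
qed

text \<open>Boxes form an intersection-stable generator of the Borel sets.\<close>

lemma eq_0_if_orthogonal_to_boxes:
  fixes u :: "'d::finite L2"
  assumes ortho: "\<And>a b. cinner (abs_L2 (indicator (box a b))) u = 0"
  shows "u = 0"
proof -
  let ?f = "rep_L2 u"
  \<comment> \<open>A square-integrable function need not be integrable over the whole space, but it
    is over the bounded boxes \<open>B n\<close>; moreover, cutting a box with \<open>B n\<close>
    gives a box again.\<close>
  define B :: "nat \<Rightarrow> (real^'d) set" where "B n = box (- (real n *\<^sub>R One)) (real n *\<^sub>R One)" for n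
  have box: "integrable lborel (\<lambda>x. indicator (box a b) x * ?f x)"
    "(\<integral>x. indicator (box a b) x * ?f x \<partial>lborel) = 0" for a b
  proof -
    note s = square_integrable_indicator_box(2)[of a b]
    show "integrable lborel (\<lambda>x. indicator (box a b) x * ?f x)"
      using square_integrable_mult[OF s square_integrable_rep[of u]] by simp
    show "(\<integral>x. indicator (box a b) x * ?f x \<partial>lborel) = 0"
      using ortho[of a b] cinner_abs_L2[OF s square_integrable_rep[of u]] by simp
  qed
  have "AE x in lborel. indicator (B n) x * ?f x = 0" for n
  proof -
    let ?g = "\<lambda>x. indicator (B n) x * ?f x"
    have g: "integrable lborel ?g" "(\<integral>x. ?g x \<partial>lborel) = 0"
      unfolding B_def by (rule box)+
    have set_g: "set_integrable lborel A ?g" if "A \<in> sets borel" for A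
      using g(1) that unfolding set_integrable_def by (intro integrable_mult_indicator) auto
    have A: "set_lebesgue_integral lborel A ?g = 0" if "A \<in> sets borel" for A
    proof -
      have "Int_stable (range (\<lambda>(a, b). box a b :: (real^'d) set))"
        by (auto simp: Int_stable_def box_Int_box)
      moreover have "range (\<lambda>(a, b). box a b :: (real^'d) set) \<subseteq> Pow UNIV" by simp
      moreover have "A \<in> sigma_sets UNIV (range (\<lambda>(a, b). box a b :: (real^'d) set))"
        using that by (simp add: borel_eq_box)
      ultimately show ?thesis
      proof (induction rule: sigma_sets_induct_disjoint)
        case (basic A)
        then obtain a b :: "real^'d" where A: "A = box a b" by auto
        obtain c d :: "real^'d" where cd: "box a b \<inter> B n = box c d"
          unfolding B_def by (simp add: box_Int_box)
        have "(\<lambda>x. indicat_real A x *\<^sub>R ?g x) = (\<lambda>x. indicator (box c d) x * ?f x)"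
          unfolding A cd[symmetric] by (auto simp: fun_eq_iff indicator_def)
        then show ?case by (simp add: set_lebesgue_integral_def box)
      next
        case empty
        show ?case by (simp add: set_lebesgue_integral_def)
      next
        \<comment> \<open>The integral over the whole space is already 0, because \<open>B n\<close>
          itself is a box.\<close>
        case (compl A)
        have Ab: "A \<in> sets borel" using compl(1) by (simp add: borel_eq_box)
        have "set_lebesgue_integral lborel (UNIV - A) ?g + set_lebesgue_integral lborel A ?g
            = set_lebesgue_integral lborel ((UNIV - A) \<union> A) ?g"
          using Ab by (intro set_integral_Un[symmetric] set_g) auto
        also have "\<dots> = 0"
          using g(2) by (simp add: set_lebesgue_integral_def)
        finally show ?case using compl(2) by simp
      next
        case (union A)
        then have "A i \<in> sets borel" for i by (auto simp: borel_eq_box)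
        then have "set_lebesgue_integral lborel (\<Union>i. A i) ?g = (\<Sum>i. set_lebesgue_integral lborel (A i) ?g)"
          using union(1) by (intro lebesgue_integral_countable_add set_g) (auto simp: disjoint_family_on_def)
        then show ?case using union(3) by simp
      qed
    qed
    show ?thesis
      by (rule sigma_finite_measure.density_zero[OF sigma_finite_lborel g(1)]) (use A in simp)
  qed
  then have "AE x in lborel. \<forall>n. indicator (B n) x * ?f x = 0" unfolding AE_all_countable by blast
  then have "AE x in lborel. rep_L2 u x = rep_L2 0 x"
    using rep_abs_L2[OF square_integrable_0, where 'a = 'd] unfolding zero_L2.abs_eq[symmetric]
  proof eventually_elim
    case (elim x)
    have "x \<in> (\<Union>n. B n)" unfolding B_def UN_box_eq_UNIV by simp
    then obtain n where "x \<in> B n" by blast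
    with elim show ?case by (auto dest!: spec[of _ n])
  qed
  then show ?thesis by (rule L2_eqI)
qed

section \<open>Truncation, density and extension of the Fourier transform\<close>

text \<open>Serves on both sides of the transform: balls in space give integrable approximations,
  balls in frequency give band-limited functions, and cubes in frequency give the Wiener
  projections.\<close>

definition truncate_L2 :: "(real^'d) set \<Rightarrow> 'd::finite L2 \<Rightarrow> 'd L2" where
  "truncate_L2 E u = abs_L2 (\<lambda>x. indicator E x * rep_L2 u x)"

lemma square_integrable_indicator_mult:
  assumes "E \<in> sets borel" "square_integrable f"
  shows "square_integrable (\<lambda>x. indicator E x * f x)"
proof -
  have [measurable]: "f \<in> borel_measurable borel" "E \<in> sets borel"
    using assms by (auto intro: borel_measurable_square_integrable)
  show ?thesis unfolding square_integrable_def
  proof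
    have "integrable lborel (\<lambda>x. (cmod (f x))\<^sup>2)" using assms(2) by (simp add: square_integrable_def)
    then show "integrable lborel (\<lambda>x. (cmod (indicator E x * f x))\<^sup>2)"
      by (rule Bochner_Integration.integrable_bound) (auto simp: indicator_def)
  qed simp
qed

lemma tendsto_truncate_L2:
  assumes E: "\<And>n. E n \<in> sets borel" "\<And>x. \<forall>\<^sub>F n in sequentially. x \<in> E n"
  shows "(\<lambda>n. truncate_L2 (E n) u) \<longlonglongrightarrow> u"
proof -
  note [measurable] = E(1)
  have "(\<lambda>n. \<integral>x. (cmod (indicator (- E n) x * rep_L2 u x))\<^sup>2 \<partial>lborel) \<longlonglongrightarrow> (\<integral>x. 0 \<partial>(lborel :: (real^'a) measure))"
  proof (rule integral_dominated_convergence[where w = "\<lambda>x. (cmod (rep_L2 u x))\<^sup>2"])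
    show "integrable lborel (\<lambda>x. (cmod (rep_L2 u x))\<^sup>2)"
      using square_integrable_rep[of u] by (simp add: square_integrable_def)
    show "AE x in lborel. (\<lambda>n. (cmod (indicator (- E n) x * rep_L2 u x))\<^sup>2) \<longlonglongrightarrow> 0"
    proof (intro AE_I2 tendsto_eventually)
      fix x show "\<forall>\<^sub>F n in sequentially. (cmod (indicator (- E n) x * rep_L2 u x))\<^sup>2 = 0"
        using E(2)[of x] by eventually_elim simp
    qed
  qed (auto simp: indicator_def)
  moreover have "(\<integral>x. (cmod (indicator (- E n) x * rep_L2 u x))\<^sup>2 \<partial>lborel) = (norm (truncate_L2 (E n) u - u))\<^sup>2" for n
  proof -
    have "AE x in lborel. rep_L2 (truncate_L2 (E n) u) x = indicator (E n) x * rep_L2 u x"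
      unfolding truncate_L2_def
      by (intro rep_abs_L2 square_integrable_indicator_mult E square_integrable_rep)
    then have "AE x in lborel. (cmod (indicator (- E n) x * rep_L2 u x))\<^sup>2
        = (cmod (rep_L2 (truncate_L2 (E n) u - u) x))\<^sup>2"
      using rep_L2_diff[of "truncate_L2 (E n) u" u]
      by eventually_elim (auto simp: indicator_def norm_minus_commute)
    then show ?thesis unfolding norm_L2_rep_square by (intro integral_cong_AE) measurable
  qed
  ultimately have "(\<lambda>n. (norm (truncate_L2 (E n) u - u))\<^sup>2) \<longlonglongrightarrow> 0" by simp
  then have "(\<lambda>n. sqrt ((norm (truncate_L2 (E n) u - u))\<^sup>2)) \<longlonglongrightarrow> sqrt 0"
    by (rule tendsto_real_sqrt)
  then show ?thesis by (simp add: LIM_zero_iff tendsto_norm_zero_iff)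
qed

text \<open>The dense space on which \<open>fourier_L2\<close> is prescribed by the integral
  formula.\<close>

definition L1_L2 :: "(real^'d::finite \<Rightarrow> complex) \<Rightarrow> bool" where
  "L1_L2 f \<longleftrightarrow> integrable lborel f \<and> square_integrable f"

text \<open>The indicator of a ball is itself square integrable, so its product with a
  square-integrable function is integrable.\<close>

lemma L1_L2_cball: "L1_L2 (\<lambda>x. indicator (cball 0 r) x * rep_L2 u x)"
proof -
  let ?B = "cball 0 r :: (real^'a) set"
  have i: "integrable lborel (indicat_real ?B)"
    by (rule integrable_real_indicator) (simp, rule emeasure_bounded_finite[OF bounded_cball])
  have "(cmod (indicator ?B x))\<^sup>2 = indicat_real ?B x" for x :: "real^'a"
    by (simp add: indicator_def)
  moreover have "(indicator ?B :: _ \<Rightarrow> complex) \<in> borel_measurable borel" by (intro borel_measurable_indicator) simp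
  ultimately have "square_integrable (indicator ?B)" using i by (simp add: square_integrable_def)
  from square_integrable_mult[OF this square_integrable_rep[of u]]
  have "integrable lborel (\<lambda>x. indicator ?B x * rep_L2 u x)"
    by (simp add: indicator_def of_bool_def if_distrib cong: if_cong)
  then show ?thesis
    unfolding L1_L2_def by (intro conjI square_integrable_indicator_mult) auto
qed

lemma tendsto_truncate_cball: "(\<lambda>n. truncate_L2 (cball 0 (real n)) u) \<longlonglongrightarrow> u"
proof (rule tendsto_truncate_L2)
  fix x :: "real^'a"
  obtain N where "norm x \<le> real N" using real_arch_simple by blast
  then show "\<forall>\<^sub>F n in sequentially. x \<in> cball 0 (real n)"
    by (intro eventually_sequentiallyI[of N]) (auto intro: order.trans)
qed simp

lemma L1_L2_dense: "\<exists>f. (\<forall>n. L1_L2 (f n)) \<and> (\<lambda>n. abs_L2 (f n)) \<longlonglongrightarrow> u"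
  using L1_L2_cball tendsto_truncate_cball[of u] unfolding truncate_L2_def
  by (intro exI[of _ "\<lambda>n x. indicator (cball 0 (real n)) x * rep_L2 u x"]) auto

lemma L1_L2_add: "L1_L2 f \<Longrightarrow> L1_L2 g \<Longrightarrow> L1_L2 (\<lambda>x. f x + g x)"
  by (auto simp: L1_L2_def intro: square_integrable_add)

lemma L1_L2_scale: "L1_L2 f \<Longrightarrow> L1_L2 (\<lambda>x. c * f x)"
  by (auto simp: L1_L2_def intro: square_integrable_scale)

lemma integrable_cis_mult:
  fixes f :: "real^'d::finite \<Rightarrow> complex"
  assumes "integrable lborel f"
  shows "integrable lborel (\<lambda>x. cis (- (x \<bullet> \<xi>)) * f x)"
proof -
  have [measurable]: "f \<in> borel_measurable borel" using assms by auto
  show ?thesis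
    using assms by (rule Bochner_Integration.integrable_bound) (auto simp: norm_mult)
qed

lemma fourier_add:
  assumes "integrable lborel f" "integrable lborel g"
  shows "fourier (\<lambda>x. f x + g x) = (\<lambda>\<xi>. fourier f \<xi> + fourier g \<xi>)"
  unfolding fourier_def using assms
  by (auto simp: fun_eq_iff distrib_left integrable_cis_mult)

lemma fourier_scale: "fourier (\<lambda>x. c * f x) = (\<lambda>\<xi>. c * fourier f \<xi>)"
  unfolding fourier_def by (auto simp: fun_eq_iff mult.left_commute[of _ c])

lemma fourier_cong_AE:
  assumes "AE x in lborel. f x = g x" "f \<in> borel_measurable borel" "g \<in> borel_measurable borel"
  shows "fourier f = fourier g"
proof
  note [measurable] = assms(2,3)
  show "fourier f \<xi> = fourier g \<xi>" for \<xi>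
    unfolding fourier_def
    by (intro arg_cong2[where f = "(*)"] integral_cong_AE) (use assms(1) in auto)
qed

lemma abs_L2_fourier_add:
  assumes "L1_L2 f" "L1_L2 g"
  shows "abs_L2 (fourier (\<lambda>x. f x + g x)) = abs_L2 (fourier f) + abs_L2 (fourier g)"
  using assms unfolding L1_L2_def
  by (simp add: fourier_add abs_L2_add square_integrable_fourier)

lemma abs_L2_fourier_scale:
  assumes "L1_L2 f"
  shows "abs_L2 (fourier (\<lambda>x. c * f x)) = c *\<^sub>C abs_L2 (fourier f)"
  using assms unfolding L1_L2_def
  by (simp add: fourier_scale abs_L2_scaleC square_integrable_fourier)

text \<open>By linearity the contraction estimate extends to differences; transforms of a Cauchy
  sequence are therefore Cauchy.\<close>

lemma norm_fourier_diff_le: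
  assumes "L1_L2 f" "L1_L2 g"
  shows "norm (abs_L2 (fourier f) - abs_L2 (fourier g)) \<le> norm (abs_L2 f - abs_L2 g)"
proof -
  have h: "L1_L2 (\<lambda>x. f x + (-1) * g x)" by (intro L1_L2_add L1_L2_scale assms)
  have "abs_L2 (fourier f) - abs_L2 (fourier g) = abs_L2 (fourier (\<lambda>x. f x + (-1) * g x))"
    unfolding abs_L2_fourier_add[OF assms(1) L1_L2_scale[OF assms(2), of "-1"]]
      abs_L2_fourier_scale[OF assms(2)]
    by (simp add: scaleC_of_real[of "-1", simplified])
  moreover have "abs_L2 f - abs_L2 g = abs_L2 (\<lambda>x. f x + (-1) * g x)"
    using abs_L2_add[of f "\<lambda>x. (-1) * g x"] abs_L2_scaleC[of g "-1"] assms
      square_integrable_scale[of g "-1"] scaleC_of_real[of "-1" "abs_L2 g"]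
    unfolding L1_L2_def by simp
  ultimately show ?thesis using norm_fourier_le[of "\<lambda>x. f x + (-1) * g x"] h
    unfolding L1_L2_def by simp
qed

lemma bounded_linear_eq_on_L1_L2:
  fixes S T :: "'d::finite L2 \<Rightarrow> 'b::real_normed_vector"
  assumes "bounded_linear S" "bounded_linear T" "\<And>f. L1_L2 f \<Longrightarrow> S (abs_L2 f) = T (abs_L2 f)"
  shows "S = T"
proof
  fix u :: "'d L2"
  obtain f where f: "\<And>n. L1_L2 (f n)" "(\<lambda>n. abs_L2 (f n)) \<longlonglongrightarrow> u"
    using L1_L2_dense by blast
  have "(\<lambda>n. S (abs_L2 (f n))) \<longlonglongrightarrow> S u" "(\<lambda>n. S (abs_L2 (f n))) \<longlonglongrightarrow> T u"
    using bounded_linear.tendsto[OF assms(1) f(2)] bounded_linear.tendsto[OF assms(2) f(2)]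
    by (simp_all add: assms(3) f(1))
  then show "S u = T u" by (rule LIMSEQ_unique)
qed

text \<open>The transforms of the truncations to growing balls form a Cauchy sequence, and its limit
  is linear with norm at most 1. Using these particular approximants defines \<open>T\<close>
  without choosing a sequence for each vector.\<close>

lemma fourier_extension_exists:
  "\<exists>T. bounded_linear T \<and> (\<forall>f. integrable lborel f \<and> square_integrable f \<longrightarrow>
    square_integrable (fourier f) \<and> T (abs_L2 f) = abs_L2 (fourier f :: real^'d::finite \<Rightarrow> complex))"
proof -
  define F where "F n u = abs_L2 (fourier (\<lambda>x. indicator (cball 0 (real n)) x * rep_L2 u x))"
    for n and u :: "'d L2"
  define T where "T u = lim (\<lambda>n. F n u)" for u
  let ?c = "\<lambda>n. indicator (cball 0 (real n)) :: real^'d \<Rightarrow> complex"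
  \<comment> \<open>The transform only depends on the class of a function, so \<open>F n\<close> may
    be computed from any representative; this is what gives its additivity.\<close>
  have cong: "F n u = abs_L2 (fourier (\<lambda>x. ?c n x * f x))"
    if "AE x in lborel. rep_L2 u x = f x" "square_integrable f" for n u f
  proof -
    have [measurable]: "f \<in> borel_measurable borel"
      using that(2) by (rule borel_measurable_square_integrable)
    show ?thesis unfolding F_def
    proof (intro arg_cong[where f = abs_L2] fourier_cong_AE)
      show "AE x in lborel. ?c n x * rep_L2 u x = ?c n x * f x" using that(1) by auto
    qed (auto intro!: borel_measurable_times borel_measurable_indicator)
  qed
  have lim: "(\<lambda>n. F n u) \<longlonglongrightarrow> T u" for u
  proof -
    have "Cauchy (\<lambda>n. truncate_L2 (cball 0 (real n)) u)"
      using tendsto_truncate_cball[of u] by (rule LIMSEQ_imp_Cauchy)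
    then have "Cauchy (\<lambda>n. F n u)"
      unfolding Cauchy_def dist_norm F_def truncate_L2_def
      by (blast intro: le_less_trans[OF norm_fourier_diff_le[OF L1_L2_cball L1_L2_cball]])
    then show ?thesis unfolding T_def by (simp add: Cauchy_convergent_iff convergent_LIMSEQ_iff)
  qed
  have T: "T (abs_L2 f) = abs_L2 (fourier f)" if f: "L1_L2 f" for f
  proof -
    have f': "square_integrable f" using f by (simp add: L1_L2_def)
    have c: "L1_L2 (\<lambda>x. ?c n x * f x)" for n
    proof -
      have "integrable lborel (\<lambda>x. indicat_real (cball 0 (real n)) x *\<^sub>R f x)"
        using f by (intro integrable_mult_indicator) (auto simp: L1_L2_def)
      then show ?thesis using f' unfolding L1_L2_def
        by (intro conjI square_integrable_indicator_mult)
          (auto simp: indicator_def of_bool_def if_distrib if_distribR cong: if_cong)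
    qed
    have "truncate_L2 (cball 0 (real n)) (abs_L2 f) = abs_L2 (\<lambda>x. ?c n x * f x)" for n
      unfolding truncate_L2_def
      by (subst abs_L2_eq_iff) (use rep_abs_L2[OF f'] f' in \<open>auto intro!: square_integrable_indicator_mult elim: AE_mp\<close>)
    then have "(\<lambda>n. abs_L2 (\<lambda>x. ?c n x * f x)) \<longlonglongrightarrow> abs_L2 f"
      using tendsto_truncate_cball[of "abs_L2 f"] by simp
    then have "(\<lambda>n. abs_L2 (\<lambda>x. ?c n x * f x) - abs_L2 f) \<longlonglongrightarrow> 0" by (rule LIM_zero)
    then have "(\<lambda>n. F n (abs_L2 f) - abs_L2 (fourier f)) \<longlonglongrightarrow> 0"
      by (rule tendsto_0_le[where K = 1])
        (use norm_fourier_diff_le[OF c f] cong[OF rep_abs_L2[OF f'] f'] in simp)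
    then have "(\<lambda>n. F n (abs_L2 f)) \<longlonglongrightarrow> abs_L2 (fourier f)" by (simp add: LIM_zero_iff)
    then show ?thesis using lim LIMSEQ_unique by blast
  qed
  have "bounded_linear T"
  proof (rule bounded_linear_intro)
    fix u v :: "'d L2" and r :: real
    have "F n (u + v) = F n u + F n v" for n
      using cong[OF rep_L2_add[of u v], of n] abs_L2_fourier_add[OF L1_L2_cball[of n u] L1_L2_cball[of n v]]
      by (simp add: F_def square_integrable_add distrib_left)
    then show "T (u + v) = T u + T v"
      using tendsto_add[OF lim[of u] lim[of v]] lim[of "u + v"] LIMSEQ_unique by simp
    have "F n (r *\<^sub>R u) = r *\<^sub>R F n u" for n
      using cong[OF rep_L2_scaleC[of "complex_of_real r" u], of n]
        abs_L2_fourier_scale[OF L1_L2_cball[of n u], of "complex_of_real r"]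
      by (simp add: F_def square_integrable_scale mult.left_commute scaleC_of_real)
    then show "T (r *\<^sub>R u) = r *\<^sub>R T u"
      using tendsto_scaleR[OF tendsto_const lim[of u], of r] lim[of "r *\<^sub>R u"] LIMSEQ_unique by simp
    have "norm (F n u) \<le> norm (truncate_L2 (cball 0 (real n)) u)" for n
      unfolding F_def truncate_L2_def using L1_L2_cball[of n u]
      by (intro norm_fourier_le) (auto simp: L1_L2_def)
    then have "norm (T u) \<le> norm u"
      by (intro LIMSEQ_le[OF tendsto_norm[OF lim] tendsto_norm[OF tendsto_truncate_cball]]) auto
    then show "norm (T u) \<le> norm u * 1" by simp
  qed
  then show ?thesis
    using T square_integrable_fourier unfolding L1_L2_def by blast
qed

text \<open>A bounded operator is determined by its values on a dense subspace, so the definite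
  description defining \<open>fourier_L2\<close> is met.\<close>

lemma
  shows bounded_linear_fourier_L2: "bounded_linear (fourier_L2 :: 'd::finite L2 \<Rightarrow> 'd L2)"
    and fourier_L2_abs: "\<And>f :: real^'d \<Rightarrow> complex. L1_L2 f \<Longrightarrow> fourier_L2 (abs_L2 f) = abs_L2 (fourier f)"
proof -
  let ?P = "\<lambda>T. bounded_linear T \<and> (\<forall>f. integrable lborel f \<and> square_integrable f \<longrightarrow>
    square_integrable (fourier f) \<and> T (abs_L2 f) = abs_L2 (fourier f :: real^'d \<Rightarrow> complex))"
  have "\<exists>!T. ?P T"
  proof (rule ex_ex1I)
    show "\<exists>T. ?P T" by (rule fourier_extension_exists)
    show "S = T" if "?P S" "?P T" for S T
      using that by (intro bounded_linear_eq_on_L1_L2) (auto simp: L1_L2_def)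
  qed
  from theI'[OF this] have "?P fourier_L2" unfolding fourier_L2_def .
  then show "bounded_linear (fourier_L2 :: 'd L2 \<Rightarrow> 'd L2)"
    and "\<And>f :: real^'d \<Rightarrow> complex. L1_L2 f \<Longrightarrow> fourier_L2 (abs_L2 f) = abs_L2 (fourier f)"
    by (auto simp: L1_L2_def)
qed

lemma fourier_L2_scaleC: "fourier_L2 (c *\<^sub>C u) = c *\<^sub>C fourier_L2 (u :: 'd::finite L2)"
proof -
  have "(\<lambda>u :: 'd L2. fourier_L2 (c *\<^sub>C u)) = (\<lambda>u. c *\<^sub>C fourier_L2 u)"
  proof (rule bounded_linear_eq_on_L1_L2)
    show "bounded_linear (\<lambda>u :: 'd L2. fourier_L2 (c *\<^sub>C u))"
      by (rule bounded_linear_compose[OF bounded_linear_fourier_L2 scaleC.bounded_linear_right])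
    show "bounded_linear (\<lambda>u :: 'd L2. c *\<^sub>C fourier_L2 u)"
      by (rule bounded_linear_compose[OF scaleC.bounded_linear_right bounded_linear_fourier_L2])
    fix f :: "real^'d \<Rightarrow> complex" assume f: "L1_L2 f"
    then have "square_integrable f" by (simp add: L1_L2_def)
    then have "fourier_L2 (c *\<^sub>C abs_L2 f) = fourier_L2 (abs_L2 (\<lambda>x. c * f x))"
      by (simp add: abs_L2_scaleC)
    also have "\<dots> = c *\<^sub>C fourier_L2 (abs_L2 f)"
      using f by (simp add: fourier_L2_abs L1_L2_scale abs_L2_fourier_scale)
    finally show "fourier_L2 (c *\<^sub>C abs_L2 f) = c *\<^sub>C fourier_L2 (abs_L2 f)" .
  qed
  then show ?thesis by metis
qed

section \<open>Adjoint, unitarity and surjectivity of the Fourier transform\<close>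

text \<open>Conjugating the Fourier transform by this map gives its adjoint, which turns out to be
  its inverse, without introducing the inverse Fourier integral. The map is antilinear, but bounded
  and linear over the reals, so arguments by density still apply.\<close>

definition conj_L2 :: "'d::finite L2 \<Rightarrow> 'd L2" where
  "conj_L2 u = abs_L2 (\<lambda>x. cnj (rep_L2 u x))"

lemma square_integrable_cnj: "square_integrable f \<Longrightarrow> square_integrable (\<lambda>x. cnj (f x))"
  by (auto simp: square_integrable_def intro: measurable_compose[OF _ borel_measurable_cnj])

lemma conj_L2_abs:
  assumes "square_integrable f"
  shows "conj_L2 (abs_L2 f) = abs_L2 (\<lambda>x. cnj (f x))"
  unfolding conj_L2_def
  by (subst abs_L2_eq_iff) (use assms rep_abs_L2[OF assms] in \<open>auto intro: square_integrable_cnj\<close>)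

lemma conj_conj_L2 [simp]: "conj_L2 (conj_L2 u) = u"
  unfolding conj_L2_def[of u]
  by (subst conj_L2_abs) (simp_all add: square_integrable_cnj)

lemma bounded_linear_conj_L2: "bounded_linear (conj_L2 :: 'd::finite L2 \<Rightarrow> 'd L2)"
proof (rule bounded_linear_intro)
  fix u v :: "'d L2" and r :: real
  have *: "conj_L2 w = abs_L2 (\<lambda>x. cnj (f x))" if "w = abs_L2 f" "square_integrable f" for w :: "'d L2" and f
    using that conj_L2_abs by simp
  show "conj_L2 (u + v) = conj_L2 u + conj_L2 v"
    by (subst *[of _ "\<lambda>x. rep_L2 u x + rep_L2 v x"])
      (auto simp: abs_L2_add[symmetric] square_integrable_add square_integrable_cnj conj_L2_def)
  show "conj_L2 (r *\<^sub>R u) = r *\<^sub>R conj_L2 u"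
    by (subst *[of _ "\<lambda>x. complex_of_real r * rep_L2 u x"])
      (auto simp: abs_L2_scaleC[symmetric] square_integrable_scale square_integrable_cnj conj_L2_def scaleC_of_real)
  have "(norm (conj_L2 u))\<^sup>2 = (norm u)\<^sup>2"
    unfolding conj_L2_def norm_L2_rep_square[of u]
    by (subst norm_abs_L2_square) (auto simp: square_integrable_cnj)
  then show "norm (conj_L2 u) \<le> norm u * 1" by (simp add: power2_eq_iff_nonneg)
qed

text \<open>The kernel \<open>cis (- (x \<bullet> \<xi>))\<close> is symmetric in its variables, so
  Fubini's theorem moves the transform from one factor to the other.\<close>

lemma fourier_exchange:
  assumes f: "integrable lborel f" and g: "integrable lborel g"
  shows "(\<integral>\<xi>. fourier f \<xi> * g \<xi> \<partial>lborel) = (\<integral>x. f x * fourier g x \<partial>lborel)"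
proof -
  define G where "G x \<xi> = cis (- (x \<bullet> \<xi>)) * f x * g \<xi>" for x \<xi>
  have [measurable]: "f \<in> borel_measurable borel" "g \<in> borel_measurable borel"
    using f g by auto
  have G: "integrable (lborel \<Otimes>\<^sub>M lborel) (case_prod G)"
    unfolding lborel_prod
    by (rule Bochner_Integration.integrable_bound[OF integrable_lborel_times(1)[OF f g]])
      (auto simp: G_def norm_mult case_prod_unfold)
  have "(\<integral>\<xi>. fourier f \<xi> * g \<xi> \<partial>lborel) = complex_of_real ((2 * pi) powr (- real CARD('a) / 2)) *
      (\<integral>\<xi>. (\<integral>x. G x \<xi> \<partial>lborel) \<partial>lborel)"
    unfolding fourier_def G_def
    by (simp only: integral_mult_left_zero mult.assoc[of "complex_of_real ((2 * pi) powr _)"] integral_mult_right_zero)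
  also have "(\<integral>\<xi>. (\<integral>x. G x \<xi> \<partial>lborel) \<partial>lborel) = (\<integral>x. (\<integral>\<xi>. G x \<xi> \<partial>lborel) \<partial>lborel)"
    by (rule lborel_pair.Fubini_integral[OF G])
  also have "(\<lambda>x. \<integral>\<xi>. G x \<xi> \<partial>lborel) = (\<lambda>x. f x * (\<integral>\<xi>. cis (- (\<xi> \<bullet> x)) * g \<xi> \<partial>lborel))"
  proof
    fix x
    show "(\<integral>\<xi>. G x \<xi> \<partial>lborel) = f x * (\<integral>\<xi>. cis (- (\<xi> \<bullet> x)) * g \<xi> \<partial>lborel)"
      unfolding G_def
      by (subst integral_mult_right_zero[symmetric]) (simp add: inner_commute mult_ac)
  qed
  also have "complex_of_real ((2 * pi) powr (- real CARD('a) / 2)) *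
      (\<integral>x. f x * (\<integral>\<xi>. cis (- (\<xi> \<bullet> x)) * g \<xi> \<partial>lborel) \<partial>lborel) = (\<integral>x. f x * fourier g x \<partial>lborel)"
    unfolding fourier_def by (simp add: mult.left_commute flip: integral_mult_right_zero)
  finally show ?thesis .
qed

text \<open>The exchange formula with conjugates inserted, extended by density in one argument at a
  time.\<close>

lemma cinner_fourier_L2_adjoint:
  "cinner (conj_L2 (fourier_L2 (conj_L2 u))) v = cinner u (fourier_L2 v)"
proof -
  note bl = bounded_linear_fourier_L2 bounded_linear_conj_L2
  have base: "cinner (conj_L2 (fourier_L2 (abs_L2 f))) (abs_L2 g) = cinner (conj_L2 (abs_L2 f)) (fourier_L2 (abs_L2 g))"
    if "L1_L2 f" "L1_L2 g" for f g :: "real^'a \<Rightarrow> complex"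
    using that fourier_exchange[of f g]
    by (auto simp: fourier_L2_abs L1_L2_def conj_L2_abs square_integrable_fourier cinner_abs_L2 square_integrable_cnj)
  have 1: "(\<lambda>v. cinner (conj_L2 (fourier_L2 (abs_L2 f))) v) = (\<lambda>v. cinner (conj_L2 (abs_L2 f)) (fourier_L2 v))"
    if "L1_L2 f" for f :: "real^'a \<Rightarrow> complex"
    using that base
    by (intro bounded_linear_eq_on_L1_L2 cinner.bounded_linear_right
        bounded_linear_compose[OF cinner.bounded_linear_right bl(1)])
  have "(\<lambda>w. cinner (conj_L2 (fourier_L2 w)) v) = (\<lambda>w. cinner (conj_L2 w) (fourier_L2 v))"
    using fun_cong[OF 1]
    by (intro bounded_linear_eq_on_L1_L2 bounded_linear_compose[OF cinner.bounded_linear_left]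
        bounded_linear_compose[OF bl(2) bl(1)] bl(2))
  from fun_cong[OF this, of "conj_L2 u"] show ?thesis by simp
qed

text \<open>Parseval's identity against box indicators, rewritten with the adjoint, says that the
  difference of the two sides is orthogonal to all boxes.\<close>

lemma conj_fourier_conj_fourier [simp]: "conj_L2 (fourier_L2 (conj_L2 (fourier_L2 u))) = u"
proof -
  let ?S = "\<lambda>w. conj_L2 (fourier_L2 (conj_L2 w))"
  have box: "cinner (fourier_L2 (abs_L2 (indicator (box a b)))) (fourier_L2 w) = cinner (abs_L2 (indicator (box a b))) w"
    for a b and w :: "'a L2"
  proof -
    note g = square_integrable_indicator_box[of a b]
    have "(\<lambda>w. cinner (fourier_L2 (abs_L2 (indicator (box a b)))) (fourier_L2 w)) = cinner (abs_L2 (indicator (box a b)))"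
    proof (rule bounded_linear_eq_on_L1_L2)
      fix f :: "real^'a \<Rightarrow> complex" assume f: "L1_L2 f"
      then show "cinner (fourier_L2 (abs_L2 (indicator (box a b)))) (fourier_L2 (abs_L2 f))
          = cinner (abs_L2 (indicator (box a b))) (abs_L2 f)"
        using g fourier_inner_indicator_box[of f a b]
        by (simp add: fourier_L2_abs L1_L2_def cinner_abs_L2 square_integrable_fourier)
    qed (intro cinner.bounded_linear_right bounded_linear_compose[OF cinner.bounded_linear_right bounded_linear_fourier_L2])+
    then show ?thesis by metis
  qed
  have "cinner (abs_L2 (indicator (box a b))) (?S (fourier_L2 u) - u) = 0" for a b
    using cinner_fourier_L2_adjoint[of "fourier_L2 u" "abs_L2 (indicator (box a b))"] box[of a b u]
    unfolding cinner_diff_right by (metis cinner_commute diff_self)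
  then have "?S (fourier_L2 u) - u = 0" by (rule eq_0_if_orthogonal_to_boxes)
  then show ?thesis by simp
qed

theorem cinner_fourier_L2 [simp]: "cinner (fourier_L2 u) (fourier_L2 v) = cinner u v"
  using cinner_fourier_L2_adjoint[of "fourier_L2 u" v] by simp

theorem bij_fourier_L2: "bij fourier_L2"
proof (rule bijI)
  show "inj fourier_L2"
    by (rule inj_on_inverseI[where g = "\<lambda>u. conj_L2 (fourier_L2 (conj_L2 u))"]) simp
  \<comment> \<open>Conjugating the left inverse identity by \<open>conj_L2\<close> yields the right
    inverse identity.\<close>
  have "fourier_L2 (conj_L2 (fourier_L2 (conj_L2 w))) = w" for w :: "'a L2"
    using conj_fourier_conj_fourier[of "conj_L2 w"] by (metis conj_conj_L2)
  then show "surj (fourier_L2 :: 'a L2 \<Rightarrow> 'a L2)" by (rule surjI)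
qed

section \<open>Orthogonal series\<close>

lemma
  fixes x :: "'i \<Rightarrow> 'b::{real_inner,banach}"
  assumes orth: "pairwise (\<lambda>i j. orthogonal (x i) (x j)) I"
    and sq: "(\<lambda>i. (norm (x i))\<^sup>2) summable_on I"
  shows summable_on_orthogonal: "x summable_on I"
    and norm_infsum_orthogonal: "(norm (infsum x I))\<^sup>2 = (\<Sum>\<^sub>\<infinity>i\<in>I. (norm (x i))\<^sup>2)"
proof -
  let ?S = "\<Sum>\<^sub>\<infinity>i\<in>I. (norm (x i))\<^sup>2"
  have pyth: "(norm (sum x F))\<^sup>2 = (\<Sum>i\<in>F. (norm (x i))\<^sup>2)" if "finite F" "F \<subseteq> I" for F
    using that orth by (intro norm_sum_Pythagorean) (auto intro: pairwise_subset)
  have hs: "((\<lambda>i. (norm (x i))\<^sup>2) has_sum ?S) I" using sq by simp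
  have "\<exists>P. eventually P (finite_subsets_at_top I) \<and> (\<forall>F G. P F \<and> P G \<longrightarrow> dist (sum x F) (sum x G) < e)"
    if "e > 0" for e
  proof -
    have "0 < (e/2)\<^sup>2" using that by simp
    then obtain F0 where F0: "finite F0" "F0 \<subseteq> I"
      "\<And>F. finite F \<Longrightarrow> F0 \<subseteq> F \<Longrightarrow> F \<subseteq> I \<Longrightarrow> dist (\<Sum>i\<in>F. (norm (x i))\<^sup>2) ?S < (e/2)\<^sup>2"
      using hs[unfolded has_sum_def tendsto_iff eventually_finite_subsets_at_top, rule_format, of "(e/2)\<^sup>2"]
      by metis
    \<comment> \<open>Comparison with the common subset \<open>F0\<close> keeps the sets nested; any
      two sets above \<open>F0\<close> are then within \<open>e\<close> by the triangle
      inequality.\<close>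
    have near: "dist (sum x F) (sum x F0) < e / 2" if F: "finite F" "F0 \<subseteq> F" "F \<subseteq> I" for F
    proof -
      have "(norm (sum x F - sum x F0))\<^sup>2 = (norm (sum x (F - F0)))\<^sup>2"
        using F by (simp add: sum_diff)
      also have "\<dots> = (\<Sum>i\<in>F - F0. (norm (x i))\<^sup>2)" using F by (intro pyth) auto
      also have "\<dots> = (\<Sum>i\<in>F. (norm (x i))\<^sup>2) - (\<Sum>i\<in>F0. (norm (x i))\<^sup>2)"
        using F by (simp add: sum_diff)
      also have "\<dots> \<le> ?S - (\<Sum>i\<in>F0. (norm (x i))\<^sup>2)"
        using finite_sum_le_infsum[OF sq F(1,3)] by simp
      also have "\<dots> < (e/2)\<^sup>2"
        using F0(3)[OF F0(1) order_refl F0(2)] unfolding dist_real_def abs_less_iff by simp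
      finally have "(norm (sum x F - sum x F0))\<^sup>2 < (e/2)\<^sup>2" .
      then have "norm (sum x F - sum x F0) < e/2"
        by (rule power2_less_imp_less) (use \<open>e > 0\<close> in simp)
      then show ?thesis unfolding dist_norm .
    qed
    have "dist (sum x F) (sum x G) < e"
      if "(finite F \<and> F0 \<subseteq> F \<and> F \<subseteq> I) \<and> (finite G \<and> F0 \<subseteq> G \<and> G \<subseteq> I)" for F G
      using dist_triangle_half_l[OF near[of F] near[of G]] that by blast
    moreover have "eventually (\<lambda>F. finite F \<and> F0 \<subseteq> F \<and> F \<subseteq> I) (finite_subsets_at_top I)"
      unfolding eventually_finite_subsets_at_top using F0(1,2) by (intro exI[of _ F0]) simp
    ultimately show ?thesis
      by (intro exI[of _ "\<lambda>F. finite F \<and> F0 \<subseteq> F \<and> F \<subseteq> I"] conjI allI impI)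
  qed
  then have "cauchy_filter (filtermap (sum x) (finite_subsets_at_top I))"
    by (simp add: cauchy_filter_metric_filtermap)
  moreover have "Topological_Spaces.complete (UNIV :: 'b set)"
    by (meson Cauchy_convergent UNIV_I complete_def convergent_def)
  ultimately obtain L where L: "(sum x \<longlongrightarrow> L) (finite_subsets_at_top I)"
    using complete_uniform[where S = UNIV] by (force simp: filterlim_def)
  then show s: "x summable_on I" by (auto simp: summable_on_def has_sum_def)
  have "((\<lambda>F. (norm (sum x F))\<^sup>2) \<longlongrightarrow> (norm (infsum x I))\<^sup>2) (finite_subsets_at_top I)"
    using s[unfolded summable_iff_has_sum_infsum has_sum_def] by (intro tendsto_intros)
  moreover have "((\<lambda>F. (norm (sum x F))\<^sup>2) \<longlongrightarrow> ?S) (finite_subsets_at_top I)"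
  proof (rule Lim_transform_eventually)
    show "((\<lambda>F. \<Sum>i\<in>F. (norm (x i))\<^sup>2) \<longlongrightarrow> ?S) (finite_subsets_at_top I)"
      using hs by (simp add: has_sum_def)
    show "\<forall>\<^sub>F F in finite_subsets_at_top I. (\<Sum>i\<in>F. (norm (x i))\<^sup>2) = (norm (sum x F))\<^sup>2"
      by (rule eventually_finite_subsets_at_top_weakI) (simp add: pyth)
  qed
  ultimately show "(norm (infsum x I))\<^sup>2 = ?S" by (rule tendsto_unique[rotated]) simp
qed

text \<open>Indexed by arbitrary sets, so as to cover both sequences and, with the identity as the
  family, bases.\<close>

definition orthonormal_on :: "'i set \<Rightarrow> ('i \<Rightarrow> 'd::finite L2) \<Rightarrow> bool" where
  "orthonormal_on I e \<longleftrightarrow> (\<forall>i\<in>I. \<forall>j\<in>I. cinner (e i) (e j) = (if i = j then 1 else 0))"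

lemma orthonormal_on_subset: "orthonormal_on I e \<Longrightarrow> J \<subseteq> I \<Longrightarrow> orthonormal_on J e"
  unfolding orthonormal_on_def by blast

lemma orthonormal_on_norm:
  assumes "orthonormal_on I e" "i \<in> I"
  shows "norm (e i) = 1"
proof -
  have "complex_of_real ((norm (e i))\<^sup>2) = 1"
    using assms unfolding cinner_self[symmetric] orthonormal_on_def by simp
  then have "(norm (e i))\<^sup>2 = 1\<^sup>2" by (simp only: of_real_eq_1_iff power_one)
  then show ?thesis by (subst (asm) power2_eq_iff_nonneg) auto
qed

lemma orthonormal_on_orthogonal:
  "orthonormal_on I e \<Longrightarrow> pairwise (\<lambda>i j. orthogonal (c i *\<^sub>C e i) (c j *\<^sub>C e j)) I"
  by (auto simp: pairwise_def orthogonal_def inner_L2_def cinner_scaleC_left cinner_scaleC_right orthonormal_on_def)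

text \<open>For the partial expansion \<open>s\<close> the product \<open>cinner s u\<close> is the
  squared norm of \<open>s\<close>, and Cauchy-Schwarz gives
  \<open>norm s \<le> norm u\<close>.\<close>

lemma Bessel_finite:
  assumes e: "orthonormal_on I e" and I: "finite I"
  shows "(\<Sum>i\<in>I. (cmod (cinner (e i) u))\<^sup>2) \<le> (norm u)\<^sup>2"
proof -
  define s where "s = (\<Sum>i\<in>I. cinner (e i) u *\<^sub>C e i)"
  have s: "(norm s)\<^sup>2 = (\<Sum>i\<in>I. (cmod (cinner (e i) u))\<^sup>2)"
    unfolding s_def
    by (subst norm_sum_Pythagorean[OF I orthonormal_on_orthogonal[OF e]])
      (simp add: power_mult_distrib orthonormal_on_norm[OF e])
  have "cinner s u = (\<Sum>i\<in>I. complex_of_real ((cmod (cinner (e i) u))\<^sup>2))"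
    unfolding s_def cinner.sum_left cinner_scaleC_left complex_norm_square by (simp add: mult.commute)
  then have "cinner s u = complex_of_real ((norm s)\<^sup>2)" by (simp add: s)
  then have "(norm s)\<^sup>2 \<le> norm s * norm u"
    using cmod_cinner_le[of s u] by (simp add: norm_power)
  then have "norm s \<le> norm u" by (cases "norm s = 0") (auto simp: power2_eq_square)
  then show ?thesis unfolding s[symmetric] by (intro power_mono) auto
qed

lemma
  assumes e: "orthonormal_on I e"
  shows Bessel_summable: "(\<lambda>i. (cmod (cinner (e i) u))\<^sup>2) summable_on I"
    and Bessel: "(\<Sum>\<^sub>\<infinity>i\<in>I. (cmod (cinner (e i) u))\<^sup>2) \<le> (norm u)\<^sup>2"
proof -
  have b: "(\<Sum>i\<in>F. (cmod (cinner (e i) u))\<^sup>2) \<le> (norm u)\<^sup>2" if "finite F" "F \<subseteq> I" for F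
    using that by (intro Bessel_finite orthonormal_on_subset[OF e])
  then show s: "(\<lambda>i. (cmod (cinner (e i) u))\<^sup>2) summable_on I"
    by (intro nonneg_bdd_above_summable_on bdd_aboveI2[where M = "(norm u)\<^sup>2"]) auto
  show "(\<Sum>\<^sub>\<infinity>i\<in>I. (cmod (cinner (e i) u))\<^sup>2) \<le> (norm u)\<^sup>2"
    using s b by (rule infsum_le_finite_sums)
qed

text \<open>The terms are orthogonal because \<open>f\<close> is orthonormal, and bounded weights
  let the Bessel series of \<open>u\<close> dominate their squared norms. Different systems on the
  left and right are what a singular value decomposition requires.\<close>

lemma
  assumes e: "orthonormal_on I e" and f: "orthonormal_on I f" and q: "\<And>i. i \<in> I \<Longrightarrow> \<bar>q i\<bar> \<le> C"
  shows summable_on_orthonormal: "(\<lambda>i. q i *\<^sub>R rank_one (f i) (e i) u) summable_on I"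
    and norm_infsum_orthonormal: "(norm (\<Sum>\<^sub>\<infinity>i\<in>I. q i *\<^sub>R rank_one (f i) (e i) u))\<^sup>2
      = (\<Sum>\<^sub>\<infinity>i\<in>I. (q i)\<^sup>2 * (cmod (cinner (e i) u))\<^sup>2)"
    and norm_infsum_orthonormal_le: "norm (\<Sum>\<^sub>\<infinity>i\<in>I. q i *\<^sub>R rank_one (f i) (e i) u) \<le> \<bar>C\<bar> * norm u"
proof -
  let ?x = "\<lambda>i. q i *\<^sub>R rank_one (f i) (e i) u"
  have x: "?x i = (complex_of_real (q i) * cinner (e i) u) *\<^sub>C f i" for i
    by (simp add: rank_one_def flip: scaleC_of_real)
  have nx: "(norm (?x i))\<^sup>2 = (q i)\<^sup>2 * (cmod (cinner (e i) u))\<^sup>2" if "i \<in> I" for i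
    unfolding x using orthonormal_on_norm[OF f that] by (simp add: power_mult_distrib norm_mult)
  have q2: "(q i)\<^sup>2 * (cmod (cinner (e i) u))\<^sup>2 \<le> C\<^sup>2 * (cmod (cinner (e i) u))\<^sup>2" if "i \<in> I" for i
    using q[OF that] by (intro mult_right_mono) (auto simp: abs_le_square_iff[symmetric])
  have Cs: "(\<lambda>i. C\<^sup>2 * (cmod (cinner (e i) u))\<^sup>2) summable_on I"
    by (intro summable_on_cmult_right Bessel_summable e)
  have s: "(\<lambda>i. (q i)\<^sup>2 * (cmod (cinner (e i) u))\<^sup>2) summable_on I"
    by (rule summable_on_comparison_test[OF Cs]) (use q2 in auto)
  then have s': "(\<lambda>i. (norm (?x i))\<^sup>2) summable_on I"
    by (rule summable_on_cong[THEN iffD1, rotated]) (simp only: nx)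
  have o: "pairwise (\<lambda>i j. orthogonal (?x i) (?x j)) I"
    unfolding x by (rule orthonormal_on_orthogonal[OF f])
  show "?x summable_on I" by (rule summable_on_orthogonal[OF o s'])
  have "(norm (infsum ?x I))\<^sup>2 = (\<Sum>\<^sub>\<infinity>i\<in>I. (norm (?x i))\<^sup>2)"
    by (rule norm_infsum_orthogonal[OF o s'])
  also have "\<dots> = (\<Sum>\<^sub>\<infinity>i\<in>I. (q i)\<^sup>2 * (cmod (cinner (e i) u))\<^sup>2)"
    by (intro infsum_cong nx)
  finally show *: "(norm (infsum ?x I))\<^sup>2 = (\<Sum>\<^sub>\<infinity>i\<in>I. (q i)\<^sup>2 * (cmod (cinner (e i) u))\<^sup>2)" .
  also have "\<dots> \<le> (\<Sum>\<^sub>\<infinity>i\<in>I. C\<^sup>2 * (cmod (cinner (e i) u))\<^sup>2)"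
    by (intro infsum_mono s Cs q2)
  also have "\<dots> = C\<^sup>2 * (\<Sum>\<^sub>\<infinity>i\<in>I. (cmod (cinner (e i) u))\<^sup>2)"
    by (intro infsum_cmult_right Bessel_summable e)
  also have "\<dots> \<le> C\<^sup>2 * (norm u)\<^sup>2"
    by (intro mult_left_mono Bessel e) simp
  finally have "(norm (infsum ?x I))\<^sup>2 \<le> (\<bar>C\<bar> * norm u)\<^sup>2" by (simp add: power_mult_distrib)
  then show "norm (infsum ?x I) \<le> \<bar>C\<bar> * norm u" by (rule power2_le_imp_le) simp
qed

text \<open>Zorn's lemma for orthonormal sets: a nonzero vector orthogonal to a maximal one could be
  normalised and added. Existence ensures that the basis chosen in \<open>trace_pos\<close> really
  is one.\<close>

lemma orthonormal_basis_exists: "\<exists>B :: 'd::finite L2 set. orthonormal_basis B"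
proof -
  let ?A = "{B :: 'd L2 set. orthonormal_on B (\<lambda>b. b)}"
  have "\<exists>M\<in>?A. \<forall>X\<in>?A. M \<subseteq> X \<longrightarrow> X = M"
  proof (rule subset_Zorn_nonempty)
    have "{} \<in> ?A" by (simp add: orthonormal_on_def)
    then show "?A \<noteq> {}" by blast
    fix \<C> assume C: "\<C> \<noteq> {}" "subset.chain ?A \<C>"
    have "orthonormal_on (\<Union>\<C>) (\<lambda>b. b)"
      unfolding orthonormal_on_def
    proof (intro ballI)
      fix b c assume "b \<in> \<Union>\<C>" "c \<in> \<Union>\<C>"
      then obtain X Y where XY: "X \<in> \<C>" "Y \<in> \<C>" "b \<in> X" "c \<in> Y" by blast
      moreover have "X \<subseteq> Y \<or> Y \<subseteq> X" using C(2) XY by (auto simp: subset_chain_def)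
      ultimately obtain Z where "Z \<in> \<C>" "b \<in> Z" "c \<in> Z" by blast
      moreover have "orthonormal_on Z (\<lambda>b. b)" using C(2) \<open>Z \<in> \<C>\<close> by (auto simp: subset_chain_def)
      ultimately show "cinner b c = (if b = c then 1 else 0)" by (simp add: orthonormal_on_def)
    qed
    then show "\<Union>\<C> \<in> ?A" by simp
  qed
  then obtain M :: "'d L2 set" where M: "orthonormal_on M (\<lambda>b. b)"
    "\<And>X. orthonormal_on X (\<lambda>b. b) \<Longrightarrow> M \<subseteq> X \<Longrightarrow> X = M"
    by (auto simp only: mem_Collect_eq)
  have "u = 0" if u: "\<And>b. b \<in> M \<Longrightarrow> cinner b u = 0" for u
  proof (rule ccontr)
    assume "u \<noteq> 0"
    define w where "w = inverse (norm u) *\<^sub>R u"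
    have bw: "cinner b w = 0" "cinner w b = 0" if "b \<in> M" for b
      using u[OF that] cinner_commute[of b u] by (simp_all add: w_def cinner_scaleR_right cinner_scaleR_left)
    have w: "cinner w w = 1"
      using \<open>u \<noteq> 0\<close> unfolding cinner_self by (simp add: w_def)
    have "orthonormal_on (insert w M) (\<lambda>b. b)"
      using M(1) bw w unfolding orthonormal_on_def by auto
    then have "w \<in> M" using M(2)[of "insert w M"] by blast
    then show False using bw w by auto
  qed
  moreover have "\<forall>b\<in>M. \<forall>c\<in>M. cinner b c = (if b = c then 1 else 0)"
    using M(1) unfolding orthonormal_on_def .
  ultimately have "orthonormal_basis M"
    unfolding orthonormal_basis_def by (intro conjI allI impI) auto
  then show ?thesis by (rule exI)
qed

text \<open>The difference between \<open>u\<close> and its expansion is orthogonal to the whole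
  basis, hence 0, so the norm formula for orthonormal series applies to \<open>u\<close>.\<close>

lemma Parseval:
  assumes B: "orthonormal_basis B"
  shows "((\<lambda>b. (cmod (cinner b u))\<^sup>2) has_sum (norm u)\<^sup>2) B"
proof -
  have o: "orthonormal_on B (\<lambda>b. b)" using B by (simp add: orthonormal_basis_def orthonormal_on_def)
  define s where "s = (\<Sum>\<^sub>\<infinity>b\<in>B. 1 *\<^sub>R rank_one b b u)"
  have hs: "((\<lambda>b. 1 *\<^sub>R rank_one b b u) has_sum s) B"
    unfolding s_def by (intro has_sum_infsum summable_on_orthonormal[OF o o, of "\<lambda>_. 1" 1]) auto
  have "cinner c (u - s) = 0" if "c \<in> B" for c
  proof -
    have "((\<lambda>b. cinner c (1 *\<^sub>R rank_one b b u)) has_sum cinner c s) B"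
      by (rule has_sum_bounded_linear[OF cinner.bounded_linear_right hs])
    moreover have "((\<lambda>b. cinner c (1 *\<^sub>R rank_one b b u)) has_sum cinner c u) B"
      using o that
      by (intro has_sum_finite_neutralI[of "{c}"]) (auto simp: rank_one_def cinner_scaleC_right orthonormal_on_def)
    ultimately show ?thesis by (simp add: cinner_diff_right has_sum_unique)
  qed
  then have "u - s = 0" using B unfolding orthonormal_basis_def by blast
  then have "u = s" by simp
  then have "(norm u)\<^sup>2 = (\<Sum>\<^sub>\<infinity>b\<in>B. (cmod (cinner b u))\<^sup>2)"
    using norm_infsum_orthonormal[OF o o, of "\<lambda>_. 1" 1 u] by (simp add: s_def)
  then show ?thesis using Bessel_summable[OF o, of u] by (simp add: has_sum_infsum)
qed

section \<open>Operators with a singular value decomposition\<close>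

lemma orthonormal_seq_iff: "orthonormal_seq e \<longleftrightarrow> orthonormal_on UNIV e"
  by (simp add: orthonormal_seq_def orthonormal_on_def)

text \<open>Unlike in \<open>svd\<close>, weights of either sign are intended, since the randomized
  coefficients \<open>a n * g n\<close> change sign.\<close>

definition sv_op :: "(nat \<Rightarrow> real) \<Rightarrow> (nat \<Rightarrow> 'd::finite L2) \<Rightarrow> (nat \<Rightarrow> 'd L2) \<Rightarrow> 'd L2 \<Rightarrow> 'd L2" where
  "sv_op q f e \<phi> = (\<Sum>\<^sub>\<infinity>n. q n *\<^sub>R rank_one (f n) (e n) \<phi>)"

locale sv_system =
  fixes q :: "nat \<Rightarrow> real" and f e :: "nat \<Rightarrow> 'd::finite L2" and C :: real
  assumes f: "orthonormal_seq f" and e: "orthonormal_seq e" and q: "\<And>n. \<bar>q n\<bar> \<le> C"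
begin

lemma swap: "sv_system q e f C"
  by standard (fact e f q)+

lemma has_sum: "((\<lambda>n. q n *\<^sub>R rank_one (f n) (e n) \<phi>) has_sum sv_op q f e \<phi>) UNIV"
  unfolding sv_op_def using f e q
  by (intro has_sum_infsum summable_on_orthonormal[of _ _ _ _ C]) (auto simp: orthonormal_seq_iff)

lemma norm_le: "norm (sv_op q f e \<phi>) \<le> C * norm \<phi>"
proof -
  have "C \<ge> 0" using q[of 0] by linarith
  then show ?thesis
    using norm_infsum_orthonormal_le[of UNIV e f q C \<phi>] f e q unfolding sv_op_def orthonormal_seq_iff by simp
qed

lemma L2_operator: "L2_operator (sv_op q f e)"
  unfolding L2_operator_def
proof (intro conjI allI bounded_linear_intro)
  fix \<phi> \<psi> :: "'d L2" and r :: real and c :: complex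
  have "((\<lambda>n. q n *\<^sub>R rank_one (f n) (e n) (\<phi> + \<psi>)) has_sum (sv_op q f e \<phi> + sv_op q f e \<psi>)) UNIV"
    using has_sum_add[OF has_sum[of \<phi>] has_sum[of \<psi>]]
    by (simp add: rank_one_def cinner_add_right scaleC_add_left scaleR_add_right)
  then show "sv_op q f e (\<phi> + \<psi>) = sv_op q f e \<phi> + sv_op q f e \<psi>" by (simp add: sv_op_def infsumI)
  have sc: "sv_op q f e (c *\<^sub>C \<phi>) = c *\<^sub>C sv_op q f e \<phi>" for c
  proof -
    have "((\<lambda>n. q n *\<^sub>R rank_one (f n) (e n) (c *\<^sub>C \<phi>)) has_sum (c *\<^sub>C sv_op q f e \<phi>)) UNIV"
      using has_sum_bounded_linear[OF scaleC.bounded_linear_right has_sum[of \<phi>], of c]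
      by (simp add: rank_one_def cinner_scaleC_right scaleC_scaleR)
    then show ?thesis by (simp add: sv_op_def infsumI)
  qed
  show "sv_op q f e (c *\<^sub>C \<phi>) = c *\<^sub>C sv_op q f e \<phi>" by (rule sc)
  show "sv_op q f e (r *\<^sub>R \<phi>) = r *\<^sub>R sv_op q f e \<phi>"
    using sc[of "complex_of_real r"] by (simp add: scaleC_of_real)
  show "norm (sv_op q f e \<phi>) \<le> norm \<phi> * C" using norm_le by (simp add: mult.commute)
qed

lemma cinner_has_sum:
  "((\<lambda>n. complex_of_real (q n) * (cinner (e n) \<phi> * cinner w (f n))) has_sum cinner w (sv_op q f e \<phi>)) UNIV"
  using has_sum_bounded_linear[OF cinner.bounded_linear_right has_sum[of \<phi>], of w]
  by (simp add: rank_one_def cinner_scaleR_right cinner_scaleC_right)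

lemma cinner_left: "cinner (f m) (sv_op q f e \<phi>) = complex_of_real (q m) * cinner (e m) \<phi>"
proof -
  have "((\<lambda>n. complex_of_real (q n) * (cinner (e n) \<phi> * cinner (f m) (f n))) has_sum complex_of_real (q m) * cinner (e m) \<phi>) UNIV"
    using f by (intro has_sum_finite_neutralI[of "{m}"]) (auto simp: orthonormal_seq_def)
  then show ?thesis using cinner_has_sum[of \<phi> "f m"] has_sum_unique by blast
qed

lemma apply_right: "sv_op q f e (e m) = q m *\<^sub>R f m"
proof -
  have "((\<lambda>n. q n *\<^sub>R rank_one (f n) (e n) (e m)) has_sum q m *\<^sub>R f m) UNIV"
    using e by (intro has_sum_finite_neutralI[of "{m}"]) (auto simp: orthonormal_seq_def rank_one_def)
  then show ?thesis using has_sum[of "e m"] has_sum_unique by blast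
qed

lemma adjoint: "cinner (sv_op q e f w) \<phi> = cinner w (sv_op q f e \<phi>)"
proof -
  interpret s: sv_system q e f C by (rule swap)
  have "((\<lambda>n. cnj (complex_of_real (q n) * (cinner (f n) w * cinner \<phi> (e n)))) has_sum cnj (cinner \<phi> (sv_op q e f w))) UNIV"
    using s.cinner_has_sum[of w \<phi>] by (subst has_sum_cnj_iff)
  then have "((\<lambda>n. complex_of_real (q n) * (cinner (e n) \<phi> * cinner w (f n))) has_sum cinner (sv_op q e f w) \<phi>) UNIV"
    by (simp add: mult.commute flip: cinner_commute)
  then show ?thesis using cinner_has_sum[of \<phi> w] has_sum_unique by blast
qed

lemma adjoint_L2: "adjoint_L2 (sv_op q f e) = sv_op q e f"
  unfolding adjoint_L2_def
proof (rule the_equality)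
  interpret s: sv_system q e f C by (rule swap)
  show "L2_operator (sv_op q e f) \<and> (\<forall>w \<phi>. cinner (sv_op q e f w) \<phi> = cinner w (sv_op q f e \<phi>))"
    using s.L2_operator adjoint by blast
  fix B assume B: "L2_operator B \<and> (\<forall>w \<phi>. cinner (B w) \<phi> = cinner w (sv_op q f e \<phi>))"
  show "B = sv_op q e f"
  proof (rule ext, rule cinner_ext)
    fix w \<phi>
    have "cinner (B w) \<phi> = cinner (sv_op q e f w) \<phi>" using B adjoint by simp
    then show "cinner \<phi> (B w) = cinner \<phi> (sv_op q e f w)" by (metis cinner_commute)
  qed
qed

lemma adjoint_comp: "adjoint_L2 (sv_op q f e) \<circ> sv_op q f e = sv_op (\<lambda>n. (q n)\<^sup>2) e e"
proof
  fix \<phi>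
  show "(adjoint_L2 (sv_op q f e) \<circ> sv_op q f e) \<phi> = sv_op (\<lambda>n. (q n)\<^sup>2) e e \<phi>"
    unfolding adjoint_L2 o_apply sv_op_def[of q e f] sv_op_def[of _ e e]
    by (intro infsum_cong)
      (simp add: rank_one_def cinner_left power2_eq_square mult.assoc flip: scaleC_of_real)
qed

lemma svd: "(\<And>n. 0 \<le> q n) \<Longrightarrow> svd (sv_op q f e) q f e"
  unfolding svd_def using f e has_sum by blast

end

lemma svd_has_sum: "svd A a u v \<Longrightarrow> ((\<lambda>n. a n *\<^sub>R rank_one (u n) (v n) \<phi>) has_sum A \<phi>) UNIV"
  by (simp add: svd_def)

lemma svd_eq_sv_op: "svd A a u v \<Longrightarrow> A = sv_op a u v"
  unfolding sv_op_def by (rule ext) (rule infsumI[OF svd_has_sum, symmetric])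

text \<open>Applying \<open>A\<close> to the unit vector \<open>v n\<close> gives
  \<open>a n *\<^sub>R u n\<close>, so each singular value is at most the operator norm.\<close>

lemma svd_sv_system:
  assumes "svd A a u v" "L2_operator A"
  obtains C where "sv_system a u v C"
proof -
  have bl: "bounded_linear A" using assms(2) by (simp add: L2_operator_def)
  have o: "orthonormal_on UNIV u" "orthonormal_on UNIV v" "\<And>n. 0 \<le> a n"
    using assms(1) by (auto simp: svd_def orthonormal_seq_iff)
  have "\<bar>a n\<bar> \<le> onorm A" for n
  proof -
    have "((\<lambda>m. a m *\<^sub>R rank_one (u m) (v m) (v n)) has_sum a n *\<^sub>R u n) UNIV"
      using o(2) by (intro has_sum_finite_neutralI[of "{n}"]) (auto simp: orthonormal_on_def rank_one_def)
    then have "A (v n) = a n *\<^sub>R u n"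
      by (rule has_sum_unique[OF svd_has_sum[OF assms(1)]])
    then show ?thesis
      using onorm[OF bl, of "v n"] o(3)[of n] orthonormal_on_norm[OF o(1), of n]
        orthonormal_on_norm[OF o(2), of n] by simp
  qed
  then have "sv_system a u v (onorm A)"
    using o by (simp add: sv_system_def orthonormal_seq_iff)
  then show ?thesis by (rule that)
qed

text \<open>Two spectral decompositions \<open>(l, e)\<close> and \<open>(l', e')\<close> of one operator satisfy
  \<open>(l n - l' m) * \<langle>e n|e' m\<rangle> = 0\<close>, so that powers do not depend on the decomposition.\<close>

lemma svd_powr_eigenvector:
  assumes P: "svd P l e e" "svd P l' e' e'" and Q: "svd Q (\<lambda>n. l n powr s) e e"
    and op: "L2_operator P" "L2_operator Q"
  shows "Q (e' m) = (l' m powr s) *\<^sub>R e' m"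
proof -
  note eqs = svd_eq_sv_op[OF P(1)] svd_eq_sv_op[OF P(2)] svd_eq_sv_op[OF Q]
  obtain C1 where "sv_system l e e C1" using svd_sv_system[OF P(1) op(1)] .
  then interpret P1: sv_system l e e C1 .
  obtain C2 where "sv_system l' e' e' C2" using svd_sv_system[OF P(2) op(1)] .
  then interpret P2: sv_system l' e' e' C2 .
  obtain C3 where "sv_system (\<lambda>n. l n powr s) e e C3" using svd_sv_system[OF Q op(2)] .
  then interpret Q: sv_system "\<lambda>n. l n powr s" e e C3 .
  have l: "l n = l' m \<or> cinner (e n) (e' m) = 0" for n
  proof -
    have "complex_of_real (l n) * cinner (e n) (e' m) = cinner (e n) (P (e' m))"
      unfolding eqs(1) by (simp add: P1.cinner_left)
    also have "\<dots> = complex_of_real (l' m) * cinner (e n) (e' m)"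
      unfolding eqs(2) by (simp add: P2.apply_right cinner_scaleR_right)
    finally show ?thesis by auto
  qed
  show ?thesis
  proof (cases "l' m = 0")
    case True
    \<comment> \<open>For the eigenvalue 0 every term vanishes: either its coefficient is
      \<open>0 powr s = 0\<close> or its inner product is 0.\<close>
    have "Q (e' m) = (\<Sum>\<^sub>\<infinity>n::nat. 0)"
      unfolding eqs(3) sv_op_def
    proof (intro infsum_cong)
      fix n show "(l n powr s) *\<^sub>R rank_one (e n) (e n) (e' m) = 0"
        using l[of n] True by (auto simp: rank_one_def)
    qed
    then show ?thesis using True by simp
  next
    case False
    \<comment> \<open>The factor \<open>l' m\<close> makes each term a multiple of the corresponding
      term in the series for \<open>P (e' m)\<close>; it is cancelled at the end.\<close>
    have "l' m *\<^sub>R Q (e' m) = (\<Sum>\<^sub>\<infinity>n. l' m *\<^sub>R (l n powr s) *\<^sub>R rank_one (e n) (e n) (e' m))"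
      unfolding eqs(3)
      by (rule infsumI[symmetric] has_sum_bounded_linear[OF bounded_linear_scaleR_right Q.has_sum])+
    also have "\<dots> = (\<Sum>\<^sub>\<infinity>n. (l' m powr s) *\<^sub>R l n *\<^sub>R rank_one (e n) (e n) (e' m))"
    proof (intro infsum_cong)
      fix n
      show "l' m *\<^sub>R (l n powr s) *\<^sub>R rank_one (e n) (e n) (e' m)
          = (l' m powr s) *\<^sub>R l n *\<^sub>R rank_one (e n) (e n) (e' m)"
        using l[of n] by (auto simp: rank_one_def mult.commute)
    qed
    also have "\<dots> = (l' m powr s) *\<^sub>R P (e' m)"
      unfolding eqs(1)
      by (rule infsumI has_sum_bounded_linear[OF bounded_linear_scaleR_right P1.has_sum])+
    also have "P (e' m) = l' m *\<^sub>R e' m" unfolding eqs(2) by (rule P2.apply_right)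
    finally have "l' m *\<^sub>R Q (e' m) = l' m *\<^sub>R (l' m powr s) *\<^sub>R e' m" by (simp add: mult.commute)
    then show ?thesis using False by (simp only: scaleR_cancel_left simp_thms)
  qed
qed

text \<open>The operators agree on both orthonormal systems, so by self-adjointness the difference
  \<open>D\<close> of their values at \<phi> is orthogonal to both. But these values are series in
  the two systems, so \<open>D\<close> is orthogonal to itself. Neither system has to be complete,
  so agreement on the systems would not be enough.\<close>

lemma svd_powr_unique:
  assumes P: "svd P l e e" "svd P l' e' e'" and Q: "svd Q (\<lambda>n. l n powr s) e e" "svd Q' (\<lambda>n. l' n powr s) e' e'"
    and op: "L2_operator P" "L2_operator Q" "L2_operator Q'"
  shows "Q = Q'"
proof
  fix \<phi>
  note eqs = svd_eq_sv_op[OF Q(1)] svd_eq_sv_op[OF Q(2)]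
  obtain C3 where "sv_system (\<lambda>n. l n powr s) e e C3" using svd_sv_system[OF Q(1) op(2)] .
  then interpret Q1: sv_system "\<lambda>n. l n powr s" e e C3 .
  obtain C4 where "sv_system (\<lambda>n. l' n powr s) e' e' C4" using svd_sv_system[OF Q(2) op(3)] .
  then interpret Q2: sv_system "\<lambda>n. l' n powr s" e' e' C4 .
  define D where "D = Q \<phi> - Q' \<phi>"
  have "Q (e' m) = Q' (e' m)" for m
    unfolding svd_powr_eigenvector[OF P Q(1) op(1,2)] eqs(2) Q2.apply_right ..
  then have "cinner (e' m) D = 0" for m
    unfolding D_def cinner_diff_right eqs Q1.adjoint[symmetric] Q2.adjoint[symmetric] by simp
  moreover have "Q (e n) = Q' (e n)" for n
    unfolding svd_powr_eigenvector[OF P(2,1) Q(2) op(1,3)] eqs(1) Q1.apply_right ..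
  then have "cinner (e n) D = 0" for n
    unfolding D_def cinner_diff_right eqs Q1.adjoint[symmetric] Q2.adjoint[symmetric] by simp
  ultimately have "cinner D (e' m) = 0" "cinner D (e n) = 0" for m n
    by (subst cinner_commute, simp)+
  then have "cinner D (Q \<phi>) = 0" "cinner D (Q' \<phi>) = 0"
    using Q1.cinner_has_sum[of \<phi> D] Q2.cinner_has_sum[of \<phi> D]
    by (auto simp: eqs[symmetric] dest!: infsumI)
  then have "cinner D D = 0" by (simp add: D_def cinner_diff_right)
  then have "D = 0" by (simp add: cinner_self)
  then show "Q \<phi> = Q' \<phi>" by (simp add: D_def)
qed

section \<open>Schatten classes and compactness in terms of singular values\<close>

lemma ennreal_infsum_finite_iff:
  fixes f :: "'a \<Rightarrow> real"
  assumes f: "\<And>x. x \<in> A \<Longrightarrow> 0 \<le> f x"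
  shows "(\<Sum>\<^sub>\<infinity>x\<in>A. ennreal (f x)) < \<infinity> \<longleftrightarrow> f summable_on A"
proof -
  have sum: "(\<Sum>x\<in>F. ennreal (f x)) = ennreal (sum f F)" if "F \<subseteq> A" for F
    using f that by (intro sum_ennreal) auto
  have "(\<Sum>\<^sub>\<infinity>x\<in>A. ennreal (f x)) = (SUP F\<in>{F. finite F \<and> F \<subseteq> A}. \<Sum>x\<in>F. ennreal (f x))"
    by (rule nonneg_infsum_complete) simp
  also have "\<dots> = (SUP F\<in>{F. finite F \<and> F \<subseteq> A}. ennreal (sum f F))"
    by (intro SUP_cong) (auto simp: sum)
  finally have SUP: "(\<Sum>\<^sub>\<infinity>x\<in>A. ennreal (f x)) = (SUP F\<in>{F. finite F \<and> F \<subseteq> A}. ennreal (sum f F))" .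
  show ?thesis
  proof
    assume "(\<Sum>\<^sub>\<infinity>x\<in>A. ennreal (f x)) < \<infinity>"
    then obtain C where C: "(\<Sum>\<^sub>\<infinity>x\<in>A. ennreal (f x)) = ennreal C" "C \<ge> 0"
      by (cases "\<Sum>\<^sub>\<infinity>x\<in>A. ennreal (f x)") auto
    have "sum f F \<le> C" if "F \<subseteq> A" "finite F" for F
    proof -
      have "ennreal (sum f F) \<le> ennreal C"
        unfolding C(1)[symmetric] SUP using that by (intro SUP_upper) auto
      then show ?thesis using C(2) by (simp add: ennreal_le_iff)
    qed
    then show "f summable_on A"
      using f by (intro nonneg_bdd_above_summable_on bdd_aboveI2[where M = C]) auto
  next
    assume "f summable_on A"
    then have "(\<Sum>\<^sub>\<infinity>x\<in>A. ennreal (f x)) = ennreal (infsum f A)"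
      unfolding SUP using f by (intro infsum_nonneg_is_SUPREMUM_ennreal[symmetric]) auto
    then show "(\<Sum>\<^sub>\<infinity>x\<in>A. ennreal (f x)) < \<infinity>" by simp
  qed
qed

lemma has_sum_finite_sum:
  fixes f :: "'i \<Rightarrow> 'a \<Rightarrow> 'b::topological_comm_monoid_add"
  assumes "\<And>i. i \<in> F \<Longrightarrow> (f i has_sum s i) A"
  shows "((\<lambda>x. \<Sum>i\<in>F. f i x) has_sum (\<Sum>i\<in>F. s i)) A"
  using assms by (induction F rule: infinite_finite_induct) (auto intro!: has_sum_add)

text \<open>The double series of \<open>q n * (cmod (cinner b (e n)))\<^sup>2\<close> is summed in
  both orders, with one index kept in a finite set: a full sum over the basis is evaluated by
  Parseval's identity, a finite part of it is bounded by Bessel's inequality.\<close>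

lemma (in sv_system) trace_pos_finite_iff:
  assumes q0: "\<And>n. 0 \<le> q n"
  shows "trace_pos (sv_op q e e) < \<infinity> \<longleftrightarrow> q summable_on UNIV"
proof -
  interpret s: sv_system q e e C by standard (fact e q)+
  define B where "B = (SOME B :: 'd L2 set. orthonormal_basis B)"
  have B: "orthonormal_basis B"
    unfolding B_def by (rule someI_ex[OF orthonormal_basis_exists])
  have oB: "orthonormal_on B (\<lambda>b. b)" using B by (simp add: orthonormal_basis_def orthonormal_on_def)
  have ne: "norm (e n) = 1" for n using e by (intro orthonormal_on_norm[of UNIV]) (auto simp: orthonormal_seq_iff)
  define r where "r b = Re (cinner b (sv_op q e e b))" for b
  have hs: "((\<lambda>n. q n * (cmod (cinner b (e n)))\<^sup>2) has_sum r b) UNIV" for b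
  proof -
    have "cinner (e n) b * cinner b (e n) = complex_of_real ((cmod (cinner b (e n)))\<^sup>2)" for n
      unfolding complex_norm_square using cinner_commute[of b "e n"] by (simp add: mult.commute)
    then have "((\<lambda>n. complex_of_real (q n * (cmod (cinner b (e n)))\<^sup>2)) has_sum cinner b (sv_op q e e b)) UNIV"
      using s.cinner_has_sum[of b b] by simp
    from has_sum_bounded_linear[OF bounded_linear_Re this] show ?thesis
      unfolding r_def by (simp only: Re_complex_of_real)
  qed
  have r0: "0 \<le> r b" for b
    using hs[of b] q0 by (intro has_sum_nonneg[OF hs[of b]]) simp
  have "trace_pos (sv_op q e e) < \<infinity> \<longleftrightarrow> r summable_on B"
    unfolding trace_pos_def B_def[symmetric] r_def[symmetric]
    by (rule ennreal_infsum_finite_iff) (rule r0)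
  also have "\<dots> \<longleftrightarrow> q summable_on UNIV"
  proof
    assume r: "r summable_on B"
    have "sum q N \<le> infsum r B" if N: "finite N" for N
    proof (rule has_sum_mono)
      have "((\<lambda>b. \<Sum>n\<in>N. q n * (cmod (cinner b (e n)))\<^sup>2) has_sum (\<Sum>n\<in>N. q n * (norm (e n))\<^sup>2)) B"
        by (intro has_sum_finite_sum has_sum_cmult_right Parseval B)
      then show "((\<lambda>b. \<Sum>n\<in>N. q n * (cmod (cinner b (e n)))\<^sup>2) has_sum sum q N) B"
        by (simp add: ne)
      show "(r has_sum infsum r B) B" using r by simp
      show "(\<Sum>n\<in>N. q n * (cmod (cinner b (e n)))\<^sup>2) \<le> r b" for b
        using N q0 by (intro finite_sum_le_has_sum[OF hs[of b]]) auto
    qed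
    then show "q summable_on UNIV"
      using q0 by (intro nonneg_bdd_above_summable_on bdd_aboveI2[where M = "infsum r B"]) auto
  next
    assume q: "q summable_on UNIV"
    have "sum r F \<le> infsum q UNIV" if F: "finite F" "F \<subseteq> B" for F
    proof (rule has_sum_mono)
      show "((\<lambda>n. \<Sum>b\<in>F. q n * (cmod (cinner b (e n)))\<^sup>2) has_sum sum r F) UNIV"
        by (intro has_sum_finite_sum hs)
      show "(q has_sum infsum q UNIV) UNIV" using q by simp
      show "(\<Sum>b\<in>F. q n * (cmod (cinner b (e n)))\<^sup>2) \<le> q n" for n
      proof -
        have "(\<Sum>b\<in>F. (cmod (cinner b (e n)))\<^sup>2) \<le> 1"
          using Bessel_finite[OF orthonormal_on_subset[OF oB F(2)] F(1), of "e n"] by (simp add: ne)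
        then have "q n * (\<Sum>b\<in>F. (cmod (cinner b (e n)))\<^sup>2) \<le> q n * 1"
          using q0 by (intro mult_left_mono)
        then show ?thesis by (simp add: sum_distrib_left)
      qed
    qed
    then show "r summable_on B"
      using r0 by (intro nonneg_bdd_above_summable_on bdd_aboveI2[where M = "infsum q UNIV"]) auto
  qed
  finally show ?thesis .
qed

lemma sv_system_powr:
  assumes "sv_system l f e C" "\<And>n. 0 \<le> l n" "s > 0"
  shows "sv_system (\<lambda>n. l n powr s) e e (C powr s)"
proof -
  interpret sv_system l f e C by fact
  have "\<bar>l n powr s\<bar> \<le> C powr s" for n
    using q[of n] assms(2)[of n] assms(3) by (simp add: powr_mono2)
  then show ?thesis by (intro sv_system.intro e)
qed

text \<open>Uniqueness of powers across spectral decompositions validates the definite description,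
  so the given decomposition may be used to compute it.\<close>

lemma op_powr_svd:
  assumes P: "svd P l e e" "L2_operator P" and s: "s > 0"
  shows "op_powr P s = sv_op (\<lambda>n. l n powr s) e e"
proof -
  have pow: "svd (sv_op (\<lambda>n. l n powr s) e e) (\<lambda>n. l n powr s) e e" "L2_operator (sv_op (\<lambda>n. l n powr s) e e)"
    if lP: "svd P l e e" for l e
  proof -
    obtain C where "sv_system l e e C" using svd_sv_system[OF lP P(2)] .
    then interpret sv_system "\<lambda>n. l n powr s" e e "C powr s"
      by (rule sv_system_powr) (use lP s in \<open>auto simp: svd_def\<close>)
    show "svd (sv_op (\<lambda>n. l n powr s) e e) (\<lambda>n. l n powr s) e e" by (rule svd) simp
    show "L2_operator (sv_op (\<lambda>n. l n powr s) e e)" by (rule L2_operator)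
  qed
  show ?thesis unfolding op_powr_def
  proof (rule the_equality)
    show "\<exists>l' e'. svd P l' e' e' \<and> svd (sv_op (\<lambda>n. l n powr s) e e) (\<lambda>n. l' n powr s) e' e'"
      using P(1) pow(1)[OF P(1)] by blast
    fix Q assume "\<exists>l' e'. svd P l' e' e' \<and> svd Q (\<lambda>n. l' n powr s) e' e'"
    then obtain l' e' where Q: "svd P l' e' e'" "svd Q (\<lambda>n. l' n powr s) e' e'" by blast
    have "L2_operator Q" using pow(2)[OF Q(1)] svd_eq_sv_op[OF Q(2)] by simp
    then show "Q = sv_op (\<lambda>n. l n powr s) e e"
      using svd_powr_unique[OF Q(1) P(1) Q(2) pow(1)[OF P(1)] P(2)] pow(2)[OF P(1)] by blast
  qed
qed

text \<open>The adjoint times \<open>A\<close> has the squared weights on the right singular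
  vectors, and the square root undoes the squaring because the weights are nonnegative.\<close>

lemma op_abs_svd:
  assumes A: "svd A a u v" "L2_operator A"
  shows "op_abs A = sv_op a v v"
proof -
  obtain C where C: "sv_system a u v C" using svd_sv_system[OF A] .
  then interpret sv_system a u v C .
  have a0: "0 \<le> a n" for n using A(1) by (simp add: svd_def)
  interpret sq: sv_system "\<lambda>n. (a n)\<^sup>2" v v "C\<^sup>2"
    by standard (use e order.trans[OF q abs_ge_self] in \<open>auto simp: abs_le_square_iff[symmetric]\<close>)
  have "op_abs A = op_powr (sv_op (\<lambda>n. (a n)\<^sup>2) v v) (1 / 2)"
    unfolding op_abs_def svd_eq_sv_op[OF A(1)] adjoint_comp ..
  also have "\<dots> = sv_op (\<lambda>n. (a n)\<^sup>2 powr (1 / 2)) v v"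
    by (intro op_powr_svd sq.svd sq.L2_operator) auto
  also have "(\<lambda>n. (a n)\<^sup>2 powr (1 / 2)) = a"
    using a0 by (simp add: powr_half_sqrt)
  finally show ?thesis .
qed

text \<open>Both \<open>op_abs\<close> and \<open>op_powr\<close> act on the weights alone, so the
  trace is that of a diagonal operator with weights \<open>a n powr s\<close>. This is the bridge
  from operators to series.\<close>

lemma schatten_svd_iff:
  assumes A: "svd A a u v" "compact_operator A" and s: "s > 0"
  shows "A \<in> schatten s \<longleftrightarrow> (\<lambda>n. a n powr s) summable_on UNIV"
proof -
  have op: "L2_operator A" using A(2) by (simp add: compact_operator_def)
  have a0: "0 \<le> a n" for n using A(1) by (simp add: svd_def)
  obtain C where C: "sv_system a u v C" using svd_sv_system[OF A(1) op] .
  then interpret sv_system a u v C .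
  interpret v: sv_system a v v C by standard (fact e q)+
  interpret p: sv_system "\<lambda>n. a n powr s" v v "C powr s"
    by (rule sv_system_powr[OF C a0 s])
  have "op_powr (op_abs A) s = sv_op (\<lambda>n. a n powr s) v v"
    unfolding op_abs_svd[OF A(1) op] by (intro op_powr_svd v.svd v.L2_operator a0 s)
  then show ?thesis
    using p.trace_pos_finite_iff A(2) by (simp add: schatten_def)
qed

section \<open>Compactness from weights tending to 0\<close>

lemma sv_op_split:
  assumes "sv_system q f e C"
  shows "sv_op q f e \<phi> = (\<Sum>n<N. q n *\<^sub>R rank_one (f n) (e n) \<phi>) + sv_op (\<lambda>n. if n < N then 0 else q n) f e \<phi>"
proof -
  interpret sv_system q f e C by fact
  interpret r: sv_system "\<lambda>n. if n < N then 0 else q n" f e C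
    by standard (use f e q order.trans[OF abs_ge_zero q] in auto)
  have "((\<lambda>n. if n < N then q n *\<^sub>R rank_one (f n) (e n) \<phi> else 0) has_sum (\<Sum>n<N. q n *\<^sub>R rank_one (f n) (e n) \<phi>)) UNIV"
    by (intro has_sum_finite_neutralI[of "{..<N}"]) auto
  from has_sum_add[OF this r.has_sum[of \<phi>]]
  have "((\<lambda>n. q n *\<^sub>R rank_one (f n) (e n) \<phi>) has_sum
      ((\<Sum>n<N. q n *\<^sub>R rank_one (f n) (e n) \<phi>) + sv_op (\<lambda>n. if n < N then 0 else q n) f e \<phi>)) UNIV"
    by (rule has_sum_cong[THEN iffD1, rotated]) simp
  then show ?thesis by (simp add: sv_op_def infsumI)
qed

text \<open>The first \<open>N\<close> terms map the unit ball into a compact set and the remainder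
  is uniformly small, so the image is totally bounded. \<open>schatten\<close> demands compactness
  besides a finite trace.\<close>

lemma compact_operator_sv_op:
  fixes f e :: "nat \<Rightarrow> 'd::finite L2"
  assumes sys: "sv_system q f e C" and lim: "q \<longlonglongrightarrow> 0"
  shows "compact_operator (sv_op q f e)"
proof -
  interpret sv_system q f e C by fact
  let ?A = "sv_op q f e"
  let ?F = "\<lambda>N \<phi>. \<Sum>n<N. q n *\<^sub>R rank_one (f n) (e n) \<phi>"
  have K: "\<exists>K. compact K \<and> (\<forall>\<phi>\<in>cball 0 1. ?F N \<phi> \<in> K)" for N
  proof (induction N)
    case 0
    show ?case by (intro exI[of _ "{0}"]) simp
  next
    case (Suc N)
    then obtain K where K: "compact K" "\<forall>\<phi>\<in>cball 0 1. ?F N \<phi> \<in> K" by (elim exE conjE)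
    \<comment> \<open>The coefficient of \<open>f N\<close> ranges over a disc of radius
      \<open>C\<close>, so one more term only adds a compact set.\<close>
    let ?L = "(\<lambda>z. z *\<^sub>C f N) ` cball 0 C"
    have L: "compact ?L"
      by (intro compact_continuous_image linear_continuous_on scaleC.bounded_linear_left compact_cball)
    have "?F (Suc N) \<phi> \<in> {x + y |x y. x \<in> K \<and> y \<in> ?L}" if \<phi>: "\<phi> \<in> cball 0 1" for \<phi>
    proof -
      have "cmod (cinner (e N) \<phi>) \<le> 1"
        using cmod_cinner_le[of "e N" \<phi>] \<phi> e orthonormal_on_norm[of UNIV e N] by (simp add: orthonormal_seq_iff)
      then have "\<bar>q N\<bar> * cmod (cinner (e N) \<phi>) \<le> C * 1"
        using q[of N] by (intro mult_mono) auto
      then have "complex_of_real (q N) * cinner (e N) \<phi> \<in> cball 0 C" by (simp add: norm_mult)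
      moreover have "q N *\<^sub>R rank_one (f N) (e N) \<phi> = (complex_of_real (q N) * cinner (e N) \<phi>) *\<^sub>C f N"
        by (simp add: rank_one_def flip: scaleC_of_real)
      ultimately have "q N *\<^sub>R rank_one (f N) (e N) \<phi> \<in> ?L" by blast
      moreover have "?F N \<phi> \<in> K" using K(2) \<phi> by blast
      ultimately show ?thesis unfolding sum.lessThan_Suc by blast
    qed
    then show ?case by (intro exI[of _ "{x + y |x y. x \<in> K \<and> y \<in> ?L}"] conjI compact_sums K(1) L ballI)
  qed
  have "\<exists>k. finite k \<and> closure (?A ` cball 0 1) \<subseteq> (\<Union>x\<in>k. ball x \<epsilon>)" if \<epsilon>: "\<epsilon> > 0" for \<epsilon>
  proof -
    \<comment> \<open>A quarter for the covering and a quarter for the remainder give closed balls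
      of radius \<epsilon> / 2, which also contain the closure and lie in the open balls of radius
      \<epsilon>.\<close>
    have "\<exists>N. \<forall>n\<ge>N. \<bar>q n\<bar> < \<epsilon> / 4"
      using LIMSEQ_D[OF lim, of "\<epsilon> / 4"] \<epsilon> by simp
    then obtain N where N: "\<forall>n\<ge>N. \<bar>q n\<bar> < \<epsilon> / 4" ..
    have "\<bar>if n < N then 0 else q n\<bar> \<le> \<epsilon> / 4" for n
      using N[rule_format, of n] \<epsilon> by (cases "n < N") auto
    then interpret r: sv_system "\<lambda>n. if n < N then 0 else q n" f e "\<epsilon> / 4"
      by (intro sv_system.intro f e)
    obtain K where K: "compact K" "\<forall>\<phi>\<in>cball 0 1. ?F N \<phi> \<in> K" using K[of N] by (elim exE conjE)
    have "\<epsilon> / 4 > 0" using \<epsilon> by simp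
    then have "\<exists>k. finite k \<and> K \<subseteq> (\<Union>x\<in>k. ball x (\<epsilon> / 4))"
      using K(1) unfolding compact_eq_totally_bounded by blast
    then obtain k where k: "finite k" "K \<subseteq> (\<Union>x\<in>k. ball x (\<epsilon> / 4))" by (elim exE conjE)
    have "?A ` cball 0 1 \<subseteq> (\<Union>x\<in>k. cball x (\<epsilon> / 2))"
    proof (intro image_subsetI)
      fix \<phi> :: "'d L2" assume \<phi>: "\<phi> \<in> cball 0 1"
      then have "?F N \<phi> \<in> (\<Union>x\<in>k. ball x (\<epsilon> / 4))" using K(2) k(2) by blast
      then obtain x where x: "x \<in> k" "dist x (?F N \<phi>) < \<epsilon> / 4" by (auto simp only: UN_iff mem_ball)
      have "dist (?F N \<phi>) (?A \<phi>) \<le> \<epsilon> / 4 * norm \<phi>"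
        using r.norm_le[of \<phi>] unfolding sv_op_split[OF sys, of \<phi> N] by (simp add: dist_norm)
      also have "\<dots> \<le> \<epsilon> / 4 * 1" using \<phi> \<epsilon> by (intro mult_left_mono) auto
      finally have "dist x (?A \<phi>) \<le> \<epsilon> / 2"
        using dist_triangle[of x "?A \<phi>" "?F N \<phi>"] x(2) by linarith
      then show "?A \<phi> \<in> (\<Union>x\<in>k. cball x (\<epsilon> / 2))" using x(1) by auto
    qed
    then have "closure (?A ` cball 0 1) \<subseteq> (\<Union>x\<in>k. cball x (\<epsilon> / 2))"
      using k(1) by (intro closure_minimal closed_UN) auto
    also have "\<dots> \<subseteq> (\<Union>x\<in>k. ball x \<epsilon>)" using \<epsilon> by (intro UN_mono) auto
    finally show ?thesis using k(1) by blast
  qed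
  then have "compact (closure (?A ` cball 0 1))"
    unfolding compact_eq_totally_bounded complete_eq_closed by simp
  then show ?thesis using L2_operator by (simp add: compact_operator_def)
qed

section \<open>Random weights on series\<close>

lemma summable_on_nonneg_iff_suminf:
  fixes f :: "nat \<Rightarrow> real"
  assumes "\<And>n. 0 \<le> f n"
  shows "f summable_on UNIV \<longleftrightarrow> (\<Sum>n. ennreal (f n)) < \<infinity>"
proof -
  have "f summable_on UNIV \<longleftrightarrow> summable f"
    using assms by (auto intro: summable_nonneg_imp_summable_on summable_on_imp_summable)
  also have "\<dots> \<longleftrightarrow> (\<Sum>n. ennreal (f n)) < \<infinity>"
  proof
    assume "summable f"
    then show "(\<Sum>n. ennreal (f n)) < \<infinity>" using assms by (simp add: suminf_ennreal2)
  next
    assume "(\<Sum>n. ennreal (f n)) < \<infinity>"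
    then show "summable f" using assms by (intro summable_suminf_not_top) (auto simp: less_top)
  qed
  finally show ?thesis .
qed

text \<open>For large arguments \<open>p\<close> is rounded up to an integer \<open>n\<close>, and
  \<open>\<bar>x\<bar> ^ n / fact n\<close> is one term of the exponential series; for small ones
  the left side is at most 1. The sum over both signs removes the absolute value from the exponent,
  as exponential moments require.\<close>

lemma powr_le_fact_mult_exp_add_exp:
  fixes x p :: real
  assumes p: "0 \<le> p"
  shows "\<bar>x\<bar> powr p \<le> fact (nat \<lceil>p\<rceil>) * (exp x + exp (- x))"
proof -
  define n where "n = nat \<lceil>p\<rceil>"
  have n: "p \<le> real n" unfolding n_def using p by linarith
  have e: "exp \<bar>x\<bar> \<le> exp x + exp (- x)" by (cases "x \<ge> 0") auto
  have f1: "(1::real) \<le> fact n" by (rule fact_ge_1)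
  show ?thesis unfolding n_def[symmetric]
  proof (cases "\<bar>x\<bar> \<le> 1")
    case True
    have "\<bar>x\<bar> powr p \<le> 1 powr p" using True p by (intro powr_mono2) auto
    also have "\<dots> \<le> fact n * exp \<bar>x\<bar>"
      using mult_mono[OF f1, of 1 "exp \<bar>x\<bar>"] by simp
    also have "\<dots> \<le> fact n * (exp x + exp (- x))" using e by (intro mult_left_mono) auto
    finally show "\<bar>x\<bar> powr p \<le> fact n * (exp x + exp (- x))" .
  next
    case False
    have "\<bar>x\<bar> powr p \<le> \<bar>x\<bar> powr real n" using False n by (intro powr_mono) auto
    also have "\<dots> = \<bar>x\<bar> ^ n" using False by (simp add: powr_realpow)
    also have "\<dots> \<le> fact n * exp \<bar>x\<bar>"
    proof -
      have "\<bar>x\<bar> ^ n /\<^sub>R fact n \<le> exp \<bar>x\<bar>"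
        using sum_le_suminf[OF summable_exp_generic[of "\<bar>x\<bar>"], of "{n}"]
        unfolding exp_def by simp
      then show ?thesis by (simp add: field_simps)
    qed
    also have "\<dots> \<le> fact n * (exp x + exp (- x))" using e by (intro mult_left_mono) auto
    finally show "\<bar>x\<bar> powr p \<le> fact n * (exp x + exp (- x))" .
  qed
qed

text \<open>The exponential moments at \<zeta> = 1 and \<zeta> = -1 dominate the moment of order
  \<open>p\<close>. The bound depends on \<open>p\<close> and \<open>C\<close> alone, hence is
  uniform along a sequence of variables.\<close>

lemma (in prob_space) subgaussian_moment_le:
  fixes X :: "'a \<Rightarrow> real"
  assumes X[measurable]: "random_variable borel X" and p: "0 \<le> p"
    and sub: "\<And>\<zeta>. (\<integral>\<^sup>+x. ennreal (exp (\<zeta> * x)) \<partial>distr M borel X) \<le> ennreal (exp (C * \<zeta>\<^sup>2))"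
  shows "(\<integral>\<^sup>+\<omega>. ennreal (\<bar>X \<omega>\<bar> powr p) \<partial>M) \<le> ennreal (fact (nat \<lceil>p\<rceil>) * (2 * exp C))"
proof -
  have m: "(\<integral>\<^sup>+\<omega>. ennreal (exp (\<zeta> * X \<omega>)) \<partial>M) \<le> ennreal (exp (C * \<zeta>\<^sup>2))" for \<zeta>
    using sub[of \<zeta>] by (simp add: nn_integral_distr)
  let ?F = "fact (nat \<lceil>p\<rceil>) :: real"
  have "(\<integral>\<^sup>+\<omega>. ennreal (\<bar>X \<omega>\<bar> powr p) \<partial>M)
      \<le> (\<integral>\<^sup>+\<omega>. ennreal ?F * (ennreal (exp (1 * X \<omega>)) + ennreal (exp (-1 * X \<omega>))) \<partial>M)"
  proof (intro nn_integral_mono)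
    fix \<omega>
    show "ennreal (\<bar>X \<omega>\<bar> powr p) \<le> ennreal ?F * (ennreal (exp (1 * X \<omega>)) + ennreal (exp (-1 * X \<omega>)))"
      using ennreal_leI[OF powr_le_fact_mult_exp_add_exp[OF p, of "X \<omega>"]]
      by (simp add: ennreal_mult ennreal_plus)
  qed
  also have "\<dots> = ennreal ?F * ((\<integral>\<^sup>+\<omega>. ennreal (exp (1 * X \<omega>)) \<partial>M) + (\<integral>\<^sup>+\<omega>. ennreal (exp (-1 * X \<omega>)) \<partial>M))"
    by (simp add: nn_integral_cmult nn_integral_add)
  also have "\<dots> \<le> ennreal ?F * (ennreal (exp (C * 1\<^sup>2)) + ennreal (exp (C * (-1)\<^sup>2)))"
    by (intro mult_left_mono add_mono m) simp
  also have "\<dots> = ennreal (?F * (2 * exp C))"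
    by (simp add: ennreal_mult ennreal_plus[symmetric] del: ennreal_plus)
  finally show ?thesis .
qed

text \<open>By Tonelli's theorem and the uniform moment bound the whole series has finite
  expectation, so it is finite almost surely.\<close>

lemma (in prob_space) AE_summable_subgaussian_weights:
  fixes g :: "nat \<Rightarrow> 'a \<Rightarrow> real"
  assumes g: "\<And>n. random_variable borel (g n)" and p: "0 \<le> p" and a: "\<And>n. 0 \<le> a n"
    and sub: "\<And>n \<zeta>. (\<integral>\<^sup>+x. ennreal (exp (\<zeta> * x)) \<partial>distr M borel (g n)) \<le> ennreal (exp (C * \<zeta>\<^sup>2))"
    and sum: "(\<lambda>n. a n powr p) summable_on UNIV"
  shows "AE \<omega> in M. (\<lambda>n. (a n * \<bar>g n \<omega>\<bar>) powr p) summable_on UNIV"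
proof -
  note [measurable] = g
  let ?K = "fact (nat \<lceil>p\<rceil>) * (2 * exp C)"
  have "(\<integral>\<^sup>+\<omega>. (\<Sum>n. ennreal ((a n * \<bar>g n \<omega>\<bar>) powr p)) \<partial>M)
      = (\<Sum>n. \<integral>\<^sup>+\<omega>. ennreal ((a n * \<bar>g n \<omega>\<bar>) powr p) \<partial>M)"
    by (intro nn_integral_suminf) measurable
  also have "\<dots> = (\<Sum>n. ennreal (a n powr p) * (\<integral>\<^sup>+\<omega>. ennreal (\<bar>g n \<omega>\<bar> powr p) \<partial>M))"
    using a by (intro suminf_cong) (simp add: powr_mult ennreal_mult nn_integral_cmult)
  also have "\<dots> \<le> (\<Sum>n. ennreal (a n powr p) * ennreal ?K)"
    by (intro suminf_le mult_left_mono subgaussian_moment_le g p sub summableI) simp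
  also have "\<dots> = (\<Sum>n. ennreal (a n powr p)) * ennreal ?K" by (rule ennreal_suminf_multc)
  also have "\<dots> < \<infinity>"
    using sum summable_on_nonneg_iff_suminf[of "\<lambda>n. a n powr p"] by (simp add: ennreal_mult_less_top)
  finally have "AE \<omega> in M. (\<Sum>n. ennreal ((a n * \<bar>g n \<omega>\<bar>) powr p)) \<noteq> \<infinity>"
    by (intro nn_integral_noteq_infinite) auto
  then show ?thesis
    by eventually_elim (simp add: summable_on_nonneg_iff_suminf less_top)
qed

text \<open>With \<open>E n = {c < \<bar>g n\<bar>}\<close> and \<open>\<P>(E n) \<ge> \<delta>\<close>, independence gives
  \<open>\<E> exp (- \<Sum>n<N. b n * 1\<^bsub>E n\<^esub>) \<le> exp (- \<delta> * \<Sum>n<N. (1 - exp (- b n)))\<close>, which tends to \<open>0\<close> if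
  the bounded weights \<open>b\<close> are not summable.\<close>

lemma (in prob_space) AE_not_summable_indep_weights:
  fixes g :: "nat \<Rightarrow> 'a \<Rightarrow> real" and b :: "nat \<Rightarrow> real"
  assumes indep: "indep_vars (\<lambda>_. borel) g UNIV"
    and delta: "\<delta> > 0" "\<And>n. b n \<noteq> 0 \<Longrightarrow> prob {\<omega> \<in> space M. \<bar>g n \<omega>\<bar> \<le> c} \<le> 1 - \<delta>"
    and b: "\<And>n. 0 \<le> b n" "\<And>n. b n \<le> B" and not: "\<not> b summable_on UNIV"
  shows "AE \<omega> in M. \<not> (\<lambda>n. b n * of_bool (c < \<bar>g n \<omega>\<bar>)) summable_on UNIV"
proof -
  have g[measurable]: "random_variable borel (g n)" for n
    using indep by (auto simp: indep_vars_def)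
  define w where "w n x = exp (- (b n * of_bool (c < \<bar>x\<bar>)))" for n and x :: real
  have [measurable]: "w n \<in> borel_measurable borel" for n unfolding w_def by measurable
  have w: "0 \<le> w n x" "w n x \<le> 1" for n x using b(1)[of n] by (auto simp: w_def)
  define Z where "Z N \<omega> = (\<Prod>n<N. w n (g n \<omega>))" for N \<omega>
  have Z_exp: "Z N \<omega> = exp (- (\<Sum>n<N. b n * of_bool (c < \<bar>g n \<omega>\<bar>)))" for N \<omega>
    unfolding Z_def w_def sum_negf[symmetric] by (rule exp_sum[symmetric]) simp
  have int: "integrable M (\<lambda>\<omega>. w n (g n \<omega>))" for n
    by (rule integrable_const_bound[where B = 1]) (use w in auto)
  \<comment> \<open>The factor is \<open>exp (- b n)\<close> where
    \<open>c < \<bar>g n \<omega>\<bar>\<close> and 1 elsewhere; \<open>1 + x \<le> exp x\<close>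
    then gives bounds that multiply to the exponential of a sum. Where \<open>b n = 0\<close> the
    factor is constantly 1.\<close>
  have Ew: "expectation (\<lambda>\<omega>. w n (g n \<omega>)) \<le> exp (- (\<delta> * (1 - exp (- b n))))" for n
  proof -
    let ?p = "prob {\<omega> \<in> space M. \<bar>g n \<omega>\<bar> \<le> c}"
    have "expectation (\<lambda>\<omega>. w n (g n \<omega>))
        = expectation (\<lambda>\<omega>. exp (- b n) + (1 - exp (- b n)) * indicator {\<omega> \<in> space M. \<bar>g n \<omega>\<bar> \<le> c} \<omega>)"
      by (intro Bochner_Integration.integral_cong) (auto simp: w_def indicator_def)
    also have "\<dots> = exp (- b n) + (1 - exp (- b n)) * ?p"
      by (subst Bochner_Integration.integral_add) (auto simp: prob_space emeasure_eq_measure)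
    also have "\<dots> \<le> exp (- b n) + (1 - exp (- b n)) * (1 - \<delta>)"
      using delta(2)[of n] b(1)[of n] by (cases "b n = 0") (auto intro: mult_left_mono)
    also have "\<dots> = 1 + - (\<delta> * (1 - exp (- b n)))" by (simp add: algebra_simps)
    also have "\<dots> \<le> exp (- (\<delta> * (1 - exp (- b n))))" by (rule exp_ge_add_one_self)
    finally show ?thesis .
  qed
  have indep_w: "indep_vars (\<lambda>_. borel) (\<lambda>n \<omega>. w n (g n \<omega>)) {..<N}" for N
    using indep_vars_compose2[OF indep_vars_subset[OF indep], of "{..<N}" w "\<lambda>_. borel"] by simp
  have EZ: "expectation (Z N) \<le> exp (- (\<delta> * (\<Sum>n<N. 1 - exp (- b n))))" for N
  proof -
    have "expectation (Z N) = (\<Prod>n<N. expectation (\<lambda>\<omega>. w n (g n \<omega>)))"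
      unfolding Z_def by (intro indep_vars_lebesgue_integral indep_w int) simp
    also have "\<dots> \<le> (\<Prod>n<N. exp (- (\<delta> * (1 - exp (- b n)))))"
      using w by (intro prod_mono conjI Ew Bochner_Integration.integral_nonneg) auto
    also have "\<dots> = exp (- (\<delta> * (\<Sum>n<N. 1 - exp (- b n))))"
      by (simp add: exp_sum[symmetric] sum_distrib_left sum_negf)
    finally show ?thesis .
  qed
  have B0: "0 \<le> B" using b[of 0] by linarith
  \<comment> \<open>Boundedness makes \<open>b n\<close> comparable to
    \<open>1 - exp (- b n)\<close>, so that divergence carries over to the exponent.\<close>
  have b_le: "b n \<le> exp B * (1 - exp (- b n))" for n
  proof -
    have "b n \<le> exp (b n) - 1" using exp_ge_add_one_self[of "b n"] by linarith
    also have "\<dots> = exp (b n) * (1 - exp (- b n))" by (simp add: algebra_simps flip: exp_add)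
    also have "\<dots> \<le> exp B * (1 - exp (- b n))" using b by (intro mult_right_mono) auto
    finally show ?thesis .
  qed
  have unb: "\<exists>N. K < (\<Sum>n<N. b n)" for K
  proof (rule ccontr)
    assume "\<not> (\<exists>N. K < (\<Sum>n<N. b n))"
    then have "(\<Sum>n<N. b n) \<le> K" for N by (simp add: not_less)
    then have "summable b" using b(1) by (intro summableI_nonneg_bounded)
    then show False using not b(1) by (auto intro: summable_nonneg_imp_summable_on)
  qed
  have small: "\<exists>N. expectation (Z N) < e" if e: "e > 0" for e
  proof -
    \<comment> \<open>The threshold makes the exponent in the bound on the expectation smaller than
      \<open>ln e\<close>; the factor \<open>exp B\<close> pays for passing from \<open>b n\<close>
      to \<open>1 - exp (- b n)\<close>.\<close>
    obtain N where N: "- ln e / \<delta> * exp B < (\<Sum>n<N. b n)" using unb by blast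
    also have "\<dots> \<le> exp B * (\<Sum>n<N. 1 - exp (- b n))"
      unfolding sum_distrib_left by (intro sum_mono b_le)
    finally have "exp B * (- ln e / \<delta>) < exp B * (\<Sum>n<N. 1 - exp (- b n))"
      by (simp only: mult.commute)
    then have "- ln e / \<delta> < (\<Sum>n<N. 1 - exp (- b n))"
      by (subst (asm) mult_less_cancel_left_pos) auto
    then have "- (\<delta> * (\<Sum>n<N. 1 - exp (- b n))) < ln e"
      using delta(1) by (simp add: field_simps)
    then have "exp (- (\<delta> * (\<Sum>n<N. 1 - exp (- b n)))) < e"
      using e by (metis exp_less_mono exp_ln)
    then show ?thesis using EZ[of N] by (intro exI[of _ N]) linarith
  qed
  \<comment> \<open>Where all partial sums stay below \<open>K\<close>, every \<open>Z N\<close> is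
    at least \<open>exp (- real K)\<close>, whereas the expectation of \<open>Z N\<close> becomes
    arbitrarily small.\<close>
  have bounded: "prob {\<omega> \<in> space M. \<forall>N. (\<Sum>n<N. b n * of_bool (c < \<bar>g n \<omega>\<bar>)) \<le> real K} = 0" for K
  proof -
    define S where "S = {\<omega> \<in> space M. \<forall>N. (\<Sum>n<N. b n * of_bool (c < \<bar>g n \<omega>\<bar>)) \<le> real K}"
    have S: "S \<in> events" unfolding S_def by measurable
    have *: "exp (- real K) * prob S \<le> expectation (Z N)" for N
    proof -
      have "exp (- real K) * prob S = expectation (\<lambda>\<omega>. exp (- real K) * indicator S \<omega>)"
        using sets.sets_into_space[OF S] by (simp add: Int_absorb2)
      also have "\<dots> \<le> expectation (Z N)"
      proof (rule integral_mono)
        show "integrable M (\<lambda>\<omega>. exp (- real K) * indicator S \<omega>)"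
          using S by (intro integrable_mult_right integrable_real_indicator) (auto simp: emeasure_eq_measure)
        show "integrable M (Z N)"
          unfolding Z_def
          by (rule integrable_const_bound[where B = 1])
            (use w in \<open>auto intro!: prod_le_1 simp: abs_prod\<close>)
        show "exp (- real K) * indicator S \<omega> \<le> Z N \<omega>" if "\<omega> \<in> space M" for \<omega>
          unfolding Z_exp by (auto simp: indicator_def S_def)
      qed
      finally show ?thesis .
    qed
    have "exp (- real K) * prob S \<le> e" if "e > 0" for e
      using small[OF that] * by (meson less_imp_le order.trans)
    then have "exp (- real K) * prob S \<le> 0" by (rule field_le_epsilon) simp
    then show ?thesis unfolding S_def[symmetric] by (simp add: mult_le_0_iff measure_le_0_iff)
  qed
  have "AE \<omega> in M. \<not> (\<forall>N. (\<Sum>n<N. b n * of_bool (c < \<bar>g n \<omega>\<bar>)) \<le> real K)" for K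
  proof (rule AE_I')
    have "{\<omega> \<in> space M. \<forall>N. (\<Sum>n<N. b n * of_bool (c < \<bar>g n \<omega>\<bar>)) \<le> real K} \<in> events"
      by measurable
    then show "{\<omega> \<in> space M. \<forall>N. (\<Sum>n<N. b n * of_bool (c < \<bar>g n \<omega>\<bar>)) \<le> real K} \<in> null_sets M"
      using bounded[of K] by (intro null_setsI) (simp_all only: emeasure_eq_measure ennreal_0)
  qed auto
  then have "AE \<omega> in M. \<forall>K. \<not> (\<forall>N. (\<Sum>n<N. b n * of_bool (c < \<bar>g n \<omega>\<bar>)) \<le> real K)"
    by (simp add: AE_all_countable)
  then show ?thesis
  proof eventually_elim
    case (elim \<omega>)
    show ?case
    proof
      assume s: "(\<lambda>n. b n * of_bool (c < \<bar>g n \<omega>\<bar>)) summable_on UNIV"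
      obtain K :: nat where K: "(\<Sum>\<^sub>\<infinity>n. b n * of_bool (c < \<bar>g n \<omega>\<bar>)) \<le> real K"
        using real_arch_simple by blast
      have "(\<Sum>n<N. b n * of_bool (c < \<bar>g n \<omega>\<bar>)) \<le> real K" for N
        by (rule order.trans[OF finite_sum_le_infsum[OF s] K]) (use b in auto)
      then show False using elim by blast
    qed
  qed
qed

section \<open>Fourier multipliers\<close>

lemma inv_fourier_L2 [simp]:
  "fourier_L2 (inv fourier_L2 u) = u" "inv fourier_L2 (fourier_L2 u) = u"
  by (simp_all add: surj_f_inv_f[OF bij_is_surj[OF bij_fourier_L2]] inv_f_f[OF bij_is_inj[OF bij_fourier_L2]])

lemma norm_fourier_L2 [simp]: "norm (fourier_L2 u) = norm (u :: 'd::finite L2)"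
proof -
  have "(norm (fourier_L2 u))\<^sup>2 = (norm u)\<^sup>2"
    using cinner_fourier_L2[of u u] unfolding cinner_self by (simp only: of_real_eq_iff)
  then show ?thesis by (simp add: power2_eq_iff_nonneg)
qed

lemma fourier_L2_diff: "fourier_L2 (u - v) = fourier_L2 u - fourier_L2 v"
  by (rule linear_diff[OF bounded_linear.linear[OF bounded_linear_fourier_L2]])

text \<open>The transform preserves norms, so convergence may be checked after applying it.\<close>

lemma tendsto_inv_fourier_L2:
  assumes "w \<longlonglongrightarrow> fourier_L2 u"
  shows "(\<lambda>n. inv fourier_L2 (w n)) \<longlonglongrightarrow> (u :: 'd::finite L2)"
proof -
  have "norm (inv fourier_L2 (w n) - u) = norm (w n - fourier_L2 u)" for n
    using norm_fourier_L2[of "inv fourier_L2 (w n) - u"] by (simp add: fourier_L2_diff)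
  then have "(\<lambda>n. norm (inv fourier_L2 (w n) - u)) \<longlonglongrightarrow> 0"
    using assms by (simp add: LIM_zero_iff tendsto_norm_zero_iff)
  then show ?thesis by (simp add: LIM_zero_iff tendsto_norm_zero_iff)
qed

lemma square_integrable_bounded_by:
  assumes "f \<in> borel_measurable borel" "square_integrable g" "AE x in lborel. cmod (f x) \<le> C * cmod (g x)"
  shows "square_integrable f"
  unfolding square_integrable_def
proof
  have [measurable]: "f \<in> borel_measurable borel" by fact
  show "f \<in> borel_measurable lborel" by simp
  have "integrable lborel (\<lambda>x. (cmod (C * g x))\<^sup>2)"
    using square_integrable_scale[OF assms(2), of "complex_of_real C"] by (simp add: square_integrable_def)
  then show "integrable lborel (\<lambda>x. (cmod (f x))\<^sup>2)"
  proof (rule Bochner_Integration.integrable_bound)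
    show "AE x in lborel. norm ((cmod (f x))\<^sup>2) \<le> norm ((cmod (C * g x))\<^sup>2)"
      using assms(3)
    proof eventually_elim
      case (elim x)
      also have "C * cmod (g x) \<le> \<bar>C\<bar> * cmod (g x)" by (intro mult_right_mono) auto
      finally have "cmod (f x) \<le> cmod (C * g x)" by (simp add: norm_mult)
      then have "(cmod (f x))\<^sup>2 \<le> (cmod (C * g x))\<^sup>2" by (rule power_mono) simp
      then show ?case by simp
    qed
  qed measurable
qed

section \<open>Sobolev weights and uniqueness of extensions\<close>

lemma borel_measurable_jb_symbol [measurable]: "jb_symbol s \<in> borel_measurable borel"
  unfolding jb_symbol_def by measurable

text \<open>The symbols multiply to 1. Membership in \<open>H_infty\<close> places \<psi> in the
  domain of \<open>jb s\<close>; the second product is then almost everywhere the transform of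
  \<psi>, so it is square integrable too.\<close>

lemma jb_jb_inverse:
  assumes "\<psi> \<in> H_infty"
  shows "jb (- s) (jb s \<psi>) = \<psi>"
proof -
  let ?F = "rep_L2 (fourier_L2 \<psi>)"
  have sq: "square_integrable (\<lambda>\<xi>. jb_symbol s \<xi> * ?F \<xi>)"
    using assms by (simp add: H_infty_def multiplier_dom_def)
  have c: "jb_symbol (- s) \<xi> * (jb_symbol s \<xi> * z) = z" for \<xi> z
  proof -
    have pos: "0 < 1 + (norm \<xi>)\<^sup>2" by (simp add: add_pos_nonneg)
    have "(1 + (norm \<xi>)\<^sup>2) powr (- s / 2) * (1 + (norm \<xi>)\<^sup>2) powr (s / 2) = 1"
      using pos unfolding powr_add[symmetric] by simp
    then show ?thesis unfolding jb_symbol_def mult.assoc[symmetric] of_real_mult[symmetric] by simp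
  qed
  let ?G = "\<lambda>\<xi>. jb_symbol (- s) \<xi> * rep_L2 (fourier_L2 (jb s \<psi>)) \<xi>"
  have G: "AE \<xi> in lborel. ?G \<xi> = ?F \<xi>"
    unfolding jb_def multiplier_def inv_fourier_L2 using rep_abs_L2[OF sq]
    by eventually_elim (simp add: c)
  have "square_integrable ?G"
  proof (rule square_integrable_bounded_by)
    show "?G \<in> borel_measurable borel" by measurable
    show "AE \<xi> in lborel. cmod (?G \<xi>) \<le> 1 * cmod (?F \<xi>)" using G by eventually_elim simp
  qed (rule square_integrable_rep)
  then have "abs_L2 ?G = abs_L2 ?F"
    using G by (subst abs_L2_eq_iff) (rule square_integrable_rep | assumption)+
  then have "inv fourier_L2 (abs_L2 ?G) = \<psi>" by (simp only: abs_rep_L2 inv_fourier_L2)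
  then show ?thesis by (simp only: jb_def multiplier_def)
qed

lemma rep_truncate_L2:
  assumes "E \<in> sets borel"
  shows "AE x in lborel. rep_L2 (truncate_L2 E u) x = indicator E x * rep_L2 u x"
  unfolding truncate_L2_def by (intro rep_abs_L2 square_integrable_indicator_mult assms square_integrable_rep)

text \<open>On a ball in frequency every power of the symbol is bounded; the exponent
  \<open>\<bar>s\<bar>\<close> treats both signs of \<open>s\<close> at once. These band-limited
  functions are the approximants in \<open>H_infty_dense\<close>.\<close>

lemma inv_fourier_truncate_in_H_infty:
  "inv fourier_L2 (truncate_L2 (cball 0 r) w) \<in> (H_infty :: 'd::finite L2 set)"
  unfolding H_infty_def multiplier_dom_def
proof (intro INT_I CollectI)
  fix s :: real
  show "square_integrable (\<lambda>\<xi>. jb_symbol s \<xi> * rep_L2 (fourier_L2 (inv fourier_L2 (truncate_L2 (cball 0 r) w))) \<xi>)"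
  proof (rule square_integrable_bounded_by[where C = "(1 + r\<^sup>2) powr (\<bar>s\<bar> / 2)" and g = "rep_L2 w"])
    show "AE \<xi> in lborel. cmod (jb_symbol s \<xi> * rep_L2 (fourier_L2 (inv fourier_L2 (truncate_L2 (cball 0 r) w))) \<xi>)
        \<le> (1 + r\<^sup>2) powr (\<bar>s\<bar> / 2) * cmod (rep_L2 w \<xi>)"
      using rep_truncate_L2[of "cball 0 r" w, OF borel_closed[OF closed_cball]]
    proof eventually_elim
      case (elim \<xi>)
      show ?case
      proof (cases "\<xi> \<in> cball 0 r")
        case True
        have "(1 + (norm \<xi>)\<^sup>2) powr (s / 2) \<le> (1 + (norm \<xi>)\<^sup>2) powr (\<bar>s\<bar> / 2)"
          by (intro powr_mono) auto
        also have "\<dots> \<le> (1 + r\<^sup>2) powr (\<bar>s\<bar> / 2)"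
          using True by (intro powr_mono2 add_left_mono power_mono) auto
        finally have "(1 + (norm \<xi>)\<^sup>2) powr (s / 2) * cmod (rep_L2 w \<xi>)
            \<le> (1 + r\<^sup>2) powr (\<bar>s\<bar> / 2) * cmod (rep_L2 w \<xi>)"
          by (rule mult_right_mono) simp
        moreover have "indicator (cball 0 r) \<xi> = (1 :: complex)" using True by (rule indicator_simps)
        ultimately show ?thesis
          by (simp only: elim inv_fourier_L2 norm_mult jb_symbol_def norm_of_real mult_1_left) simp
      next
        case False
        then show ?thesis by (simp add: elim)
      qed
    qed
  qed auto
qed

lemma H_infty_dense: "\<exists>f. (\<forall>n. f n \<in> H_infty) \<and> f \<longlonglongrightarrow> (u :: 'd::finite L2)"
  using inv_fourier_truncate_in_H_infty tendsto_inv_fourier_L2[OF tendsto_truncate_cball[of "fourier_L2 u"]]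
  by (intro exI[of _ "\<lambda>n. inv fourier_L2 (truncate_L2 (cball 0 (real n)) (fourier_L2 u))"]) auto

text \<open>The identity is known on \<open>H_infty\<close> only; density and continuity extend it
  in one argument after the other. Uniqueness is what turns non-membership in
  \<open>schatten_sobolev\<close> into a statement about one operator.\<close>

lemma extends_to_unique:
  fixes A B :: "'d::finite L2 \<Rightarrow> 'd L2"
  assumes A: "extends_to \<gamma> A" and B: "extends_to \<gamma> B"
  shows "A = B"
proof
  have bl: "bounded_linear A" "bounded_linear B"
    using A B by (auto simp: extends_to_def L2_operator_def)
  have eq: "cinner \<phi> (A \<psi>) = cinner \<phi> (B \<psi>)" if "\<phi> \<in> H_infty" "\<psi> \<in> H_infty" for \<phi> \<psi>
    using A B that by (simp add: extends_to_def of_L2_operator_def)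
  have H: "A \<psi> = B \<psi>" if "\<psi> \<in> H_infty" for \<psi>
  proof (rule cinner_ext)
    fix \<phi> :: "'d L2"
    obtain f where f: "\<And>n. f n \<in> H_infty" "f \<longlonglongrightarrow> \<phi>" using H_infty_dense by blast
    have "(\<lambda>n. cinner (f n) (A \<psi>)) \<longlonglongrightarrow> cinner \<phi> (A \<psi>)" "(\<lambda>n. cinner (f n) (B \<psi>)) \<longlonglongrightarrow> cinner \<phi> (B \<psi>)"
      by (intro cinner.tendsto f tendsto_const)+
    then show "cinner \<phi> (A \<psi>) = cinner \<phi> (B \<psi>)"
      using LIMSEQ_unique by (simp add: eq[OF f(1) that])
  qed
  fix \<psi> :: "'d L2"
  obtain f where f: "\<And>n. f n \<in> H_infty" "f \<longlonglongrightarrow> \<psi>" using H_infty_dense by blast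
  have "(\<lambda>n. A (f n)) \<longlonglongrightarrow> A \<psi>" "(\<lambda>n. A (f n)) \<longlonglongrightarrow> B \<psi>"
    using bounded_linear.tendsto[OF bl(1) f(2)] bounded_linear.tendsto[OF bl(2) f(2)] by (simp_all add: H f(1))
  then show "A \<psi> = B \<psi>" by (rule LIMSEQ_unique)
qed

lemma L2_extension_eqI:
  assumes "extends_to \<gamma> A"
  shows "L2_extension \<gamma> = A"
  unfolding L2_extension_def
proof (rule the_equality)
  show "extends_to \<gamma> A" by fact
  show "B = A" if "extends_to \<gamma> B" for B by (rule extends_to_unique[OF that assms])
qed

text \<open>In both arguments \<open>jb (- s)\<close> undoes \<open>jb s\<close>, so the Sobolev
  weights leave the problem here.\<close>

lemma extends_to_jb_conj:
  assumes "L2_operator R"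
  shows "extends_to (jb_conj s (jb_conj (- s) (of_L2_operator R))) R"
  unfolding extends_to_def using assms
  by (simp add: jb_conj_def jb_dual_def of_L2_operator_def jb_jb_inverse)

section \<open>The Wiener randomization as a self-adjoint unitary involution\<close>

text \<open>Isolates what the Wiener randomization needs: mutually orthogonal projections with
  trivial common kernel. \<open>total\<close> is easier to verify than convergence of the sum of all
  \<open>P k u\<close> to \<open>u\<close>.\<close>

locale resolution_of_identity =
  fixes P :: "'k \<Rightarrow> 'd::finite L2 \<Rightarrow> 'd L2"
  assumes add: "P k (u + v) = P k u + P k v"
    and scaleC: "P k (c *\<^sub>C u) = c *\<^sub>C P k u"
    and sym: "cinner (P k u) v = cinner u (P k v)"
    and comp: "P j (P k u) = (if j = k then P k u else 0)"
    and total: "(\<And>k. P k u = 0) \<Longrightarrow> u = 0"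
begin

lemma cinner_P: "cinner (P j u) (P k v) = (if j = k then cinner u (P k v) else 0)"
  by (simp add: sym comp)

lemma orth: "pairwise (\<lambda>j k. orthogonal (h j *\<^sub>R P j u) (h k *\<^sub>R P k u)) I"
  by (simp add: pairwise_def orthogonal_def inner_L2_def cinner_scaleR_left cinner_scaleR_right cinner_P)

text \<open>Bessel's inequality for orthogonal projections, by the same Cauchy-Schwarz argument as
  for orthonormal systems.\<close>

lemma sum_norm_le:
  assumes F: "finite F"
  shows "(\<Sum>k\<in>F. (norm (P k u))\<^sup>2) \<le> (norm u)\<^sup>2"
proof -
  define s where "s = (\<Sum>k\<in>F. 1 *\<^sub>R P k u)"
  have s: "(norm s)\<^sup>2 = (\<Sum>k\<in>F. (norm (P k u))\<^sup>2)"
    unfolding s_def by (subst norm_sum_Pythagorean[OF F orth]) simp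
  have "cinner s u = (\<Sum>k\<in>F. cinner (P k u) (P k u))"
    unfolding s_def cinner.sum_left by (simp add: sym comp)
  then have "cinner s u = complex_of_real ((norm s)\<^sup>2)" by (simp add: s cinner_self)
  then have "(norm s)\<^sup>2 \<le> norm s * norm u"
    using cmod_cinner_le[of s u] by (simp add: norm_power)
  then have "norm s \<le> norm u" by (cases "norm s = 0") (auto simp: power2_eq_square)
  then show ?thesis unfolding s[symmetric] by (intro power_mono) auto
qed

lemma bounded_linear_P: "bounded_linear (P k)"
proof (rule bounded_linear_intro)
  show "P k (u + v) = P k u + P k v" for u v by (rule add)
  show "P k (r *\<^sub>R u) = r *\<^sub>R P k u" for r u
    using scaleC[of k "complex_of_real r" u] by (simp add: scaleC_of_real)
  show "norm (P k u) \<le> norm u * 1" for u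
    using power2_le_imp_le[of "norm (P k u)" "norm u"] sum_norm_le[of "{k}" u] by simp
qed

end

locale signed_resolution = resolution_of_identity P
  for P :: "'k \<Rightarrow> 'd::finite L2 \<Rightarrow> 'd L2" +
  fixes h :: "'k \<Rightarrow> real"
  assumes sign: "\<bar>h k\<bar> = 1"
begin

definition W :: "'d L2 \<Rightarrow> 'd L2" where
  "W u = (\<Sum>\<^sub>\<infinity>k. h k *\<^sub>R P k u)"

lemma W_has_sum: "((\<lambda>k. h k *\<^sub>R P k u) has_sum W u) UNIV"
  unfolding W_def
proof (rule has_sum_infsum, rule summable_on_orthogonal, rule orth)
  show "(\<lambda>k. (norm (h k *\<^sub>R P k u))\<^sup>2) summable_on UNIV"
    unfolding norm_scaleR sign mult_1
    using sum_norm_le[of _ u] by (intro nonneg_bdd_above_summable_on bdd_aboveI2[where M = "(norm u)\<^sup>2"]) auto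
qed

text \<open>Orthogonality leaves only the term of index \<open>j\<close>: on the range of
  \<open>P j\<close> the operator \<open>W\<close> is multiplication by the sign
  \<open>h j\<close>.\<close>

lemma P_W: "P j (W u) = h j *\<^sub>R P j u"
proof -
  interpret P: bounded_linear "P j" by (rule bounded_linear_P)
  have "((\<lambda>k. P j (h k *\<^sub>R P k u)) has_sum P j (W u)) UNIV"
    by (rule has_sum_bounded_linear[OF bounded_linear_P W_has_sum])
  moreover have "((\<lambda>k. P j (h k *\<^sub>R P k u)) has_sum h j *\<^sub>R P j u) UNIV"
    by (intro has_sum_finite_neutralI[of "{j}"]) (auto simp: P.scaleR comp)
  ultimately show ?thesis by (rule has_sum_unique)
qed

text \<open>Each \<open>P k\<close> picks up the square of its sign, which is 1, so the difference
  of the two sides lies in the common kernel.\<close>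

lemma W_W: "W (W u) = u"
proof -
  interpret P: bounded_linear "P k" for k by (rule bounded_linear_P)
  have "h k * h k = 1" for k
    using abs_mult_self_eq[of "h k"] unfolding sign by simp
  then have "P k (W (W u) - u) = 0" for k
    unfolding P.diff P_W by simp
  then have "W (W u) - u = 0" by (rule total)
  then show ?thesis by simp
qed

lemma W_sym: "cinner (W u) v = cinner u (W v)"
proof -
  have "((\<lambda>k. cinner (h k *\<^sub>R P k u) v) has_sum cinner (W u) v) UNIV"
    by (rule has_sum_bounded_linear[OF cinner.bounded_linear_left W_has_sum])
  moreover have "((\<lambda>k. cinner u (h k *\<^sub>R P k v)) has_sum cinner u (W v)) UNIV"
    by (rule has_sum_bounded_linear[OF cinner.bounded_linear_right W_has_sum])
  ultimately show ?thesis
    unfolding cinner_scaleR_left cinner_scaleR_right sym by (rule has_sum_unique)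
qed

lemma cinner_W: "cinner (W u) (W v) = cinner u v"
  by (simp add: W_sym W_W)

lemma W_scaleC: "W (c *\<^sub>C u) = c *\<^sub>C W u"
proof -
  have "((\<lambda>k. h k *\<^sub>R P k (c *\<^sub>C u)) has_sum c *\<^sub>C W u) UNIV"
    using has_sum_bounded_linear[OF scaleC.bounded_linear_right W_has_sum[of u], of c]
    by (simp add: scaleC scaleC_scaleR)
  then show ?thesis unfolding W_def[of "c *\<^sub>C u"] by (rule infsumI)
qed

lemma bounded_linear_W: "bounded_linear W"
proof (rule bounded_linear_intro)
  fix u v :: "'d L2" and r :: real
  have "((\<lambda>k. h k *\<^sub>R P k (u + v)) has_sum (W u + W v)) UNIV"
    using has_sum_add[OF W_has_sum[of u] W_has_sum[of v]] by (simp add: add scaleR_add_right)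
  then show "W (u + v) = W u + W v" unfolding W_def[of "u + v"] by (rule infsumI)
  show "W (r *\<^sub>R u) = r *\<^sub>R W u"
    using W_scaleC[of "complex_of_real r" u] by (simp add: scaleC_of_real)
  have "(norm (W u))\<^sup>2 = (norm u)\<^sup>2"
    using cinner_W[of u u] unfolding cinner_self by (simp only: of_real_eq_iff)
  then show "norm (W u) \<le> norm u * 1" by (simp add: power2_eq_iff_nonneg)
qed

end

section \<open>Unit cubes in frequency space as a resolution of the identity\<close>

definition cube :: "int^'d \<Rightarrow> (real^'d::finite) set" where
  "cube k = {\<xi>. \<forall>i. real_of_int (k $ i) \<le> \<xi> $ i \<and> \<xi> $ i \<le> real_of_int (k $ i) + 1}"

lemma cube_cutoff_eq: "cube_cutoff k = indicator (cube k)"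
  by (auto simp: fun_eq_iff cube_cutoff_def cube_def indicator_def mem_box_cart algebra_simps)

lemma cube_borel [measurable]: "cube k \<in> sets borel"
proof -
  have "cube k = cbox (\<chi> i. real_of_int (k $ i)) (\<chi> i. real_of_int (k $ i) + 1)"
    by (auto simp: cube_def mem_box_cart)
  then show ?thesis by simp
qed

text \<open>The closed cubes share faces. In a coordinate where \<open>j\<close> and
  \<open>k\<close> differ, the two intervals can meet only at the larger integer, so the overlap
  lies in a hyperplane.\<close>

lemma AE_cube_disjoint:
  fixes j k :: "int^'d::finite"
  assumes "j \<noteq> k"
  shows "AE \<xi> in lborel. \<xi> \<notin> cube j \<inter> cube k"
proof -
  obtain i where i: "j $ i \<noteq> k $ i" using assms by (auto simp: vec_eq_iff)
  have "cube j \<inter> cube k \<subseteq> {\<xi>. \<xi> $ i = real_of_int (max (j $ i) (k $ i))}"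
  proof
    fix \<xi> assume "\<xi> \<in> cube j \<inter> cube k"
    then have "real_of_int (j $ i) \<le> \<xi> $ i" "\<xi> $ i \<le> real_of_int (j $ i) + 1"
      "real_of_int (k $ i) \<le> \<xi> $ i" "\<xi> $ i \<le> real_of_int (k $ i) + 1"
      by (auto simp: cube_def)
    then show "\<xi> \<in> {\<xi>. \<xi> $ i = real_of_int (max (j $ i) (k $ i))}"
      using i by (cases "j $ i < k $ i") auto
  qed
  moreover have "negligible {\<xi> :: real^'d. \<xi> $ i = real_of_int (max (j $ i) (k $ i))}"
    unfolding cart_eq_inner_axis by (intro negligible_standard_hyperplane) (simp add: axis_in_Basis_iff)
  ultimately have "negligible (cube j \<inter> cube k)" by (rule negligible_subset[rotated])
  then have "cube j \<inter> cube k \<in> null_sets lborel"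
    by (auto simp: negligible_iff_null_sets null_sets_completion_iff)
  then show ?thesis by (rule AE_not_in)
qed

lemma cube_cover: "\<exists>k. \<xi> \<in> cube k"
  by (intro exI[of _ "\<chi> i. \<lfloor>\<xi> $ i\<rfloor>"]) (auto simp: cube_def less_imp_le)

lemma multiplier_cube: "multiplier (cube_cutoff k) u = inv fourier_L2 (truncate_L2 (cube k) (fourier_L2 u))"
  by (simp add: multiplier_def truncate_L2_def cube_cutoff_eq)

text \<open>On the Fourier side the projections multiply by indicators, so the axioms become almost
  everywhere identities of functions. Injectivity of the transform carries them back, and its
  unitarity gives the symmetry.\<close>

lemma resolution_of_identity_cube:
  "resolution_of_identity (\<lambda>k. multiplier (cube_cutoff k) :: 'd::finite L2 \<Rightarrow> 'd L2)"
proof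
  let ?P = "\<lambda>k. multiplier (cube_cutoff k) :: 'd L2 \<Rightarrow> 'd L2"
  fix j k :: "int^'d" and u v :: "'d L2" and c :: complex
  have F: "AE \<xi> in lborel. rep_L2 (fourier_L2 (?P k u)) \<xi> = indicator (cube k) \<xi> * rep_L2 (fourier_L2 u) \<xi>" for k u
    by (simp add: multiplier_cube rep_truncate_L2)
  have inj: "u = v" if "AE \<xi> in lborel. rep_L2 (fourier_L2 u) \<xi> = rep_L2 (fourier_L2 v) \<xi>" for u v :: "'d L2"
    by (rule injD[OF bij_is_inj[OF bij_fourier_L2] L2_eqI[OF that]])
  interpret F: bounded_linear "fourier_L2 :: 'd L2 \<Rightarrow> 'd L2" by (rule bounded_linear_fourier_L2)
  show "?P k (u + v) = ?P k u + ?P k v"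
  proof (rule inj)
    show "AE \<xi> in lborel. rep_L2 (fourier_L2 (?P k (u + v))) \<xi> = rep_L2 (fourier_L2 (?P k u + ?P k v)) \<xi>"
      unfolding F.add[of "?P k u"]
      using F[of k "u + v", unfolded F.add[of u]] F[of k u] F[of k v] rep_L2_add[of "fourier_L2 u" "fourier_L2 v"]
        rep_L2_add[of "fourier_L2 (?P k u)" "fourier_L2 (?P k v)"]
      by eventually_elim (simp add: distrib_left)
  qed
  show "?P k (c *\<^sub>C u) = c *\<^sub>C ?P k u"
  proof (rule inj)
    show "AE \<xi> in lborel. rep_L2 (fourier_L2 (?P k (c *\<^sub>C u))) \<xi> = rep_L2 (fourier_L2 (c *\<^sub>C ?P k u)) \<xi>"
      unfolding fourier_L2_scaleC[of c "?P k u"]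
      using F[of k "c *\<^sub>C u", unfolded fourier_L2_scaleC[of c u]] F[of k u] rep_L2_scaleC[of c "fourier_L2 u"]
        rep_L2_scaleC[of c "fourier_L2 (?P k u)"]
      by eventually_elim simp
  qed
  show "cinner (?P k u) v = cinner u (?P k v)"
  proof -
    have "cinner (fourier_L2 (?P k u)) (fourier_L2 v) = cinner (fourier_L2 u) (fourier_L2 (?P k v))"
      unfolding cinner_rep
    proof (rule integral_cong_AE)
      show "(\<lambda>x. cnj (rep_L2 (fourier_L2 (?P k u)) x) * rep_L2 (fourier_L2 v) x) \<in> borel_measurable lborel"
        "(\<lambda>x. cnj (rep_L2 (fourier_L2 u) x) * rep_L2 (fourier_L2 (?P k v)) x) \<in> borel_measurable lborel"
        by (intro borel_measurable_integrable square_integrable_mult square_integrable_rep)+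
      show "AE x in lborel. cnj (rep_L2 (fourier_L2 (?P k u)) x) * rep_L2 (fourier_L2 v) x
          = cnj (rep_L2 (fourier_L2 u) x) * rep_L2 (fourier_L2 (?P k v)) x"
        using F[of k u] F[of k v] by eventually_elim (simp add: mult_ac)
    qed
    then show ?thesis by simp
  qed
  show "?P j (?P k u) = (if j = k then ?P k u else 0)"
  proof (cases "j = k")
    case True
    have "?P k (?P k u) = ?P k u"
      by (rule inj)
        (use F[of k "?P k u"] F[of k u] in \<open>eventually_elim, simp add: indicator_def\<close>)
    then show ?thesis using True by simp
  next
    case False
    have "?P j (?P k u) = 0"
    proof (rule inj)
      have z: "AE \<xi> in lborel. rep_L2 (fourier_L2 (0 :: 'd L2)) \<xi> = 0"
        unfolding F.zero unfolding zero_L2.abs_eq by (rule rep_abs_L2[OF square_integrable_0])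
      show "AE \<xi> in lborel. rep_L2 (fourier_L2 (?P j (?P k u))) \<xi> = rep_L2 (fourier_L2 (0 :: 'd L2)) \<xi>"
        using F[of j "?P k u"] F[of k u] AE_cube_disjoint[OF False] z
        by eventually_elim (auto simp: indicator_def)
    qed
    then show ?thesis using False by simp
  qed
  show "u = 0" if zero: "\<And>k. ?P k u = 0" for u
  proof (rule inj)
    have z: "AE \<xi> in lborel. rep_L2 (fourier_L2 (0 :: 'd L2)) \<xi> = 0"
      unfolding F.zero unfolding zero_L2.abs_eq by (rule rep_abs_L2[OF square_integrable_0])
    have "AE \<xi> in lborel. indicator (cube k) \<xi> * rep_L2 (fourier_L2 u) \<xi> = 0" for k
      using F[of k u] z unfolding zero by eventually_elim simp
    \<comment> \<open>There are countably many cubes, so the exceptional sets can be merged.\<close>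
    then have "AE \<xi> in lborel. \<forall>k. indicator (cube k) \<xi> * rep_L2 (fourier_L2 u) \<xi> = 0"
      unfolding AE_all_countable by blast
    then show "AE \<xi> in lborel. rep_L2 (fourier_L2 u) \<xi> = rep_L2 (fourier_L2 (0 :: 'd L2)) \<xi>"
      using z
    proof eventually_elim
      case (elim \<xi>)
      obtain k where "\<xi> \<in> cube k" using cube_cover by blast
      then show ?case using elim by (auto dest!: spec[of _ k])
    qed
  qed
qed

section \<open>The randomized operator\<close>

text \<open>The Wiener randomization being unitary and self-adjoint, it only rotates the singular vectors.
  The phase \<open>\<plusminus>1\<close> moves the sign of \<open>g n\<close> into the left singular vector.\<close>

lemma svd_randomize:
  fixes u v :: "nat \<Rightarrow> 'd::finite L2" and h :: "int^'d \<Rightarrow> real"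
  assumes sys: "sv_system (\<lambda>n. a n * g n) u v C" and a: "\<And>n. 0 \<le> a n" and h: "\<And>k. \<bar>h k\<bar> = 1"
  obtains u' v' where "sv_system (\<lambda>n. a n * \<bar>g n\<bar>) u' v' C"
    and "randomize a u v g h = sv_op (\<lambda>n. a n * \<bar>g n\<bar>) u' v'"
proof
  interpret sv_system "\<lambda>n. a n * g n" u v C by (rule sys)
  interpret resolution_of_identity "\<lambda>k. multiplier (cube_cutoff k) :: 'd L2 \<Rightarrow> 'd L2"
    by (rule resolution_of_identity_cube)
  interpret signed_resolution "\<lambda>k. multiplier (cube_cutoff k) :: 'd L2 \<Rightarrow> 'd L2" h
    by standard (rule h)
  \<comment> \<open>The value 1 at \<open>g n = 0\<close> keeps the phase of modulus one, so the
    left vectors remain orthonormal where the weight vanishes.\<close>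
  define \<epsilon> :: "nat \<Rightarrow> real" where "\<epsilon> n = (if 0 \<le> g n then 1 else - 1)" for n
  have \<epsilon>: "\<epsilon> n * \<epsilon> n = 1" "g n = \<epsilon> n * \<bar>g n\<bar>" for n by (auto simp: \<epsilon>_def)
  let ?u = "\<lambda>n. \<epsilon> n *\<^sub>R W (u n)" and ?v = "\<lambda>n. W (v n)"
  show "sv_system (\<lambda>n. a n * \<bar>g n\<bar>) ?u ?v C"
  proof (rule sv_system.intro)
    show "orthonormal_seq ?v" using e by (simp add: orthonormal_seq_def cinner_W)
    show "orthonormal_seq ?u"
      using f by (auto simp: orthonormal_seq_def cinner_W cinner_scaleR_left cinner_scaleR_right \<epsilon>(1)
          simp flip: of_real_mult)
    show "\<bar>a n * \<bar>g n\<bar>\<bar> \<le> C" for n using q[of n] by (simp add: abs_mult)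
  qed
  have "wiener h = W" by (simp add: fun_eq_iff wiener_def W_def)
  moreover have "randomize_sv a u v g = sv_op (\<lambda>n. a n * g n) u v"
    by (simp add: fun_eq_iff randomize_sv_def sv_op_def)
  moreover have "W (sv_op (\<lambda>n. a n * g n) u v (W \<phi>)) = sv_op (\<lambda>n. a n * \<bar>g n\<bar>) ?u ?v \<phi>" for \<phi>
  proof -
    interpret W: bounded_linear W by (rule bounded_linear_W)
    have "((\<lambda>n. W ((a n * g n) *\<^sub>R rank_one (u n) (v n) (W \<phi>))) has_sum
        W (sv_op (\<lambda>n. a n * g n) u v (W \<phi>))) UNIV"
      by (rule has_sum_bounded_linear[OF bounded_linear_W has_sum])
    \<comment> \<open>The outer \<open>W\<close> acts on \<open>u n\<close>, and symmetry moves the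
      inner one from \<phi> onto \<open>v n\<close>.\<close>
    moreover have "W ((a n * g n) *\<^sub>R rank_one (u n) (v n) (W \<phi>))
        = (a n * \<bar>g n\<bar>) *\<^sub>R rank_one (?u n) (?v n) \<phi>" for n
      unfolding W.scaleR rank_one_def W_scaleC W_sym[symmetric] scaleC_scaleR scaleR_scaleR
      by (subst \<epsilon>(2)) (simp add: mult_ac)
    ultimately show ?thesis unfolding sv_op_def[of _ ?u ?v] by (simp add: infsumI)
  qed
  ultimately show "randomize a u v g h = sv_op (\<lambda>n. a n * \<bar>g n\<bar>) ?u ?v"
    by (simp add: randomize_def fun_eq_iff)
qed

text \<open>A deterministic statement about one path. Summability of the \<alpha>-th powers forces
  the weights to tend to 0; they are therefore bounded and the series defines a compact operator,
  whatever the size of the individual \<open>g n\<close>.\<close>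

lemma randomize_schatten:
  fixes u v :: "nat \<Rightarrow> 'd::finite L2" and h :: "int^'d \<Rightarrow> real"
  assumes u: "orthonormal_seq u" and v: "orthonormal_seq v" and a: "\<And>n. 0 \<le> a n" and h: "\<And>k. \<bar>h k\<bar> = 1"
    and \<alpha>: "0 < \<alpha>" and \<beta>: "0 < \<beta>"
    and sum: "(\<lambda>n. (a n * \<bar>g n\<bar>) powr \<alpha>) summable_on UNIV"
    and not_sum: "\<not> (\<lambda>n. (a n * \<bar>g n\<bar>) powr \<beta>) summable_on UNIV"
  shows "randomize a u v g h \<in> schatten \<alpha> - schatten \<beta>"
proof -
  have b0: "0 \<le> a n * \<bar>g n\<bar>" for n using a by simp
  have lim: "(\<lambda>n. a n * \<bar>g n\<bar>) \<longlonglongrightarrow> 0"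
  proof -
    have "(\<lambda>n. (a n * \<bar>g n\<bar>) powr \<alpha>) \<longlonglongrightarrow> 0"
      using sum by (intro summable_LIMSEQ_zero summable_on_imp_summable)
    then have "(\<lambda>n. ((a n * \<bar>g n\<bar>) powr \<alpha>) powr (1 / \<alpha>)) \<longlonglongrightarrow> 0"
      by (rule tendsto_zero_powrI[OF _ tendsto_const]) (use \<alpha> in auto)
    then show ?thesis using \<alpha> b0 by (simp add: powr_powr)
  qed
  then have "Bseq (\<lambda>n. a n * \<bar>g n\<bar>)" by (intro convergent_imp_Bseq convergentI)
  then obtain C where "\<forall>n. norm (a n * \<bar>g n\<bar>) \<le> C" by (rule BseqE)
  then have C: "\<bar>a n * \<bar>g n\<bar>\<bar> \<le> C" for n by simp
  have "sv_system (\<lambda>n. a n * g n) u v C"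
    by (rule sv_system.intro[OF u v]) (use C in \<open>simp add: abs_mult\<close>)
  then obtain u' v' where sys: "sv_system (\<lambda>n. a n * \<bar>g n\<bar>) u' v' C"
    and R: "randomize a u v g h = sv_op (\<lambda>n. a n * \<bar>g n\<bar>) u' v'"
    using a h by (rule svd_randomize)
  interpret sv_system "\<lambda>n. a n * \<bar>g n\<bar>" u' v' C by (rule sys)
  note iff = schatten_svd_iff[OF svd[OF b0] compact_operator_sv_op[OF sys lim]]
  show ?thesis unfolding R using iff[OF \<alpha>] iff[OF \<beta>] sum not_sum by simp
qed

section \<open>Passage to almost sure statements\<close>

text \<open>The exceptional set lies in the union of two null cylinders, which also deals with
  predicates whose measurability has not been established.\<close>

lemma AE_pair_prob_space:
  assumes "prob_space M" "prob_space N" "AE x in M. P x" "AE y in N. Q y"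
  shows "AE z in M \<Otimes>\<^sub>M N. P (fst z) \<and> Q (snd z)"
proof -
  interpret M: prob_space M by fact
  interpret N: prob_space N by fact
  obtain A where A: "{x \<in> space M. \<not> P x} \<subseteq> A" "A \<in> null_sets M"
    using assms(3) by (auto simp: eventually_ae_filter)
  obtain B where B: "{y \<in> space N. \<not> Q y} \<subseteq> B" "B \<in> null_sets N"
    using assms(4) by (auto simp: eventually_ae_filter)
  have "A \<times> space N \<in> null_sets (M \<Otimes>\<^sub>M N)" "space M \<times> B \<in> null_sets (M \<Otimes>\<^sub>M N)"
    using A(2) B(2) by (auto simp: null_sets_def N.emeasure_pair_measure_Times)
  then have "A \<times> space N \<union> space M \<times> B \<in> null_sets (M \<Otimes>\<^sub>M N)" by (rule null_sets.Un)
  moreover have "{z \<in> space (M \<Otimes>\<^sub>M N). \<not> (P (fst z) \<and> Q (snd z))} \<subseteq> A \<times> space N \<union> space M \<times> B"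
    using A(1) B(1) by (auto simp: space_pair_measure)
  ultimately show ?thesis by (rule AE_I')
qed

lemma rademacher_AE:
  assumes "prob_space N" "rademacher N X"
  shows "AE \<omega> in N. \<bar>X \<omega>\<bar> = 1"
proof -
  interpret prob_space N by fact
  have [measurable]: "X \<in> borel_measurable N" using assms(2) by (simp add: rademacher_def)
  let ?A = "\<lambda>s. {\<omega> \<in> space N. X \<omega> = s}"
  have "prob (?A 1 \<union> ?A (- 1)) = prob (?A 1) + prob (?A (- 1))"
    by (rule finite_measure_Union) auto
  also have "\<dots> = 1" using assms(2) by (simp add: rademacher_def)
  finally have "AE \<omega> in N. \<omega> \<in> ?A 1 \<union> ?A (- 1)" by (rule AE_prob_1)
  then show ?thesis by eventually_elim auto
qed

text \<open>The limsup condition controls the probabilities from some index on, and finitely many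
  weights do not affect divergence. Where \<open>c < \<bar>g n \<omega>\<bar>\<close> the term is at
  least \<open>a n powr p * c powr p\<close>, so comparison with the truncated weights
  applies.\<close>

lemma (in prob_space) AE_not_summable_randomized:
  fixes g :: "nat \<Rightarrow> 'a \<Rightarrow> real" and a :: "nat \<Rightarrow> real"
  assumes indep: "indep_vars (\<lambda>_. borel) g UNIV" and c: "c > 0"
    and lim: "limsup (\<lambda>n. ereal (prob {\<omega> \<in> space M. \<bar>g n \<omega>\<bar> \<le> c})) < 1"
    and a: "\<And>n. 0 \<le> a n" "\<And>n. a n \<le> A" and p: "p > 0" and not: "\<not> (\<lambda>n. a n powr p) summable_on UNIV"
  shows "AE \<omega> in M. \<not> (\<lambda>n. (a n * \<bar>g n \<omega>\<bar>) powr p) summable_on UNIV"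
proof -
  \<comment> \<open>\<open>1 - r\<close> will be the uniform lower bound for the probability that
    \<open>c < \<bar>g n \<omega>\<bar>\<close>.\<close>
  obtain r where r: "limsup (\<lambda>n. ereal (prob {\<omega> \<in> space M. \<bar>g n \<omega>\<bar> \<le> c})) < ereal r" "ereal r < 1"
    using ereal_dense2[OF lim] by blast
  obtain N where N: "\<And>n. n \<ge> N \<Longrightarrow> prob {\<omega> \<in> space M. \<bar>g n \<omega>\<bar> \<le> c} < r"
    using Limsup_lessD[OF r(1)] by (auto simp: eventually_sequentially)
  \<comment> \<open>Early weights are set to 0 instead of shifting the sequence, so the independence
    of the whole family \<open>g\<close> applies as it stands.\<close>
  define b where "b n = (if n < N then 0 else a n powr p)" for n
  have b: "\<not> b summable_on UNIV"
  proof
    assume "b summable_on UNIV"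
    then have "(\<lambda>n. b n + (if n < N then a n powr p else 0)) summable_on UNIV"
    proof (rule summable_on_add)
      show "(\<lambda>n. if n < N then a n powr p else 0) summable_on UNIV"
        by (rule has_sum_imp_summable[OF has_sum_finite_neutralI[of "{..<N}" _ _ _]]) auto
    qed
    moreover have "(\<lambda>n. b n + (if n < N then a n powr p else 0)) = (\<lambda>n. a n powr p)"
      by (auto simp: b_def)
    ultimately show False using not by simp
  qed
  have "AE \<omega> in M. \<not> (\<lambda>n. b n * of_bool (c < \<bar>g n \<omega>\<bar>)) summable_on UNIV"
  proof (rule AE_not_summable_indep_weights[OF indep])
    show "0 < 1 - r" using r(2) by simp
    show "prob {\<omega> \<in> space M. \<bar>g n \<omega>\<bar> \<le> c} \<le> 1 - (1 - r)" if "b n \<noteq> 0" for n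
      using N[of n] that by (auto simp: b_def split: if_splits)
    show "0 \<le> b n" for n by (simp add: b_def)
    show "b n \<le> A powr p" for n using a[of n] p by (auto simp: b_def intro: powr_mono2)
  qed (rule b)
  then show ?thesis
  proof eventually_elim
    case (elim \<omega>)
    show ?case
    proof
      assume s: "(\<lambda>n. (a n * \<bar>g n \<omega>\<bar>) powr p) summable_on UNIV"
      have "(\<lambda>n. b n * of_bool (c < \<bar>g n \<omega>\<bar>)) summable_on UNIV"
      proof (rule summable_on_comparison_test[OF summable_on_cmult_right[OF s, of "1 / c powr p"]])
        fix n
        have "c powr p \<le> \<bar>g n \<omega>\<bar> powr p" if "c < \<bar>g n \<omega>\<bar>"
          using that c p by (intro powr_mono2) auto
        then have "a n powr p * c powr p \<le> a n powr p * \<bar>g n \<omega>\<bar> powr p" if "c < \<bar>g n \<omega>\<bar>"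
          using that by (intro mult_left_mono) auto
        then show "b n * of_bool (c < \<bar>g n \<omega>\<bar>) \<le> 1 / c powr p * (a n * \<bar>g n \<omega>\<bar>) powr p"
          using a(1)[of n] c by (auto simp: b_def powr_mult field_simps)
        show "0 \<le> b n * of_bool (c < \<bar>g n \<omega>\<bar>)" by (simp add: b_def)
      qed
      then show False using elim by blast
    qed
  qed
qed

theorem proposition2p6:
  fixes M :: "'a measure" and N :: "'b measure"
    and g :: "nat \<Rightarrow> 'a \<Rightarrow> real" and h :: "int^'d::finite \<Rightarrow> 'b \<Rightarrow> real"
    and \<gamma>\<^sub>0 :: "'d sobolev_operator"
    and a :: "nat \<Rightarrow> real" and u v :: "nat \<Rightarrow> 'd L2"
    and C\<^sub>0 c \<alpha> \<beta> \<sigma> :: real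
  assumes "prob_space M" and "prob_space N"
    and "prob_space.indep_vars M (\<lambda>_. borel) g UNIV"
    and "\<And>n. integrable M (g n)" and "\<And>n. prob_space.expectation M (g n) = 0"
    and "C\<^sub>0 > 0"
    and "\<And>n \<zeta>. (\<integral>\<^sup>+x. ennreal (exp (\<zeta> * x)) \<partial>distr M borel (g n)) \<le> ennreal (exp (C\<^sub>0 * \<zeta>\<^sup>2))"
    and "c > 0"
    and "limsup (\<lambda>n. ereal (measure M {\<omega> \<in> space M. \<bar>g n \<omega>\<bar> \<le> c})) < 1"
    and "prob_space.indep_vars N (\<lambda>_. borel) h UNIV"
    and "\<And>k. rademacher N (h k)"
    and "1 \<le> \<beta>" and "\<beta> \<le> \<alpha>"
    and "jb_conj \<sigma> \<gamma>\<^sub>0 \<in> schatten_sobolev \<alpha> - schatten_sobolev \<beta>"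
    and "svd (L2_extension (jb_conj \<sigma> \<gamma>\<^sub>0)) a u v"
  shows "AE (\<omega>, \<omega>') in M \<Otimes>\<^sub>M N.
    jb_conj \<sigma> (randomize_sobolev \<sigma> a u v (\<lambda>n. g n \<omega>) (\<lambda>k. h k \<omega>'))
      \<in> schatten_sobolev \<alpha> - schatten_sobolev \<beta>"
proof -
  interpret M: prob_space M by fact
  note indep = assms(3) and subgauss = assms(7)
  have \<alpha>\<beta>: "0 < \<alpha>" "0 < \<beta>" using assms(12,13) by auto
  \<comment> \<open>By uniqueness this witness is the operator
    \<open>L2_extension (jb_conj \<sigma> \<gamma>\<^sub>0)\<close>, so the given decomposition
    \<open>a\<close>, \<open>u\<close>, \<open>v\<close> belongs to it.\<close>
  obtain A where A: "A \<in> schatten \<alpha>" "extends_to (jb_conj \<sigma> \<gamma>\<^sub>0) A"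
    using DiffD1[OF assms(14)] unfolding schatten_sobolev_def by blast
  have A\<beta>: "A \<notin> schatten \<beta>"
    using DiffD2[OF assms(14)] A(2) unfolding schatten_sobolev_def by blast
  have comp: "compact_operator A" using A(1) by (simp add: schatten_def)
  have svd: "svd A a u v" using assms(15) unfolding L2_extension_eqI[OF A(2)] .
  have a: "0 \<le> a n" for n using svd by (simp add: svd_def)
  have o: "orthonormal_seq u" "orthonormal_seq v" using svd by (auto simp: svd_def)
  have sum: "(\<lambda>n. a n powr \<alpha>) summable_on UNIV" "\<not> (\<lambda>n. a n powr \<beta>) summable_on UNIV"
    using A(1) A\<beta> schatten_svd_iff[OF svd comp] \<alpha>\<beta> by auto
  have op: "L2_operator A" using comp by (simp add: compact_operator_def)
  obtain K where K: "sv_system a u v K" using svd_sv_system[OF svd op] .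
  have aK: "a n \<le> K" for n using sv_system.q[OF K, of n] by linarith
  have g: "M.random_variable borel (g n)" for n using indep unfolding M.indep_vars_def by blast
  have "AE \<omega> in M. (\<lambda>n. (a n * \<bar>g n \<omega>\<bar>) powr \<alpha>) summable_on UNIV"
    using \<alpha>\<beta> by (intro M.AE_summable_subgaussian_weights[OF g _ a subgauss sum(1)]) auto
  moreover have "AE \<omega> in M. \<not> (\<lambda>n. (a n * \<bar>g n \<omega>\<bar>) powr \<beta>) summable_on UNIV"
    by (rule M.AE_not_summable_randomized[OF indep assms(8,9) a aK \<alpha>\<beta>(2) sum(2)])
  ultimately have AE_M: "AE \<omega> in M. (\<lambda>n. (a n * \<bar>g n \<omega>\<bar>) powr \<alpha>) summable_on UNIV \<and>
      \<not> (\<lambda>n. (a n * \<bar>g n \<omega>\<bar>) powr \<beta>) summable_on UNIV"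
    by eventually_elim simp
  \<comment> \<open>The lattice is countable, so outside one null set all values are signs.\<close>
  have AE_N: "AE \<omega>' in N. \<forall>k. \<bar>h k \<omega>'\<bar> = 1"
    unfolding AE_all_countable by (intro allI rademacher_AE assms)
  have "AE z in M \<Otimes>\<^sub>M N. ((\<lambda>n. (a n * \<bar>g n (fst z)\<bar>) powr \<alpha>) summable_on UNIV \<and>
      \<not> (\<lambda>n. (a n * \<bar>g n (fst z)\<bar>) powr \<beta>) summable_on UNIV) \<and> (\<forall>k. \<bar>h k (snd z)\<bar> = 1)"
    by (rule AE_pair_prob_space[OF assms(1,2) AE_M AE_N])
  then show ?thesis
  proof eventually_elim
    case (elim z)
    obtain \<omega> \<omega>' where z: "z = (\<omega>, \<omega>')" by (cases z)
    let ?R = "randomize a u v (\<lambda>n. g n \<omega>) (\<lambda>k. h k \<omega>')"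
    have R: "?R \<in> schatten \<alpha> - schatten \<beta>"
      using elim unfolding z by (intro randomize_schatten o a \<alpha>\<beta>) auto
    then have "L2_operator ?R" by (simp add: schatten_def compact_operator_def)
    then have ext: "extends_to (jb_conj \<sigma> (randomize_sobolev \<sigma> a u v (\<lambda>n. g n \<omega>) (\<lambda>k. h k \<omega>'))) ?R"
      unfolding randomize_sobolev_def by (rule extends_to_jb_conj)
    have "jb_conj \<sigma> (randomize_sobolev \<sigma> a u v (\<lambda>n. g n \<omega>) (\<lambda>k. h k \<omega>'))
        \<in> schatten_sobolev \<alpha> - schatten_sobolev \<beta>"
    proof
      show "jb_conj \<sigma> (randomize_sobolev \<sigma> a u v (\<lambda>n. g n \<omega>) (\<lambda>k. h k \<omega>')) \<in> schatten_sobolev \<alpha>"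
        unfolding schatten_sobolev_def using DiffD1[OF R] ext by blast
      \<comment> \<open>Every operator extending the form has to be excluded; by uniqueness
        \<open>?R\<close> is the only candidate.\<close>
      show "jb_conj \<sigma> (randomize_sobolev \<sigma> a u v (\<lambda>n. g n \<omega>) (\<lambda>k. h k \<omega>')) \<notin> schatten_sobolev \<beta>"
      proof
        assume "jb_conj \<sigma> (randomize_sobolev \<sigma> a u v (\<lambda>n. g n \<omega>) (\<lambda>k. h k \<omega>')) \<in> schatten_sobolev \<beta>"
        then obtain B where B: "B \<in> schatten \<beta>"
          "extends_to (jb_conj \<sigma> (randomize_sobolev \<sigma> a u v (\<lambda>n. g n \<omega>) (\<lambda>k. h k \<omega>'))) B"
          unfolding schatten_sobolev_def by blast
        then show False using DiffD2[OF R] extends_to_unique[OF ext B(2)] by simp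
      qed
    qed
    then show ?case unfolding z by simp
  qed
qed

end
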